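(* Let $\Gamma$ be a Riemann surface of genus $g$ with divisors $P=P_1+\dots+P_n$, $D=\gamma_1+\dots+\gamma_{g+l}$, $R=r+r_1+\dots+r_l$, with local parameters $k_i^{-1}$ in neighborhoods of $P_i$, $i=1,\dots,n$, and let $Q_1,\dots,Q_{n+1}$ be $n+1$ points on $\Gamma$. Let $\psi(u_1,\dots,u_n,S)$ be the $n$-point Baker--Akhiezer function corresponding to the spectral data $\{\Gamma,P_1,\dots,P_n,k_1,\dots,k_n,D,R\}$, with normalization constant $h=\psi(r)\neq 0$ at $r$ and $\psi(r_j)=0$ for $j=1,\dots,l$. Assume that there exists a holomorphic involution $\sigma:\Gamma\to\Gamma$ with stationary points $Q_1,\dots,Q_{n+1},P_1,\dots,P_n$ and $r$, which in some neighborhood of $P_i$ acts as $\sigma(k_i)=-k_i$, $i=1,\dots,n$. Assume that there exists a 1-form $\Omega$ on $\Gamma$ with divisor $$(\Omega)=D+\sigma D+P-Q_1-\dots-Q_{n+1}-R-\sigma r_1-\dots-\sigma r_l .$$ Put $A_i=\operatorname{Res}_{Q_i}\Omega$, $B=\operatorname{Res}_r\Omega$; let $C_i$ be defined from the expansion $\big(-C_i k_i^{-1}+\dots\big)\,dk_i^{-1}$ of the form $\Omega$ in a neighborhood of $P_i$, $i=1,\dots,n$; and let $f_j(u_1,\dots,u_n)$, $j=1,\dots,n$, be the first coefficient of the expansion $e^{-u_jk_j}\psi=f_j+\frac{g_j}{k_j}+\dots$ in a neighborhood of $P_j$. Then $$\sum_{k=1}^{n+1}\psi(Q_k)^2A_k+h^2B=0,$$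 $$\sum_{k=1}^{n+1}\psi_{u_i}(Q_k)\,\psi_{u_j}(Q_k)\,A_k=0,\qquad i,j=1,\dots,n,\ i\neq j,$$ $$\sum_{k=1}^{n+1}\psi_{u_i}^2(Q_k)\,A_k=C_if_i^2,\qquad i=1,\dots,n,$$ where $\psi(Q_k)=\psi(u_1,\dots,u_n,Q_k)$ and $\psi_{u_i}=\partial\psi/\partial u_i$.
   Context: The $n$-point Baker--Akhiezer function $\psi(u_1,\dots,u_n,S)$ ($u_1,\dots,u_n$ real variables, $S\in\Gamma$) corresponding to spectral data $\{\Gamma,P_1,\dots,P_n,k_1,\dots,k_n,D,R\}$, where $D=\gamma_1+\dots+\gamma_{g+l}$ and $R=r+r_1+\dots+r_l$, is a function with the following properties: (1) in neighborhoods of $P_1,\dots,P_n$ it has essential singularities of the form $\psi=e^{k_ju_j}\left(f_j+\frac{g_j}{k_j}+\dots\right)$, $j=1,\dots,n$, with $f_j,g_j,\dots$ functions of $u_1,\dots,u_n$; (2) $\psi$ is meromorphic on $\Gamma\setminus\{P_1,\dots,P_n\}$ with simple poles on $D$; (3) $\psi(u_1,\dots,u_n,r)=h$, where $h$ is a nonzero constant, and $\psi(u_1,\dots,u_n,r_i)=0$ for $i=1,\dots,l$. The involution $\sigma$ acts on divisors pointwise.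
   Formalization: Sign of C_i corrected: expansion (C_i k_i^{-1}+...)dk_i^{-1}, as the third identity fails otherwise. Made explicit: P_i, Q_k, r distinct; Q_k not in D or among the r_j; r, r_j not in P or D; repeated r_j are zeros with multiplicity; psi and psi_{u_i} continuous in (u,S) off P and D. *)

theory Defs
  imports "HOL-Complex_Analysis.Complex_Analysis" "HOL-Homology.Homology"
begin

text \<open>A chart is a pair of a domain and a coordinate function; the values of the coordinate
  function outside the domain are irrelevant.\<close>

type_synonym 'a chart = "'a set \<times> ('a \<Rightarrow> complex)"

abbreviation chart_inv :: "'a chart \<Rightarrow> complex \<Rightarrow> 'a" where
  "chart_inv c \<equiv> inv_into (fst c) (snd c)"

definition complex_chart :: "'a topology \<Rightarrow> 'a chart \<Rightarrow> bool" where
  "complex_chart X c \<longleftrightarrow>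
     openin X (fst c) \<and> open (snd c ` fst c) \<and>
     homeomorphic_map (subtopology X (fst c)) (top_of_set (snd c ` fst c)) (snd c)"

definition holomorphic_transition :: "'a chart \<Rightarrow> 'a chart \<Rightarrow> bool" where
  "holomorphic_transition c d \<longleftrightarrow>
     (snd d \<circ> chart_inv c) holomorphic_on snd c ` (fst c \<inter> fst d)"

text \<open>The atlas is maximal, so that a local parameter at a point \<open>p\<close> is the same thing as a
  chart of the atlas that vanishes at \<open>p\<close>.  Second countability is automatic (Rado).\<close>

definition riemann_surface :: "'a topology \<Rightarrow> 'a chart set \<Rightarrow> bool" where
  "riemann_surface X At \<longleftrightarrow>
     topspace X \<noteq> {} \<and> connected_space X \<and> Hausdorff_space X \<and>
     (\<forall>c\<in>At. complex_chart X c) \<and>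
     (\<Union>c\<in>At. fst c) = topspace X \<and>
     (\<forall>c\<in>At. \<forall>d\<in>At. holomorphic_transition c d) \<and>
     (\<forall>c. complex_chart X c \<and>
          (\<forall>d\<in>At. holomorphic_transition c d \<and> holomorphic_transition d c) \<longrightarrow> c \<in> At)"

definition has_genus :: "'a topology \<Rightarrow> nat \<Rightarrow> bool" where
  "has_genus X g \<longleftrightarrow> homology_group 1 X \<cong> free_Abelian_group {..<2 * g}"

definition local_parameter :: "'a chart set \<Rightarrow> 'a \<Rightarrow> 'a chart \<Rightarrow> bool" where
  "local_parameter At p c \<longleftrightarrow> c \<in> At \<and> p \<in> fst c \<and> snd c p = 0"

definition holomorphic_self_map ::
    "'a topology \<Rightarrow> 'a chart set \<Rightarrow> ('a \<Rightarrow> 'a) \<Rightarrow> bool" where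
  "holomorphic_self_map X At \<sigma> \<longleftrightarrow> continuous_map X X \<sigma> \<and>
     (\<forall>c\<in>At. \<forall>d\<in>At.
        (snd d \<circ> \<sigma> \<circ> chart_inv c) holomorphic_on snd c ` {p \<in> fst c. \<sigma> p \<in> fst d})"

definition holomorphic_involution ::
    "'a topology \<Rightarrow> 'a chart set \<Rightarrow> ('a \<Rightarrow> 'a) \<Rightarrow> bool" where
  "holomorphic_involution X At \<sigma> \<longleftrightarrow>
     holomorphic_self_map X At \<sigma> \<and> (\<forall>p\<in>topspace X. \<sigma> (\<sigma> p) = p)"

definition holomorphic_fun_on :: "'a chart set \<Rightarrow> 'a set \<Rightarrow> ('a \<Rightarrow> complex) \<Rightarrow> bool" where
  "holomorphic_fun_on At W f \<longleftrightarrow>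
     (\<forall>c\<in>At. (f \<circ> chart_inv c) holomorphic_on snd c ` (fst c \<inter> W))"

text \<open>The function \<open>f\<close> is meromorphic at \<open>p\<close>, of order at least \<open>m\<close>; a function vanishing
  identically near \<open>p\<close> has infinite order.\<close>

definition fun_order_ge :: "'a chart set \<Rightarrow> ('a \<Rightarrow> complex) \<Rightarrow> 'a \<Rightarrow> int \<Rightarrow> bool" where
  "fun_order_ge At f p m \<longleftrightarrow>
     (\<forall>c\<in>At. p \<in> fst c \<longrightarrow>
        (\<exists>F. (\<lambda>w. f (chart_inv c (snd c p + w))) has_laurent_expansion F \<and>
             (F = 0 \<or> m \<le> fls_subdegree F)))"

text \<open>Divisors are elements of the free abelian group \<open>'a \<Rightarrow>\<^sub>0 int\<close> on the points;
  \<open>frag_of p\<close> is the divisor \<open>p\<close>.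

  A meromorphic 1-form is given by its coefficient in each chart: it is \<open>\<Omega> c w dw\<close> in terms of
  the coordinate \<open>w = snd c\<close>.  As the values of a meromorphic coefficient at isolated points
  carry no meaning, the transformation law is required on punctured neighbourhoods.\<close>

definition meromorphic_form ::
    "'a chart set \<Rightarrow> ('a chart \<Rightarrow> complex \<Rightarrow> complex) \<Rightarrow> bool" where
  "meromorphic_form At \<Omega> \<longleftrightarrow>
     (\<forall>c\<in>At. \<Omega> c meromorphic_on snd c ` fst c) \<and>
     (\<forall>c\<in>At. \<forall>d\<in>At. \<forall>p\<in>fst c \<inter> fst d.
        \<forall>\<^sub>F w in at (snd c p).
          \<Omega> c w = \<Omega> d (snd d (chart_inv c w)) * deriv (snd d \<circ> chart_inv c) w)"

definition form_divisor ::
    "'a chart set \<Rightarrow> ('a chart \<Rightarrow> complex \<Rightarrow> complex) \<Rightarrow> ('a \<Rightarrow>\<^sub>0 int) \<Rightarrow> bool" where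
  "form_divisor At \<Omega> E \<longleftrightarrow>
     (\<forall>c\<in>At. \<forall>p\<in>fst c.
        (\<exists>\<^sub>F w in at (snd c p). \<Omega> c w \<noteq> 0) \<and> zorder (\<Omega> c) (snd c p) = Poly_Mapping.lookup E p)"

text \<open>The residue of a form does not depend on the chart used to compute it.\<close>

definition form_residue ::
    "'a chart set \<Rightarrow> ('a chart \<Rightarrow> complex \<Rightarrow> complex) \<Rightarrow> 'a \<Rightarrow> complex" where
  "form_residue At \<Omega> p =
     (let c = (SOME c. c \<in> At \<and> p \<in> fst c) in residue (\<Omega> c) (snd c p))"

text \<open>With \<open>w = 1/k\<close> the local parameter \<open>c\<close>, this is the number \<open>C\<close> in
  \<open>\<Omega> = (\<dots> + C w + \<dots>) dw\<close>, that is \<open>\<Omega> = (\<dots> - C k\<^sup>-\<^sup>3 + \<dots>) dk\<close>.  The sign matters: if \<open>\<psi> = exp (k u) (f + \<dots>)\<close> and \<open>k\<close> is odd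
  under the involution \<open>\<sigma>\<close>, then \<open>\<psi>\<^sub>u (S) \<psi>\<^sub>u (\<sigma> S) \<Omega> = (- k\<^sup>2 f\<^sup>2 + \<dots>) (C w + \<dots>) dw\<close> has residue \<open>- C f\<^sup>2\<close>.\<close>

definition form_linear_coeff ::
    "('a chart \<Rightarrow> complex \<Rightarrow> complex) \<Rightarrow> 'a chart \<Rightarrow> complex" where
  "form_linear_coeff \<Omega> c = fls_nth (laurent_expansion (\<Omega> c) 0) 1"

definition partial_u ::
    "'n::finite \<Rightarrow> (real^'n \<Rightarrow> 'a \<Rightarrow> complex) \<Rightarrow> real^'n \<Rightarrow> 'a \<Rightarrow> complex" where
  "partial_u i \<psi> u S = vector_derivative (\<lambda>t. \<psi> (u + t *\<^sub>R axis i 1) S) (at 0)"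

text \<open>The function \<open>exp (- k u\<^sub>j) \<psi>\<close> in terms of the local parameter \<open>w = 1/k\<close>.\<close>

definition regular_part ::
    "(real^'n \<Rightarrow> 'a \<Rightarrow> complex) \<Rightarrow> 'a chart \<Rightarrow> 'n \<Rightarrow> real^'n \<Rightarrow> complex \<Rightarrow> complex" where
  "regular_part \<psi> c j u w = exp (- (of_real (u $ j) / w)) * \<psi> u (chart_inv c w)"

definition BA_leading_coeff ::
    "(real^'n \<Rightarrow> 'a \<Rightarrow> complex) \<Rightarrow> 'a chart \<Rightarrow> 'n \<Rightarrow> real^'n \<Rightarrow> complex" where
  "BA_leading_coeff \<psi> c j u = fls_nth (laurent_expansion (regular_part \<psi> c j u) 0) 0"

text \<open>
  The spectral data are the points \<open>P j\<close> with local parameters \<open>\<kappa> j = 1/k\<^sub>j\<close>, the pole divisor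
  \<open>D\<close>, the normalization point \<open>r\<close> and the divisor \<open>Z\<close> of prescribed zeros; in the usual notation
  \<open>R = r + Z\<close>.  Points that are repeated in \<open>D\<close> or \<open>Z\<close> count with multiplicity; when they are not
  repeated, the poles are simple and the zeros are just points where \<open>\<psi>\<close> vanishes.  The values of
  \<open>\<psi> u\<close> at the points of \<open>P\<close> and \<open>D\<close> are irrelevant.

  The variables \<open>u\<close> range over an open set \<open>U\<close>, as a Baker--Akhiezer function may become singular
  at some \<open>u\<close>.  That \<open>\<psi>\<close> depends smoothly on \<open>u\<close> is required in the form that \<open>\<psi>\<close> and its first
  partial derivatives in \<open>u\<close> are continuous in \<open>(u, S)\<close> away from \<open>P\<close> and \<open>D\<close>.\<close>

definition baker_akhiezer ::
    "'a topology \<Rightarrow> 'a chart set \<Rightarrow> ('n::finite \<Rightarrow> 'a) \<Rightarrow> ('n \<Rightarrow> 'a chart) \<Rightarrow>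
     ('a \<Rightarrow>\<^sub>0 int) \<Rightarrow> 'a \<Rightarrow> ('a \<Rightarrow>\<^sub>0 int) \<Rightarrow> complex \<Rightarrow> (real^'n) set \<Rightarrow>
     (real^'n \<Rightarrow> 'a \<Rightarrow> complex) \<Rightarrow> bool" where
  "baker_akhiezer X At P \<kappa> D r Z h U \<psi> \<longleftrightarrow>
     (let W = topspace X - (range P \<union> Poly_Mapping.keys D) in
       open U \<and> r \<in> W \<and> Poly_Mapping.keys Z \<subseteq> W \<and> h \<noteq> 0 \<and>
       (\<forall>u\<in>U.
          (\<forall>j. \<exists>F. regular_part \<psi> (\<kappa> j) j u has_laurent_expansion fps_to_fls F) \<and>
          holomorphic_fun_on At W (\<psi> u) \<and>
          (\<forall>p\<in>Poly_Mapping.keys D - range P.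
             fun_order_ge At (\<psi> u) p (- Poly_Mapping.lookup D p)) \<and>
          \<psi> u r = h \<and>
          (\<forall>p\<in>Poly_Mapping.keys Z.
             \<psi> u p = 0 \<and> fun_order_ge At (\<psi> u) p (Poly_Mapping.lookup Z p))) \<and>
       (\<forall>u\<in>U. \<forall>S\<in>W. \<forall>i. (\<lambda>t. \<psi> (u + t *\<^sub>R axis i 1) S) differentiable (at 0)) \<and>
       continuous_map (prod_topology (top_of_set U) (subtopology X W)) euclidean
         (\<lambda>(u, S). \<psi> u S) \<and>
       (\<forall>i. continuous_map (prod_topology (top_of_set U) (subtopology X W)) euclidean
              (\<lambda>(u, S). partial_u i \<psi> u S)))"

end

theory Submission
  imports Defs
begin

text \<open>
  The three identities say that the residues of \<open>\<psi> (S) \<psi> (\<sigma> S) \<Omega>\<close> and of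
  \<open>\<psi>\<^sub>i (S) \<psi>\<^sub>j (\<sigma> S) \<Omega>\<close>, where \<open>\<psi>\<^sub>i\<close> is the derivative in \<open>u\<^sub>i\<close>, add up to zero.  The
  divisor of \<open>\<Omega>\<close> cancels the poles on \<open>D\<close> and \<open>\<sigma> D\<close>, and the essential singularities cancel since
  \<open>\<sigma>\<close> changes the sign of the local parameters at the points \<open>P\<close>.

  The residue theorem itself is obtained from a nonconstant meromorphic function \<open>x\<close>: for a form \<open>\<omega>\<close>
  the total residue of \<open>x \<omega> / (x - y)\<close> is, locally in \<open>y\<close>, a finite sum of integrals over fixed circles,
  hence an entire function of \<open>y\<close>.  It tends to zero at infinity, so it vanishes by Liouville's theorem,
  and at \<open>y = 0\<close> it is the total residue of \<open>\<omega>\<close>.  A logarithmic derivative \<open>\<psi>\<^sub>i / \<psi>\<close> serves as \<open>x\<close>.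
  That \<open>\<psi>\<^sub>i\<close> is meromorphic with the expected expansions follows by differentiating Cauchy's formula
  for \<open>\<psi>\<close> in the parameter.
\<close>

section \<open>Residues and integrals depending on a parameter\<close>

text \<open>Two obstacles shape the proof. First, the existence of a nonconstant meromorphic
  function on an abstract compact surface is a theorem of its own; here the data supply one, because
  \<psi> really depends on each variable. The argument gives nonconstancy only for some parameter
  \<open>u'\<close> in \<open>U\<close>, possibly different from the given \<open>u\<close>, which
  is harmless since the residue theorem concerns the surface alone. Multiplying the form by
  \<open>x\<close> before dividing by \<open>x - y\<close> makes the value at \<open>y = 0\<close>
  the total residue of the form itself and not of its quotient by \<open>x\<close>. Second, the
  derivative in \<open>u\<close> is controlled only away from \<open>P\<close> and \<open>D\<close>,
  so no growth bound near these points is available. A factor that removes the singularity of \<psi>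
  for all nearby parameters (a power of the coordinate, or an exponential that moves with
  \<open>u\<close>) reduces the question to a family of functions holomorphic across the point, and
  Cauchy's formula then needs the derivative only on a circle around it.\<close>

lemma residue_compose:
  assumes f: "isolated_singularity_at f (\<phi> z)" and \<phi>: "\<phi> analytic_on {z}" and d: "deriv \<phi> z \<noteq> 0"
  shows "residue (\<lambda>w. f (\<phi> w) * deriv \<phi> w) z = residue f (\<phi> z)"
proof -
  define z0 where "z0 = \<phi> z"
  obtain R where R: "R > 0" "f analytic_on ball z0 R - {z0}"
    using f by (auto simp: isolated_singularity_at_def z0_def)
  have fh: "f holomorphic_on ball z0 R - {z0}"
    using R(2) analytic_imp_holomorphic by blast
  obtain r1 where r1: "r1 > 0" "\<phi> holomorphic_on ball z r1"
    using \<phi> by (auto simp: analytic_on_def)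
  obtain r2 where r2: "r2 > 0" "inj_on \<phi> (ball z r2)"
    using has_complex_derivative_locally_injective[of \<phi> "ball z r1" z] r1 d by auto
  have cont: "continuous_on (ball z r1) \<phi>" using r1 holomorphic_on_imp_continuous_on by blast
  have "open (ball z r1 \<inter> \<phi> -` ball z0 R)"
    using continuous_open_preimage[OF cont] by auto
  moreover have "z \<in> ball z r1 \<inter> \<phi> -` ball z0 R" using r1 R by (auto simp: z0_def)
  ultimately obtain r3 where r3: "r3 > 0" "ball z r3 \<subseteq> ball z r1 \<inter> \<phi> -` ball z0 R"
    by (meson open_contains_ball)
  define r where "r = min r2 r3"
  define \<rho> where "\<rho> = r / 2"
  have r: "r > 0" "\<rho> > 0" "\<rho> < r" using r2 r3 by (auto simp: r_def \<rho>_def)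
  have hol: "\<phi> holomorphic_on ball z r"
    by (rule holomorphic_on_subset[OF r1(2)]) (use r3 in \<open>auto simp: r_def\<close>)
  have inj: "inj_on \<phi> (ball z r)" by (rule inj_on_subset[OF r2(2)]) (auto simp: r_def)
  have im: "\<phi> w \<in> ball z0 R" if "w \<in> ball z r" for w using r3 that by (auto simp: r_def)
  have ne: "\<phi> w \<noteq> z0" if "w \<in> ball z r" "w \<noteq> z" for w
    using inj that r(1) unfolding z0_def inj_on_def by (metis centre_in_ball)
  have dh: "deriv \<phi> holomorphic_on ball z r" using hol by (simp add: holomorphic_deriv)
  define \<gamma> where "\<gamma> = circlepath z \<rho>"
  have \<gamma>im: "path_image \<gamma> \<subseteq> ball z r - {z}" using r by (auto simp: \<gamma>_def)
  have vp: "valid_path \<gamma>" by (simp add: \<gamma>_def)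
  have vp': "valid_path (\<phi> \<circ> \<gamma>)"
    by (rule valid_path_compose_holomorphic[OF vp hol]) (use \<gamma>im in auto)
  have pim: "path_image (\<phi> \<circ> \<gamma>) \<subseteq> ball z0 R - {z0}"
    using \<gamma>im im ne unfolding path_image_compose by blast
  have comp: "contour_integral (\<phi> \<circ> \<gamma>) g = 2 * pi * \<i> * residue (\<lambda>w. g (\<phi> w) * deriv \<phi> w) z"
    if g: "g holomorphic_on ball z0 R - {z0}" for g
  proof -
    have "contour_integral (\<phi> \<circ> \<gamma>) g = contour_integral \<gamma> (\<lambda>w. deriv \<phi> w * g (\<phi> w))"
      by (rule contour_integral_comp_analyticW[OF _ vp, of _ "ball z r"])
         (use \<gamma>im hol in \<open>auto simp: analytic_on_open\<close>)
    also have "\<dots> = contour_integral \<gamma> (\<lambda>w. g (\<phi> w) * deriv \<phi> w)" by (simp add: mult.commute)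
    also have "\<dots> = 2 * pi * \<i> * residue (\<lambda>w. g (\<phi> w) * deriv \<phi> w) z"
      unfolding \<gamma>_def
    proof (rule contour_integral_unique, rule base_residue)
      have "(g \<circ> \<phi>) holomorphic_on (ball z r - {z})"
      proof (rule holomorphic_on_compose_gen[OF _ g])
        show "\<phi> holomorphic_on ball z r - {z}" using hol by (rule holomorphic_on_subset) auto
        show "\<phi> ` (ball z r - {z}) \<subseteq> ball z0 R - {z0}" using im ne by blast
      qed
      then show "(\<lambda>w. g (\<phi> w) * deriv \<phi> w) holomorphic_on (ball z r - {z})"
        by (auto intro!: holomorphic_intros holomorphic_on_subset[OF dh] simp: o_def)
    qed (use r in auto)
    finally show ?thesis .
  qed
  \<comment> \<open>The substitution rule \<open>comp\<close> applied to \<open>1 / (w - z0)\<close>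
    computes the winding number: the pull-back is the logarithmic derivative of
    \<open>\<phi> - z0\<close>, which has a simple pole with residue 1 because the derivative of
    \<phi> does not vanish.\<close>
  have wn: "winding_number (\<phi> \<circ> \<gamma>) z0 = 1"
  proof -
    have "winding_number (\<phi> \<circ> \<gamma>) z0 = 1 / (2 * pi * \<i>) * contour_integral (\<phi> \<circ> \<gamma>) (\<lambda>w. 1 / (w - z0))"
      by (rule winding_number_valid_path[OF vp']) (use pim in auto)
    also have "contour_integral (\<phi> \<circ> \<gamma>) (\<lambda>w. 1 / (w - z0)) = 2 * pi * \<i> * residue (\<lambda>w. 1 / (\<phi> w - z0) * deriv \<phi> w) z"
      by (rule comp) (auto intro!: holomorphic_intros)
    also have "residue (\<lambda>w. 1 / (\<phi> w - z0) * deriv \<phi> w) z = 1"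
    proof (rule residue_simple'[of "ball z r"])
      show "(\<lambda>w. 1 / (\<phi> w - z0) * deriv \<phi> w) holomorphic_on ball z r - {z}"
        by (intro holomorphic_intros holomorphic_on_subset[OF dh] holomorphic_on_subset[OF hol]) (use ne in auto)
      have "(\<phi> has_field_derivative deriv \<phi> z) (at z)"
        using hol r by (simp add: holomorphic_derivI)
      then have "((\<lambda>w. (\<phi> w - z0) / (w - z)) \<longlongrightarrow> deriv \<phi> z) (at z)"
        by (simp add: has_field_derivative_iff z0_def)
      moreover have "(deriv \<phi> \<longlongrightarrow> deriv \<phi> z) (at z)"
      proof -
        have "isCont (deriv \<phi>) z"
          by (metis centre_in_ball continuous_on_eq_continuous_at dh holomorphic_on_imp_continuous_on open_ball r(1))
        then show ?thesis by (simp add: isCont_def)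
      qed
      ultimately have "((\<lambda>w. deriv \<phi> w / ((\<phi> w - z0) / (w - z))) \<longlongrightarrow> deriv \<phi> z / deriv \<phi> z) (at z)"
        using d by (intro tendsto_divide)
      then show "((\<lambda>w. 1 / (\<phi> w - z0) * deriv \<phi> w * (w - z)) \<longlongrightarrow> 1) (at z)"
        using d by simp
    qed (use r in auto)
    finally show ?thesis by (simp add: o_def)
  qed
  have "contour_integral (\<phi> \<circ> \<gamma>) f = 2 * pi * \<i> * (\<Sum>p\<in>{z0}. winding_number (\<phi> \<circ> \<gamma>) p * residue f p)"
  proof (rule Residue_theorem[OF _ _ _ fh vp'])
    show "pathfinish (\<phi> \<circ> \<gamma>) = pathstart (\<phi> \<circ> \<gamma>)" by (simp add: \<gamma>_def pathfinish_compose pathstart_compose)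
    show "\<forall>w. w \<notin> ball z0 R \<longrightarrow> winding_number (\<phi> \<circ> \<gamma>) w = 0"
      using winding_number_zero_outside[OF valid_path_imp_path[OF vp'], of "ball z0 R"] pim
      by (auto simp: \<gamma>_def pathfinish_compose pathstart_compose)
  qed (use pim in auto)
  then show ?thesis using comp[OF fh] wn by (simp add: z0_def)
qed

text \<open>The sum runs over the points of nonzero residue and not over all singularities, so that
  it depends on the residues alone; \<open>total_residue\<close> counts in the same way.\<close>

lemma residue_circle:
  assumes f: "f meromorphic_on cball z r" and r: "r > 0" and s: "f analytic_on sphere z r"
  shows "finite {w \<in> ball z r. residue f w \<noteq> 0}"
    and "contour_integral (circlepath z r) f = 2 * pi * \<i> * (\<Sum>w | w \<in> ball z r \<and> residue f w \<noteq> 0. residue f w)"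
proof -
  obtain B where B: "open B" "cball z r \<subseteq> B" "f meromorphic_on B"
    using meromorphic_on_open_nhd[OF f] by auto
  obtain r' where r': "r' > r" "cball z r' \<subseteq> B"
  proof -
    obtain e where e: "e > 0" "(\<Union>x\<in>cball z r. ball x e) \<subseteq> B"
      using compact_subset_open_imp_ball_epsilon_subset[of "cball z r" B] B compact_cball by blast
    have "cball z (r + e/2) \<subseteq> (\<Union>x\<in>cball z r. ball x e)"
    proof
      fix w assume w: "w \<in> cball z (r + e/2)"
      show "w \<in> (\<Union>x\<in>cball z r. ball x e)"
      proof (cases "w \<in> cball z r")
        case False
        then have n: "norm (w - z) > r" by (auto simp: dist_norm norm_minus_commute)
        \<comment> \<open>The radial projection of \<open>w\<close> onto the circle:
          \<open>w\<close> lies within \<open>e/2\<close> of it, so a neighbourhood of the closed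
          disc contains a larger concentric disc.\<close>
        define x where "x = z + (r / norm (w - z)) *\<^sub>R (w - z)"
        have xr: "dist z x = r" using r n by (auto simp: x_def dist_norm)
        have "w - x = (1 - r / norm (w - z)) *\<^sub>R (w - z)"
          by (simp add: x_def algebra_simps)
        moreover have "r / norm (w - z) \<le> 1" using r n by (subst divide_le_eq_1_pos) linarith+
        ultimately have "dist x w = (1 - r / norm (w - z)) * norm (w - z)"
          using \<open>r / norm (w - z) \<le> 1\<close> by (simp add: dist_norm norm_minus_commute[of x])
        then have "dist x w = norm (w - z) - r" using r n by (auto simp: algebra_simps split: if_splits)
        then show ?thesis using w e(1) xr
          by (auto intro!: bexI[of _ x] simp: dist_norm norm_minus_commute)
      next
        case True
        then show ?thesis using e(1) by force
      qed
    qed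
    then show ?thesis using that[of "r + e/2"] e by auto
  qed
  define pts where "pts = {w \<in> cball z r'. \<not> f analytic_on {w}}"
  have mero': "f meromorphic_on cball z r'" using B r' meromorphic_on_subset by blast
  \<comment> \<open>An infinite subset of the compact disc would have a limit point there, which
    sparseness forbids.\<close>
  have fin: "finite pts"
  proof -
    have "pts sparse_in cball z r'"
      unfolding pts_def by (rule meromorphic_on_imp_sparse_singularities'[OF mero'])
    then have "\<not> x islimpt pts" if "x \<in> cball z r'" for x
      using that by (auto simp: sparse_in_def)
    moreover have "pts \<subseteq> cball z r'" by (auto simp: pts_def)
    ultimately show ?thesis
      using Heine_Borel_imp_Bolzano_Weierstrass[of "cball z r'" pts] compact_cball by blast
  qed
  have ana: "f analytic_on {w}" if "w \<in> cball z r'" "w \<notin> pts" for w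
    using that by (auto simp: pts_def)
  have hol: "f holomorphic_on ball z r' - pts"
    by (rule analytic_imp_holomorphic, subst analytic_on_analytic_at) (use ana in auto)
  have sph: "sphere z r \<inter> pts = {}"
    using s unfolding pts_def by (subst (asm) analytic_on_analytic_at) auto
  have zero: "residue f w = 0" if "w \<in> cball z r'" "w \<notin> pts" for w
    using ana[OF that] by (auto simp: analytic_at intro: residue_holo)
  have sub: "{w \<in> ball z r. residue f w \<noteq> 0} \<subseteq> pts"
  proof
    fix w assume w: "w \<in> {w \<in> ball z r. residue f w \<noteq> 0}"
    then have "w \<in> cball z r'" using r'(1) by auto
    with w show "w \<in> pts" using zero[of w] by auto
  qed
  then show "finite {w \<in> ball z r. residue f w \<noteq> 0}" using fin finite_subset by blast
  have "contour_integral (circlepath z r) f = 2 * pi * \<i> * (\<Sum>p\<in>pts. winding_number (circlepath z r) p * residue f p)"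
  proof (rule Residue_theorem[OF _ _ fin hol])
    show "path_image (circlepath z r) \<subseteq> ball z r' - pts" using sph r' r by auto
    show "\<forall>w. w \<notin> ball z r' \<longrightarrow> winding_number (circlepath z r) w = 0"
      by (intro allI impI winding_number_zero_outside[of _ "cball z r"]) (use r r' in auto)
  qed auto
  also have "(\<Sum>p\<in>pts. winding_number (circlepath z r) p * residue f p) =
     (\<Sum>w | w \<in> ball z r \<and> residue f w \<noteq> 0. residue f w)"
  proof (rule sum.mono_neutral_cong_right[OF fin sub])
    show "\<forall>i\<in>pts - {w \<in> ball z r. residue f w \<noteq> 0}. winding_number (circlepath z r) i * residue f i = 0"
    proof
      fix i assume i: "i \<in> pts - {w \<in> ball z r. residue f w \<noteq> 0}"
      show "winding_number (circlepath z r) i * residue f i = 0"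
      proof (cases "i \<in> ball z r")
        case False
        with i sph have "i \<notin> cball z r" by auto
        then have "winding_number (circlepath z r) i = 0"
          by (intro winding_number_zero_outside[of _ "cball z r"]) (use r in auto)
        then show ?thesis by simp
      qed (use i in auto)
    qed
    fix i assume i: "i \<in> {w \<in> ball z r. residue f w \<noteq> 0}"
    then have "winding_number (circlepath z r) i = 1"
      by (intro winding_number_circlepath) (auto simp: dist_norm norm_minus_commute)
    then show "winding_number (circlepath z r) i * residue f i = residue f i" by simp
  qed
  finally show "contour_integral (circlepath z r) f = 2 * pi * \<i> * (\<Sum>w | w \<in> ball z r \<and> residue f w \<noteq> 0. residue f w)" .
qed

text \<open>As long as \<open>y\<close> stays off the values of \<open>x\<close> on the circle, the
  integrand can be differentiated in \<open>y\<close> under the integral sign; for large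
  \<open>y\<close> the denominator grows like \<open>y\<close>. The closed set \<open>L\<close> may
  be larger than the image of the circle, so that several circles can share one exceptional
  set.\<close>

lemma circle_integral_quotient:
  assumes r: "r > 0" and g: "continuous_on (sphere z r) g" and x: "continuous_on (sphere z r) x"
    and L: "closed L" "x ` sphere z r \<subseteq> L"
  shows circle_integral_quotient_holomorphic:
      "(\<lambda>y. contour_integral (circlepath z r) (\<lambda>w. g w / (x w - y))) holomorphic_on - L"
    and circle_integral_quotient_tendsto:
      "((\<lambda>y. contour_integral (circlepath z r) (\<lambda>w. g w / (x w - y))) \<longlongrightarrow> 0) at_infinity"
proof -
  have cp: "circlepath z r t \<in> sphere z r" for t
    using r by (auto simp: circlepath dist_norm norm_mult)
  have cc: "continuous_on A (circlepath z r)" for A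
    unfolding circlepath by (intro continuous_intros)
  have gc: "continuous_on A (\<lambda>t. g (circlepath z r t))" and xc: "continuous_on A (\<lambda>t. x (circlepath z r t))" for A
    by (rule continuous_on_compose2[OF g cc], use cp in blast) (rule continuous_on_compose2[OF x cc], use cp in blast)
  define V where "V t = vector_derivative (circlepath z r) (at t)" for t
  have V: "V t = 2 * pi * \<i> * r * exp (2 * pi * \<i> * t)" for t
    unfolding V_def by (simp add: vector_derivative_circlepath)
  have Vc: "continuous_on A V" for A unfolding V by (intro continuous_intros)
  define G where "G = (\<lambda>y. integral {0..1} (\<lambda>t. g (circlepath z r t) * V t / (x (circlepath z r t) - y)))"
  have eq: "contour_integral (circlepath z r) (\<lambda>w. g w / (x w - y)) = G y" for y
    unfolding contour_integral_integral G_def V_def by simp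
  have xL: "x (circlepath z r t) \<in> L" for t using cp L by auto
  have xL': "x (circlepath z r t) \<noteq> y" if "y \<notin> L" for t y using xL that by auto
  show "(\<lambda>y. contour_integral (circlepath z r) (\<lambda>w. g w / (x w - y))) holomorphic_on - L"
    unfolding eq
  proof (subst holomorphic_on_open)
    show "\<forall>y\<in>- L. \<exists>f'. (G has_field_derivative f') (at y)"
    proof
      fix y assume y: "y \<in> - L"
      obtain e where e: "e > 0" "ball y e \<subseteq> - L" using L y open_contains_ball[of "- L"] by (meson open_Compl)
      have xL'': "x (circlepath z r t) \<noteq> y" if "y \<in> ball y0 e" "ball y0 e \<subseteq> - L" for t y y0
        using that xL' by blast
      have "((\<lambda>y. integral (cbox 0 1) (\<lambda>t. g (circlepath z r t) * V t / (x (circlepath z r t) - y)))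
         has_field_derivative integral (cbox 0 1) ((\<lambda>y t. g (circlepath z r t) * V t / (x (circlepath z r t) - y)^2) y)) (at y within ball y e)"
      proof (rule leibniz_rule_field_derivative)
        fix y' t assume y': "y' \<in> ball y e" 
        then have "y' \<notin> L" using e by auto
        from xL'[OF this, of t]
        show "((\<lambda>y. g (circlepath z r t) * V t / (x (circlepath z r t) - y)) has_field_derivative
             g (circlepath z r t) * V t / (x (circlepath z r t) - y')\<^sup>2) (at y' within ball y e)"
          by (auto intro!: derivative_eq_intros simp: power2_eq_square)
      next
        fix y' assume y': "y' \<in> ball y e"
        then have "y' \<notin> L" using e by auto
        then show "(\<lambda>t. g (circlepath z r t) * V t / (x (circlepath z r t) - y')) integrable_on cbox 0 1"
          by (intro integrable_continuous continuous_intros gc xc Vc) (use xL' in auto)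
      next
        show "continuous_on (ball y e \<times> cbox 0 1) (\<lambda>(y, t). g (circlepath z r t) * V t / (x (circlepath z r t) - y)\<^sup>2)"
          unfolding case_prod_unfold
          by (intro continuous_intros continuous_on_compose2[OF gc continuous_on_snd]
               continuous_on_compose2[OF xc continuous_on_snd] continuous_on_compose2[OF Vc continuous_on_snd])
             (use e xL' in \<open>auto dest!: subsetD\<close>)
      qed (use e in auto)
      then show "\<exists>f'. (G has_field_derivative f') (at y)"
        unfolding G_def using e at_within_open[of y "ball y e"] by auto
    qed
  qed (use L in auto)
  obtain M where M: "M > 0" "\<And>t. t \<in> {0..1} \<Longrightarrow> norm (g (circlepath z r t) * V t) \<le> M"
  proof -
    have "compact ((\<lambda>t. g (circlepath z r t) * V t) ` {0..1})"
      by (intro compact_continuous_image continuous_intros gc Vc) auto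
    from compact_imp_bounded[OF this] that show ?thesis unfolding bounded_pos by auto
  qed
  obtain N where N: "N > 0" "\<And>t. t \<in> {0..1} \<Longrightarrow> norm (x (circlepath z r t)) \<le> N"
  proof -
    have "compact ((\<lambda>t. x (circlepath z r t)) ` {0..1})"
      by (intro compact_continuous_image xc) auto
    from compact_imp_bounded[OF this] that show ?thesis unfolding bounded_pos by auto
  qed
  have bound: "norm (G y) \<le> M / (norm y - N)" if y: "norm y > N" for y
  proof -
    have ne: "x (circlepath z r t) - y \<noteq> 0" if "t \<in> {0..1}" for t using N(2)[OF that] y by auto
    have "norm (G y) \<le> M / (norm y - N) * (1 - 0)"
      unfolding G_def
    proof (rule integral_bound)
      show "continuous_on {0..1} (\<lambda>t. g (circlepath z r t) * V t / (x (circlepath z r t) - y))"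
        by (intro continuous_intros gc xc Vc) (use ne in auto)
      fix t :: real assume t: "t \<in> {0..1}"
      have "norm (x (circlepath z r t) - y) \<ge> norm y - N"
        using N(2)[OF t] norm_triangle_ineq2[of y "x (circlepath z r t)"] by (simp add: norm_minus_commute)
      then show "norm (g (circlepath z r t) * V t / (x (circlepath z r t) - y)) \<le> M / (norm y - N)"
        unfolding norm_divide using M t y by (intro frac_le) auto
    qed auto
    then show ?thesis by simp
  qed
  show "((\<lambda>y. contour_integral (circlepath z r) (\<lambda>w. g w / (x w - y))) \<longlongrightarrow> 0) at_infinity"
    unfolding eq
  proof (rule Lim_null_comparison)
    show "\<forall>\<^sub>F y in at_infinity. norm (G y) \<le> M / (norm y - N)"
      unfolding eventually_at_infinity using bound by (intro exI[of _ "N + 1"]) auto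
    have "((\<lambda>s. M / (s - N)) \<longlongrightarrow> 0) at_top" by real_asymp
    then show "((\<lambda>y. M / (norm y - N)) \<longlongrightarrow> 0) (at_infinity :: complex filter)"
      by (rule filterlim_compose[OF _ filterlim_norm_at_top])
  qed
qed

text \<open>Cauchy's formula expresses \<open>\<phi> t\<close> inside the half-size circle by its
  values on the circle, and there \<open>\<phi>'\<close> is continuous in both variables.
  Differentiating under the integral writes \<open>\<phi>' 0\<close> as a Cauchy integral, which is
  holomorphic at the centre too. No bound on \<open>\<phi>'\<close> near \<open>z0\<close> is
  required.\<close>

lemma deriv_extends:
  fixes \<phi> \<phi>' :: "real \<Rightarrow> complex \<Rightarrow> complex"
  assumes pos: "\<delta> > 0" "\<rho> > 0"
    and ext: "\<And>t. t \<in> {-\<delta>..\<delta>} \<Longrightarrow> \<exists>G. G holomorphic_on ball z0 \<rho> \<and> (\<forall>z\<in>ball z0 \<rho> - {z0}. \<phi> t z = G z)"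
    and der: "\<And>t z. t \<in> {-\<delta>..\<delta>} \<Longrightarrow> z \<in> ball z0 \<rho> - {z0} \<Longrightarrow>
         ((\<lambda>t. \<phi> t z) has_vector_derivative \<phi>' t z) (at t within {-\<delta>..\<delta>})"
    and cont: "continuous_on ({-\<delta>..\<delta>} \<times> (ball z0 \<rho> - {z0})) (\<lambda>(t, z). \<phi>' t z)"
  shows "\<exists>G. G holomorphic_on ball z0 (\<rho>/2) \<and> (\<forall>z\<in>ball z0 (\<rho>/2) - {z0}. \<phi>' 0 z = G z)"
proof -
  let ?C = "circlepath z0 (\<rho>/2)"
  have cp: "?C s \<in> sphere z0 (\<rho>/2)" for s using pos by (auto simp: circlepath dist_norm norm_mult)
  have sph: "sphere z0 (\<rho>/2) \<subseteq> ball z0 \<rho> - {z0}" using pos by auto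
  have cp': "?C s \<in> ball z0 \<rho> - {z0}" for s using cp sph by blast
  have cc: "continuous_on A ?C" for A unfolding circlepath by (intro continuous_intros)
  define V where "V t = vector_derivative ?C (at t)" for t
  have V: "V t = 2 * pi * \<i> * (\<rho>/2) * exp (2 * pi * \<i> * t)" for t
    unfolding V_def by (simp add: vector_derivative_circlepath)
  have Vc: "continuous_on A V" for A unfolding V by (intro continuous_intros)
  define H where "H y = contour_integral ?C (\<lambda>w. \<phi>' 0 w / (w - y)) / (2 * pi * \<i>)" for y
  have cont0: "continuous_on (sphere z0 (\<rho>/2)) (\<phi>' 0)"
  proof -
    have "continuous_on (sphere z0 (\<rho>/2)) (\<lambda>z. (\<lambda>(t, z). \<phi>' t z) (0, z))"
      by (rule continuous_on_compose2[OF cont]) (use sph pos in \<open>auto intro!: continuous_intros\<close>)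
    then show ?thesis by simp
  qed
  have Hh: "H holomorphic_on - sphere z0 (\<rho>/2)"
    unfolding H_def
    by (intro holomorphic_intros circle_integral_quotient_holomorphic) (use cont0 pos in auto)
  have "\<phi>' 0 z = H z" if z: "z \<in> ball z0 (\<rho>/2) - {z0}" for z
  proof -
    have ne: "?C s \<noteq> z" for s using cp[of s] z by auto
    have zb: "z \<in> ball z0 \<rho> - {z0}" using z pos by auto
    have cauchy: "2 * pi * \<i> * \<phi> t z = integral (cbox 0 1) (\<lambda>s. \<phi> t (?C s) / (?C s - z) * V s)"
      and integrable: "(\<lambda>s. \<phi> t (?C s) / (?C s - z) * V s) integrable_on cbox 0 1" if t: "t \<in> {-\<delta>..\<delta>}" for t
    proof -
      obtain G where G: "G holomorphic_on ball z0 \<rho>" "\<And>z. z \<in> ball z0 \<rho> - {z0} \<Longrightarrow> \<phi> t z = G z"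
        using ext[OF t] by blast
      have "G holomorphic_on cball z0 (\<rho>/2)" by (rule holomorphic_on_subset[OF G(1)]) (use pos in auto)
      from Cauchy_integral_circlepath_simple[OF this, of z] z
      have "((\<lambda>u. G u / (u - z)) has_contour_integral 2 * pi * \<i> * G z) ?C"
        by (simp add: dist_norm norm_minus_commute)
      then have "((\<lambda>s. G (?C s) / (?C s - z) * vector_derivative ?C (at s within {0..1})) has_integral 2 * pi * \<i> * G z) {0..1}"
        by (simp add: has_contour_integral_def)
      then have "((\<lambda>s. \<phi> t (?C s) / (?C s - z) * V s) has_integral 2 * pi * \<i> * \<phi> t z) {0..1}"
        unfolding G(2)[OF zb]
        by (rule has_integral_eq[rotated]) (simp add: G(2)[OF cp'] V_def vector_derivative_circlepath01 vector_derivative_circlepath)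
      then show "2 * pi * \<i> * \<phi> t z = integral (cbox 0 1) (\<lambda>s. \<phi> t (?C s) / (?C s - z) * V s)"
         "(\<lambda>s. \<phi> t (?C s) / (?C s - z) * V s) integrable_on cbox 0 1"
        by (auto simp: integral_unique has_integral_integrable)
    qed
    have 0: "0 \<in> {-\<delta>..\<delta>}" using pos by auto
    have "((\<lambda>t. integral (cbox 0 1) (\<lambda>s. \<phi> t (?C s) / (?C s - z) * V s)) has_vector_derivative
        integral (cbox 0 1) ((\<lambda>t s. \<phi>' t (?C s) / (?C s - z) * V s) 0)) (at 0 within {-\<delta>..\<delta>})"
    proof (rule leibniz_rule_vector_derivative[OF _ integrable])
      fix t s assume t: "t \<in> {-\<delta>..\<delta>}"
      have "((\<lambda>t. \<phi> t (?C s) * (1 / (?C s - z) * V s)) has_vector_derivative \<phi>' t (?C s) * (1 / (?C s - z) * V s)) (at t within {-\<delta>..\<delta>})"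
        by (rule has_vector_derivative_mult_left[OF der[OF t cp']])
      then show "((\<lambda>t. \<phi> t (?C s) / (?C s - z) * V s) has_vector_derivative \<phi>' t (?C s) / (?C s - z) * V s) (at t within {-\<delta>..\<delta>})"
        by simp
    next
      have "continuous_on ({-\<delta>..\<delta>} \<times> cbox 0 1) (\<lambda>p. (\<lambda>(t, z). \<phi>' t z) (fst p, ?C (snd p)))"
        by (rule continuous_on_compose2[OF cont]) 
           (use cp' in \<open>auto intro!: continuous_intros continuous_on_compose2[OF cc continuous_on_snd]\<close>)
      then show "continuous_on ({-\<delta>..\<delta>} \<times> cbox 0 1) (\<lambda>(t, s). \<phi>' t (?C s) / (?C s - z) * V s)"
        unfolding case_prod_unfold
        by (intro continuous_intros continuous_on_compose2[OF cc continuous_on_snd] continuous_on_compose2[OF Vc continuous_on_snd])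
           (use ne in auto)
    qed (use 0 in auto)
    then have "((\<lambda>t. 2 * pi * \<i> * \<phi> t z) has_vector_derivative
        integral (cbox 0 1) (\<lambda>s. \<phi>' 0 (?C s) / (?C s - z) * V s)) (at 0 within {-\<delta>..\<delta>})"
      by (rule has_vector_derivative_transform[rotated 2]) (use 0 cauchy in auto)
    moreover have "((\<lambda>t. 2 * pi * \<i> * \<phi> t z) has_vector_derivative 2 * pi * \<i> * \<phi>' 0 z) (at 0 within {-\<delta>..\<delta>})"
      by (rule has_vector_derivative_mult_right[OF der[OF 0 zb]])
    ultimately have "integral (cbox 0 1) (\<lambda>s. \<phi>' 0 (?C s) / (?C s - z) * V s) = 2 * pi * \<i> * \<phi>' 0 z"
      using vector_derivative_unique_within_closed_interval[of "-\<delta>" \<delta> 0] pos by simp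
    moreover have "integral (cbox 0 1) (\<lambda>s. \<phi>' 0 (?C s) / (?C s - z) * V s) = contour_integral ?C (\<lambda>w. \<phi>' 0 w / (w - z))"
      unfolding contour_integral_integral V_def by simp
    ultimately show ?thesis by (simp add: H_def field_simps)
  qed
  moreover have "H holomorphic_on ball z0 (\<rho>/2)" by (rule holomorphic_on_subset[OF Hh]) auto
  ultimately show ?thesis by blast
qed

section \<open>Meromorphic functions and forms on a Riemann surface\<close>

locale riemann =
  fixes X :: "'a topology" and At :: "'a chart set"
  assumes rs: "riemann_surface X At"
begin

section \<open>Charts and punctured neighbourhoods\<close>

lemma chart_complex: "c \<in> At \<Longrightarrow> complex_chart X c"
  using rs by (auto simp: riemann_surface_def)

lemma chart_openin: "c \<in> At \<Longrightarrow> openin X (fst c)"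
  using chart_complex by (auto simp: complex_chart_def)

lemma chart_subset: "c \<in> At \<Longrightarrow> fst c \<subseteq> topspace X"
  using chart_openin openin_subset by blast

lemma chart_open_image: "c \<in> At \<Longrightarrow> open (snd c ` fst c)"
  using chart_complex by (auto simp: complex_chart_def)

lemma chart_homeo: "c \<in> At \<Longrightarrow> homeomorphic_map (subtopology X (fst c)) (top_of_set (snd c ` fst c)) (snd c)"
  using chart_complex by (auto simp: complex_chart_def)

lemma chart_inj: "c \<in> At \<Longrightarrow> inj_on (snd c) (fst c)"
  using homeomorphic_imp_injective_map[OF chart_homeo] chart_subset by (simp add: Int_absorb1)

lemma chart_inv_chart [simp]: "c \<in> At \<Longrightarrow> p \<in> fst c \<Longrightarrow> chart_inv c (snd c p) = p"
  using chart_inj by simp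

lemma chart_inv_in: "w \<in> snd c ` fst c \<Longrightarrow> chart_inv c w \<in> fst c"
  by (rule inv_into_into)

lemma chart_chart_inv: "w \<in> snd c ` fst c \<Longrightarrow> snd c (chart_inv c w) = w"
  by (rule f_inv_into_f)

lemma chart_open_map: "c \<in> At \<Longrightarrow> openin X V \<Longrightarrow> open (snd c ` (fst c \<inter> V))"
proof -
  assume c: "c \<in> At" and V: "openin X V"
  have "openin (subtopology X (fst c)) (fst c \<inter> V)" using V by (auto simp: openin_subtopology)
  then have "openin (top_of_set (snd c ` fst c)) (snd c ` (fst c \<inter> V))"
    using homeomorphic_imp_open_map[OF chart_homeo[OF c]] by (simp add: open_map_def)
  then show ?thesis using chart_open_image[OF c] by (simp add: openin_open_eq)
qed

lemma chart_continuous: "c \<in> At \<Longrightarrow> open O' \<Longrightarrow> openin X {p \<in> fst c. snd c p \<in> O'}"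
proof -
  assume c: "c \<in> At" and V: "open O'"
  have "openin (top_of_set (snd c ` fst c)) (snd c ` fst c \<inter> O')" using V by auto
  with homeomorphic_imp_continuous_map[OF chart_homeo[OF c]]
  have "openin (subtopology X (fst c)) {p \<in> topspace (subtopology X (fst c)). snd c p \<in> snd c ` fst c \<inter> O'}"
    by (rule openin_continuous_map_preimage)
  moreover have "{p \<in> topspace (subtopology X (fst c)). snd c p \<in> snd c ` fst c \<inter> O'} = {p \<in> fst c. snd c p \<in> O'}"
    using chart_subset[OF c] by auto
  ultimately show ?thesis using openin_trans_full[OF _ chart_openin[OF c]] by metis
qed

lemma chart_exists: "p \<in> topspace X \<Longrightarrow> \<exists>c\<in>At. p \<in> fst c"
  using rs unfolding riemann_surface_def by blast

text \<open>The dictionary between the surface and the plane: local statements are phrased with the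
  filter \<open>atin X p\<close>, which mentions no chart, and are proved in a coordinate.\<close>

lemma eventually_atin_chart:
  assumes c: "c \<in> At" and p: "p \<in> fst c"
  shows "eventually \<Phi> (atin X p) \<longleftrightarrow> eventually (\<lambda>w. \<Phi> (chart_inv c w)) (at (snd c p))"
proof
  assume "eventually \<Phi> (atin X p)"
  then obtain V where V: "openin X V" "p \<in> V" "\<And>q. q \<in> V - {p} \<Longrightarrow> \<Phi> q"
    using chart_subset[OF c] p by (auto simp: eventually_atin)
  have "\<forall>w\<in>snd c ` (fst c \<inter> V). w \<noteq> snd c p \<longrightarrow> \<Phi> (chart_inv c w)"
    using c V by auto
  then show "eventually (\<lambda>w. \<Phi> (chart_inv c w)) (at (snd c p))"
    unfolding eventually_at_topological using chart_open_map[OF c V(1)] p V(2) by blast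
next
  assume "eventually (\<lambda>w. \<Phi> (chart_inv c w)) (at (snd c p))"
  then obtain S where S: "open S" "snd c p \<in> S" "\<And>w. w \<in> S \<Longrightarrow> w \<noteq> snd c p \<Longrightarrow> \<Phi> (chart_inv c w)"
    unfolding eventually_at_topological by blast
  have "\<Phi> q" if q: "q \<in> {q \<in> fst c. snd c q \<in> S} - {p}" for q
  proof -
    have "snd c q \<noteq> snd c p" using q p inj_onD[OF chart_inj[OF c], of q p] by blast
    then have "\<Phi> (chart_inv c (snd c q))" using S(3) q by blast
    then show ?thesis using c q by simp
  qed
  then show "eventually \<Phi> (atin X p)"
    unfolding eventually_atin using chart_continuous[OF c S(1)] p S(2) by blast
qed

lemma atin_nonbot: "p \<in> topspace X \<Longrightarrow> \<not> eventually (\<lambda>q. False) (atin X p)"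
  using chart_exists[of p] eventually_atin_chart[where \<Phi>="\<lambda>_. False"] by fastforce

lemma eventually_atin_openin: "openin X V \<Longrightarrow> p \<in> V \<Longrightarrow> eventually (\<lambda>q. q \<in> V) (atin X p)"
  by (auto simp: eventually_atin)

lemma transition_analytic:
  assumes "c \<in> At" "d \<in> At"
  shows "(\<lambda>w. snd d (chart_inv c w)) analytic_on snd c ` (fst c \<inter> fst d)"
proof -
  have "open (snd c ` (fst c \<inter> fst d))" using chart_open_map chart_openin assms by blast
  moreover have "(\<lambda>w. snd d (chart_inv c w)) holomorphic_on snd c ` (fst c \<inter> fst d)"
    using rs assms by (auto simp: riemann_surface_def holomorphic_transition_def o_def)
  ultimately show ?thesis by (simp add: analytic_on_open)
qed

text \<open>The two transition maps are inverse to each other near the point, so by the chain rule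
  the product of their derivatives is 1.\<close>

lemma transition_deriv:
  assumes cd: "c \<in> At" "d \<in> At" and p: "p \<in> fst c" "p \<in> fst d"
  shows "deriv (\<lambda>w. snd d (chart_inv c w)) (snd c p) \<noteq> 0"
proof
  let ?f = "\<lambda>w. snd d (chart_inv c w)" and ?g = "\<lambda>w. snd c (chart_inv d w)"
  assume 0: "deriv ?f (snd c p) = 0"
  have an: "?f analytic_on {snd c p}" "?g analytic_on {snd d p}"
    using transition_analytic[OF cd] transition_analytic[OF cd(2,1)] p
    by (auto elim!: analytic_on_subset)
  have f: "(?f has_field_derivative 0) (at (snd c p))"
    using an(1) 0 analytic_on_imp_differentiable_at by (metis DERIV_deriv_iff_field_differentiable insertI1)
  have g: "(?g has_field_derivative deriv ?g (snd d p)) (at (?f (snd c p)))"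
    using an(2) analytic_on_imp_differentiable_at cd p by (simp add: DERIV_deriv_iff_field_differentiable)
  have "((\<lambda>w. ?g (?f w)) has_field_derivative deriv ?g (snd d p) * 0) (at (snd c p))"
    by (rule DERIV_chain2[OF g f])
  moreover have "\<forall>\<^sub>F w in nhds (snd c p). ?g (?f w) = w"
  proof -
    have "open (snd c ` (fst c \<inter> fst d))" using chart_open_map chart_openin cd by blast
    then have "\<forall>\<^sub>F w in nhds (snd c p). w \<in> snd c ` (fst c \<inter> fst d)"
      using p by (intro eventually_nhds_in_open) auto
    then show ?thesis by eventually_elim (use cd in auto)
  qed
  ultimately have "((\<lambda>w. w) has_field_derivative deriv ?g (snd d p) * 0) (at (snd c p))"
    using DERIV_cong_ev[OF refl _ refl] by fastforce
  then show False using DERIV_unique[OF DERIV_ident] by fastforce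
qed

section \<open>Meromorphic functions and the identity theorem\<close>

definition meromorphic_fun_at :: "('a \<Rightarrow> complex) \<Rightarrow> 'a \<Rightarrow> bool" where
  "meromorphic_fun_at x p \<longleftrightarrow> (\<forall>c\<in>At. p \<in> fst c \<longrightarrow> (\<lambda>w. x (chart_inv c w)) meromorphic_on {snd c p})"

lemma meromorphic_fun_atI:
  assumes d: "d \<in> At" "p \<in> fst d" and m: "(\<lambda>w. x (chart_inv d w)) meromorphic_on {snd d p}"
  shows "meromorphic_fun_at x p"
  unfolding meromorphic_fun_at_def
proof (intro ballI impI)
  fix c assume c: "c \<in> At" "p \<in> fst c"
  have "(\<lambda>w. x (chart_inv d (snd d (chart_inv c w)))) meromorphic_on {snd c p}"
    by (rule meromorphic_on_compose[OF m])
       (use c d in \<open>auto intro: analytic_on_subset[OF transition_analytic[of c d]]\<close>)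
  moreover have "\<forall>\<^sub>F w in at (snd c p). x (chart_inv d (snd d (chart_inv c w))) = x (chart_inv c w)"
    unfolding eventually_atin_chart[OF c, symmetric, of "\<lambda>q. x (chart_inv d (snd d q)) = x q"]
    using eventually_atin_openin[OF chart_openin[OF d(1)] d(2)]
    by eventually_elim (use d in simp)
  ultimately show "(\<lambda>w. x (chart_inv c w)) meromorphic_on {snd c p}"
    by (subst (asm) meromorphic_on_cong[OF _ refl]) auto
qed

definition meromorphic_fun :: "('a \<Rightarrow> complex) \<Rightarrow> bool" where
  "meromorphic_fun x \<longleftrightarrow> (\<forall>p\<in>topspace X. meromorphic_fun_at x p)"

lemma meromorphic_fun_chart: "meromorphic_fun x \<Longrightarrow> c \<in> At \<Longrightarrow> (\<lambda>w. x (chart_inv c w)) meromorphic_on snd c ` fst c"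
proof (subst meromorphic_on_meromorphic_at, intro ballI)
  fix z assume "meromorphic_fun x" "c \<in> At" "z \<in> snd c ` fst c"
  then obtain p where "p \<in> fst c" "z = snd c p" "p \<in> topspace X" using chart_subset by blast
  with \<open>meromorphic_fun x\<close> \<open>c \<in> At\<close> show "(\<lambda>w. x (chart_inv c w)) meromorphic_on {z}"
    by (simp add: meromorphic_fun_def meromorphic_fun_at_def)
qed

lemma meromorphic_funI: "(\<And>c. c \<in> At \<Longrightarrow> (\<lambda>w. x (chart_inv c w)) meromorphic_on snd c ` fst c) \<Longrightarrow> meromorphic_fun x"
  unfolding meromorphic_fun_def meromorphic_fun_at_def by (meson empty_subsetI imageI insert_subset meromorphic_on_subset)

lemma meromorphic_fun_const: "meromorphic_fun (\<lambda>_. y)" by (rule meromorphic_funI) (auto intro: meromorphic_intros)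

lemma meromorphic_fun_diff: "meromorphic_fun x \<Longrightarrow> meromorphic_fun y \<Longrightarrow> meromorphic_fun (\<lambda>p. x p - y p)"
  by (rule meromorphic_funI) (auto intro!: meromorphic_intros dest: meromorphic_fun_chart)

lemma meromorphic_fun_divide: "meromorphic_fun x \<Longrightarrow> meromorphic_fun y \<Longrightarrow> meromorphic_fun (\<lambda>p. x p / y p)"
  by (rule meromorphic_funI) (auto intro!: meromorphic_intros dest: meromorphic_fun_chart)

lemma meromorphic_fun_at_dichotomy:
  assumes p: "p \<in> topspace X" and m: "meromorphic_fun_at x p"
  shows "eventually (\<lambda>q. x q = y) (atin X p) \<or> eventually (\<lambda>q. x q \<noteq> y) (atin X p)"
proof -
  obtain c where c: "c \<in> At" "p \<in> fst c" using chart_exists[OF p] by blast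
  have "(\<lambda>w. x (chart_inv c w) - y) meromorphic_on {snd c p}"
    using m c by (auto simp: meromorphic_fun_at_def intro!: meromorphic_intros)
  then have "eventually (\<lambda>w. x (chart_inv c w) - y = 0) (at (snd c p)) \<or>
     eventually (\<lambda>w. x (chart_inv c w) - y \<noteq> 0) (at (snd c p))"
    using not_essential_frequently_0_imp_eventually_0[of "\<lambda>w. x (chart_inv c w) - y" "snd c p"]
    unfolding meromorphic_at_iff frequently_def by blast
  then show ?thesis using eventually_atin_chart[OF c] by simp
qed

text \<open>The points near which \<open>x\<close> equals \<open>y\<close> form an open set, and by
  the dichotomy so do the others; connectedness decides. Only the dichotomy is assumed and not
  meromorphy, so that the result also covers \<psi>, which has essential singularities at
  \<open>P\<close>.\<close>

lemma identity_theorem: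
  assumes dich: "\<And>p. p \<in> topspace X \<Longrightarrow>
       eventually (\<lambda>q. x q = y) (atin X p) \<or> eventually (\<lambda>q. x q \<noteq> y) (atin X p)"
    and p0: "p0 \<in> topspace X" "eventually (\<lambda>q. x q = y) (atin X p0)"
    and p: "p \<in> topspace X"
  shows "eventually (\<lambda>q. x q = y) (atin X p)"
proof -
  have haus: "Hausdorff_space X" and con: "connected_space X" using rs by (auto simp: riemann_surface_def)
  \<comment> \<open>A property that holds on a punctured neighbourhood of \<open>p\<close> holds
    near every other point \<open>q\<close> of it as well, because removing the single point
    \<open>p\<close> leaves an open set.\<close>
  have propagate: "\<exists>V. openin X V \<and> p \<in> V \<and> (\<forall>q\<in>V. eventually \<Phi> (atin X q))"
    if p: "p \<in> topspace X" and ev: "eventually \<Phi> (atin X p)" for p \<Phi>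
  proof -
    obtain V where V: "openin X V" "p \<in> V" "\<And>q. q \<in> V - {p} \<Longrightarrow> \<Phi> q"
      using ev p by (auto simp: eventually_atin)
    have "eventually \<Phi> (atin X q)" if q: "q \<in> V" for q
    proof (cases "q = p")
      case False
      have "openin X (V - {p})" using V(1) haus Hausdorff_imp_t1_space t1_space_openin_delete_alt by metis
      then have "eventually (\<lambda>s. s \<in> V - {p}) (atin X q)" using q False by (intro eventually_atin_openin) auto
      then show ?thesis by eventually_elim (use V in auto)
    qed (use ev in simp)
    then show ?thesis using V by blast
  qed
  let ?T = "{p \<in> topspace X. eventually (\<lambda>q. x q = y) (atin X p)}"
  have "openin X ?T"
  proof (subst openin_subopen, intro ballI)
    fix p assume "p \<in> ?T"
    then obtain V where "openin X V" "p \<in> V" "\<forall>q\<in>V. eventually (\<lambda>q. x q = y) (atin X q)"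
      using propagate[of p "\<lambda>q. x q = y"] by blast
    moreover from this have "V \<subseteq> ?T" using openin_subset by blast
    ultimately show "\<exists>T. openin X T \<and> p \<in> T \<and> T \<subseteq> ?T" by blast
  qed
  moreover have "openin X (topspace X - ?T)"
  proof (subst openin_subopen, intro ballI)
    fix p assume p: "p \<in> topspace X - ?T"
    then have "eventually (\<lambda>q. x q \<noteq> y) (atin X p)" using dich by auto
    then obtain V where V: "openin X V" "p \<in> V" "\<And>q. q \<in> V \<Longrightarrow> eventually (\<lambda>q. x q \<noteq> y) (atin X q)"
      using propagate[of p "\<lambda>q. x q \<noteq> y"] p by auto
    have "V \<subseteq> topspace X - ?T"
    proof
      fix q assume q: "q \<in> V"
      then have qX: "q \<in> topspace X" using V openin_subset by blast
      have "\<not> eventually (\<lambda>q. x q = y) (atin X q)"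
      proof
        assume "eventually (\<lambda>q. x q = y) (atin X q)"
        with V(3)[OF q] have "eventually (\<lambda>q. False) (atin X q)" by eventually_elim auto
        with atin_nonbot[OF qX] show False by simp
      qed
      with qX show "q \<in> topspace X - ?T" by blast
    qed
    with V show "\<exists>T. openin X T \<and> p \<in> T \<and> T \<subseteq> topspace X - ?T" by blast
  qed
  ultimately have "?T = {} \<or> ?T = topspace X"
    using con by (auto simp: connected_space_clopen_in closedin_def)
  with p0 p show ?thesis by blast
qed

section \<open>Forms and their residues\<close>

lemma form_meromorphic: "meromorphic_form At \<omega> \<Longrightarrow> c \<in> At \<Longrightarrow> p \<in> fst c \<Longrightarrow> \<omega> c meromorphic_on {snd c p}"
  by (rule meromorphic_on_subset[of _ "snd c ` fst c"]) (auto simp: meromorphic_form_def)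

lemma residue_chart_indep:
  assumes \<omega>: "meromorphic_form At \<omega>" and c: "c \<in> At" "p \<in> fst c" and d: "d \<in> At" "p \<in> fst d"
  shows "residue (\<omega> c) (snd c p) = residue (\<omega> d) (snd d p)"
proof -
  let ?t = "\<lambda>w. snd d (chart_inv c w)"
  have t: "?t (snd c p) = snd d p" using c by simp
  have "residue (\<omega> c) (snd c p) = residue (\<lambda>w. \<omega> d (?t w) * deriv ?t w) (snd c p)"
    by (rule residue_cong) (use \<omega> c d in \<open>auto simp: meromorphic_form_def o_def\<close>)
  also have "\<dots> = residue (\<omega> d) (?t (snd c p))"
  proof (rule residue_compose)
    show "isolated_singularity_at (\<omega> d) (?t (snd c p))"
      unfolding t by (rule meromorphic_on_isolated_singularity[OF form_meromorphic[OF \<omega> d]])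
    show "?t analytic_on {snd c p}" using transition_analytic[of c d] c d by (auto elim: analytic_on_subset)
  qed (use transition_deriv c d in blast)
  finally show ?thesis by (simp add: t)
qed

lemma form_residue_chart:
  assumes \<omega>: "meromorphic_form At \<omega>" and c: "c \<in> At" "p \<in> fst c"
  shows "form_residue At \<omega> p = residue (\<omega> c) (snd c p)"
proof -
  have "(SOME c. c \<in> At \<and> p \<in> fst c) \<in> At \<and> p \<in> fst (SOME c. c \<in> At \<and> p \<in> fst c)"
    by (rule someI) (use c in blast)
  then show ?thesis unfolding form_residue_def Let_def
    by (intro residue_chart_indep[OF \<omega> _ _ c]) auto
qed

definition fmult :: "('a \<Rightarrow> complex) \<Rightarrow> ('a chart \<Rightarrow> complex \<Rightarrow> complex) \<Rightarrow> 'a chart \<Rightarrow> complex \<Rightarrow> complex" where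
  "fmult x \<omega> c w = x (chart_inv c w) * \<omega> c w"

lemma fmult_form:
  assumes x: "meromorphic_fun x" and \<omega>: "meromorphic_form At \<omega>"
  shows "meromorphic_form At (fmult x \<omega>)"
  unfolding meromorphic_form_def
proof (intro conjI ballI)
  fix c assume "c \<in> At"
  then show "fmult x \<omega> c meromorphic_on snd c ` fst c"
    unfolding fmult_def[abs_def] using \<omega> by (intro meromorphic_intros meromorphic_fun_chart[OF x]) (auto simp: meromorphic_form_def)
next
  fix c d p assume cd: "c \<in> At" "d \<in> At" and p: "p \<in> fst c \<inter> fst d"
  have 1: "\<forall>\<^sub>F w in at (snd c p). chart_inv d (snd d (chart_inv c w)) = chart_inv c w"
    unfolding eventually_atin_chart[OF cd(1) IntD1[OF p], symmetric, of "\<lambda>q. chart_inv d (snd d q) = q"]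
    using eventually_atin_openin[OF chart_openin[OF cd(2)] IntD2[OF p]]
    by eventually_elim (use cd in simp)
  have "\<forall>\<^sub>F w in at (snd c p). \<omega> c w = \<omega> d (snd d (chart_inv c w)) * deriv (snd d \<circ> chart_inv c) w"
    using \<omega> cd p unfolding meromorphic_form_def by blast
  with 1 show "\<forall>\<^sub>F w in at (snd c p). fmult x \<omega> c w = fmult x \<omega> d (snd d (chart_inv c w)) * deriv (snd d \<circ> chart_inv c) w"
    by eventually_elim (simp add: fmult_def)
qed

end

section \<open>The residue theorem on a compact Riemann surface\<close>

context riemann begin

lemma Hausdorff_separate_finite:
  assumes S: "finite S" "S \<subseteq> topspace X"
  obtains V where "\<And>p. p \<in> S \<Longrightarrow> openin X (V p)" "\<And>p. p \<in> S \<Longrightarrow> p \<in> V p"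
    "\<And>p q. p \<in> S \<Longrightarrow> q \<in> S \<Longrightarrow> p \<noteq> q \<Longrightarrow> V p \<inter> V q = {}"
proof -
  have haus: "Hausdorff_space X" using rs by (auto simp: riemann_surface_def)
  have "\<exists>U V. openin X U \<and> openin X V \<and> p \<in> U \<and> q \<in> V \<and> disjnt U V"
    if "p \<in> S" "q \<in> S" "p \<noteq> q" for p q
    using haus that S(2) unfolding Hausdorff_space_def by blast
  then obtain U W where UW: "\<And>p q. p \<in> S \<Longrightarrow> q \<in> S \<Longrightarrow> p \<noteq> q \<Longrightarrow>
      openin X (U p q) \<and> openin X (W p q) \<and> p \<in> U p q \<and> q \<in> W p q \<and> disjnt (U p q) (W p q)"
    by metis
  define V where "V p = topspace X \<inter> \<Inter> ((\<lambda>q. U p q \<inter> W q p) ` (S - {p}))" for p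
  show ?thesis
  proof
    fix p assume p: "p \<in> S"
    show "openin X (V p)"
      unfolding V_def using S(1) UW p
      by (intro openin_Int_Inter) auto
    show "p \<in> V p" using UW p S(2) by (auto simp: V_def)
  next
    fix p q assume pq: "p \<in> S" "q \<in> S" "p \<noteq> q"
    have "V p \<subseteq> U p q" using pq by (auto simp: V_def)
    moreover have "V q \<subseteq> W p q" using pq by (auto simp: V_def)
    ultimately show "V p \<inter> V q = {}" using UW[OF pq] by (auto simp: disjnt_iff)
  qed
qed

text \<open>The centre is the only point of the disc where something may go wrong. The values in
  \<open>N\<close> are kept off the punctured disc so that the values taken by \<open>x\<close>
  outside small discs around finitely many such centres miss \<open>N\<close>.\<close>

lemma regular_disc:
  assumes x: "meromorphic_fun x" and \<omega>: "meromorphic_form At \<omega>" and p: "p \<in> topspace X"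
    and N: "finite N" "\<And>n. n \<in> N \<Longrightarrow> eventually (\<lambda>q. x q \<noteq> n) (atin X p)"
  shows "\<exists>c \<delta>. c \<in> At \<and> p \<in> fst c \<and> \<delta> > 0 \<and> cball (snd c p) \<delta> \<subseteq> snd c ` fst c \<and>
     (\<forall>w\<in>cball (snd c p) \<delta> - {snd c p}. (\<lambda>w. x (chart_inv c w)) analytic_on {w} \<and>
        \<omega> c analytic_on {w} \<and> x (chart_inv c w) \<notin> N)"
proof -
  obtain c where c: "c \<in> At" "p \<in> fst c" using chart_exists[OF p] by blast
  let ?z = "snd c p"
  have "(\<lambda>w. x (chart_inv c w)) meromorphic_on {?z}"
    using x p c by (auto simp: meromorphic_fun_def meromorphic_fun_at_def)
  then have 1: "eventually (\<lambda>w. (\<lambda>w. x (chart_inv c w)) analytic_on {w}) (at ?z)"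
    using meromorphic_on_isolated_singularity isolated_singularity_at_altdef by blast
  have 2: "eventually (\<lambda>w. \<omega> c analytic_on {w}) (at ?z)"
    using meromorphic_on_isolated_singularity[OF form_meromorphic[OF \<omega> c]] isolated_singularity_at_altdef by blast
  have 3: "eventually (\<lambda>w. \<forall>n\<in>N. x (chart_inv c w) \<noteq> n) (at ?z)"
    using N eventually_atin_chart[OF c] by (intro eventually_ball_finite) auto
  have 4: "eventually (\<lambda>w. w \<in> snd c ` fst c) (at ?z)"
    using chart_open_image[OF c(1)] c(2) by (intro eventually_at_in_open') auto
  have "eventually (\<lambda>w. ((\<lambda>w. x (chart_inv c w)) analytic_on {w} \<and>
        \<omega> c analytic_on {w} \<and> x (chart_inv c w) \<notin> N) \<and> w \<in> snd c ` fst c) (at ?z)"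
    using 1 2 3 4 by eventually_elim auto
  then obtain d where d: "d > 0" "\<And>w. w \<noteq> ?z \<Longrightarrow> dist w ?z < d \<Longrightarrow> ((\<lambda>w. x (chart_inv c w)) analytic_on {w} \<and>
        \<omega> c analytic_on {w} \<and> x (chart_inv c w) \<notin> N) \<and> w \<in> snd c ` fst c"
    unfolding eventually_at by blast
  have "cball ?z (d/2) \<subseteq> snd c ` fst c"
  proof
    fix w assume "w \<in> cball ?z (d/2)"
    then have "dist w ?z < d" using d(1) by (auto simp: dist_commute)
    then show "w \<in> snd c ` fst c" using d(2)[of w] c(2) by (cases "w = ?z") auto
  qed
  moreover have "\<forall>w\<in>cball ?z (d/2) - {?z}. (\<lambda>w. x (chart_inv c w)) analytic_on {w} \<and>
        \<omega> c analytic_on {w} \<and> x (chart_inv c w) \<notin> N"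
    using d by (auto simp: dist_commute)
  ultimately show ?thesis using c d(1) by (intro exI[of _ c] exI[of _ "d/2"]) auto
qed

lemma isCont_chart:
  assumes c: "c \<in> At" "q \<in> fst c" and cont: "isCont (\<lambda>w. x (chart_inv c w)) (snd c q)" and O': "open O'" "x q \<in> O'"
  shows "\<exists>V. openin X V \<and> q \<in> V \<and> (\<forall>s\<in>V. x s \<in> O')"
proof -
  let ?f = "\<lambda>w. x (chart_inv c w)"
  have "(?f \<longlongrightarrow> ?f (snd c q)) (nhds (snd c q))" 
    using cont tendsto_at_iff_tendsto_nhds[of ?f "snd c q"] unfolding isCont_def by blast
  then have "eventually (\<lambda>w. ?f w \<in> O') (nhds (snd c q))"
    by (rule topological_tendstoD) (use O' c in auto)
  then obtain S where S: "open S" "snd c q \<in> S" "\<And>w. w \<in> S \<Longrightarrow> ?f w \<in> O'"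
    unfolding eventually_nhds by blast
  have "\<forall>s\<in>{s \<in> fst c. snd c s \<in> S}. x s \<in> O'"
    using S(3) c(1) by (metis (mono_tags, lifting) chart_inv_chart mem_Collect_eq)
  then show ?thesis using chart_continuous[OF c(1) S(1)] c(2) S(2)
    by (intro exI[of _ "{s \<in> fst c. snd c s \<in> S}"]) auto
qed

text \<open>Restricting to nonzero residues keeps the index set finite on a compact surface; a sum
  over an infinite set would be 0 by convention. For the forms that matter, finiteness comes out of
  the proof of \<open>total_residue_representation\<close>.\<close>

definition total_residue :: "('a chart \<Rightarrow> complex \<Rightarrow> complex) \<Rightarrow> complex" where
  "total_residue \<omega> = (\<Sum>p | p \<in> topspace X \<and> form_residue At \<omega> p \<noteq> 0. form_residue At \<omega> p)"

lemma total_residue_representation: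
  assumes comp: "compact_space X"
    and x: "meromorphic_fun x" and \<omega>: "meromorphic_form At \<omega>"
    and N: "finite N" "\<And>n p. n \<in> N \<Longrightarrow> p \<in> topspace X \<Longrightarrow> eventually (\<lambda>q. x q \<noteq> n) (atin X p)"
  shows "\<exists>L H. compact L \<and> L \<inter> N = {} \<and> H holomorphic_on - L \<and> (H \<longlongrightarrow> 0) at_infinity \<and>
     (\<forall>y. y \<notin> L \<longrightarrow> total_residue (fmult (\<lambda>q. 1 / (x q - y)) \<omega>) = H y)"
proof -
  have "\<forall>p\<in>topspace X. \<exists>c \<delta>. c \<in> At \<and> p \<in> fst c \<and> \<delta> > 0 \<and> cball (snd c p) \<delta> \<subseteq> snd c ` fst c \<and>
     (\<forall>w\<in>cball (snd c p) \<delta> - {snd c p}. (\<lambda>w. x (chart_inv c w)) analytic_on {w} \<and>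
        \<omega> c analytic_on {w} \<and> x (chart_inv c w) \<notin> N)"
    using regular_disc[OF x \<omega> _ N(1)] N(2) by blast
  then obtain c \<delta> where cd: "\<And>p. p \<in> topspace X \<Longrightarrow> c p \<in> At \<and> p \<in> fst (c p) \<and> \<delta> p > 0 \<and>
      cball (snd (c p) p) (\<delta> p) \<subseteq> snd (c p) ` fst (c p)"
    and reg: "\<And>p w. p \<in> topspace X \<Longrightarrow> w \<in> cball (snd (c p) p) (\<delta> p) - {snd (c p) p} \<Longrightarrow>
      (\<lambda>w. x (chart_inv (c p) w)) analytic_on {w} \<and> \<omega> (c p) analytic_on {w} \<and> x (chart_inv (c p) w) \<notin> N"
    by metis
  define V where "V p = {q \<in> fst (c p). snd (c p) q \<in> ball (snd (c p) p) (\<delta> p)}" for p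
  have V: "openin X (V p)" "p \<in> V p" if "p \<in> topspace X" for p
    using cd[OF that] chart_continuous[of "c p" "ball (snd (c p) p) (\<delta> p)"] unfolding V_def by simp_all
  obtain S where S: "finite S" "S \<subseteq> topspace X" "topspace X \<subseteq> (\<Union>p\<in>S. V p)"
  proof -
    have "\<exists>\<F>. finite \<F> \<and> \<F> \<subseteq> V ` topspace X \<and> topspace X \<subseteq> \<Union> \<F>"
    proof -
      have "(\<forall>U\<in>V ` topspace X. openin X U) \<and> topspace X \<subseteq> \<Union> (V ` topspace X)" using V by blast
      with comp[unfolded compact_space_def compactin_def, THEN conjunct2, THEN spec, of "V ` topspace X"]
      show ?thesis by (rule mp)
    qed
    then obtain \<F> where F: "finite \<F>" "\<F> \<subseteq> V ` topspace X" "topspace X \<subseteq> \<Union> \<F>" by blast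
    then obtain S where "S \<subseteq> topspace X" "finite S" "\<F> = V ` S" by (meson finite_subset_image)
    with F that show ?thesis by blast
  qed
  obtain T where T: "\<And>p. p \<in> S \<Longrightarrow> openin X (T p)" "\<And>p. p \<in> S \<Longrightarrow> p \<in> T p"
    "\<And>p q. p \<in> S \<Longrightarrow> q \<in> S \<Longrightarrow> p \<noteq> q \<Longrightarrow> T p \<inter> T q = {}"
    using Hausdorff_separate_finite[OF S(1,2)] by metis
  \<comment> \<open>The large discs \<open>V p\<close> cover the surface but may overlap. They are
    shrunk into the disjoint sets \<open>T p\<close>, closed discs included, so that no boundary
    circle meets another disc.\<close>
  have "\<exists>\<epsilon>. 0 < \<epsilon> \<and> \<epsilon> \<le> \<delta> p \<and> cball (snd (c p) p) \<epsilon> \<subseteq> snd (c p) ` (fst (c p) \<inter> T p)" if p: "p \<in> S" for p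
  proof -
    have pX: "p \<in> topspace X" using p S by blast
    have "open (snd (c p) ` (fst (c p) \<inter> T p))" using chart_open_map T(1)[OF p] cd[OF pX] by blast
    moreover have "snd (c p) p \<in> snd (c p) ` (fst (c p) \<inter> T p)" using T(2)[OF p] cd[OF pX] by blast
    ultimately obtain e where e: "e > 0" "cball (snd (c p) p) e \<subseteq> snd (c p) ` (fst (c p) \<inter> T p)"
      using open_contains_cball by metis
    show ?thesis using e cd[OF pX] by (intro exI[of _ "min e (\<delta> p)"]) auto
  qed
  then obtain \<epsilon> where \<epsilon>: "\<And>p. p \<in> S \<Longrightarrow> 0 < \<epsilon> p \<and> \<epsilon> p \<le> \<delta> p \<and> cball (snd (c p) p) (\<epsilon> p) \<subseteq> snd (c p) ` (fst (c p) \<inter> T p)"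
    by metis
  define D where "D p = {q \<in> fst (c p). snd (c p) q \<in> ball (snd (c p) p) (\<epsilon> p)}" for p
  have pX: "p \<in> topspace X" if "p \<in> S" for p using that S by blast
  note cS = cd[OF pX]
  have Dopen: "openin X (D p)" if "p \<in> S" for p
    using chart_continuous[of "c p" "ball (snd (c p) p) (\<epsilon> p)"] cS[OF that] unfolding D_def by simp
  have DT: "D p \<subseteq> T p" if p: "p \<in> S" for p
  proof
    fix q assume q: "q \<in> D p"
    then have "snd (c p) q \<in> snd (c p) ` (fst (c p) \<inter> T p)" using \<epsilon>[OF p] by (auto simp: D_def)
    then show "q \<in> T p" using q inj_onD[OF chart_inj, of "c p"] cS[OF p] by (auto simp: D_def)
  qed
  have pD: "p \<in> D p" if "p \<in> S" for p using \<epsilon>[OF that] cS[OF that] by (auto simp: D_def)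
  define K where "K = topspace X - (\<Union>p\<in>S. D p)"
  \<comment> \<open>After the shrinking the small discs no longer cover, but a point of
    \<open>K\<close> still lies in some large disc \<open>V p\<close>, and it is not the centre
    since the centre belongs to \<open>D p\<close>.\<close>
  have Kreg: "\<exists>d\<in>At. q \<in> fst d \<and> (\<lambda>w. x (chart_inv d w)) analytic_on {snd d q} \<and> \<omega> d analytic_on {snd d q} \<and> x q \<notin> N"
    if q: "q \<in> K" for q
  proof -
    have "q \<in> topspace X" using q by (auto simp: K_def)
    then obtain p where p: "p \<in> S" "q \<in> V p" using S(3) by blast
    have "q \<noteq> p" using q pD[OF p(1)] p(1) by (auto simp: K_def)
    moreover have qc: "q \<in> fst (c p)" using p by (auto simp: V_def)
    ultimately have "snd (c p) q \<noteq> snd (c p) p"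
      using inj_onD[OF chart_inj, of "c p" q p] cS[OF p(1)] by blast
    then have "snd (c p) q \<in> cball (snd (c p) p) (\<delta> p) - {snd (c p) p}" using p by (auto simp: V_def)
    from reg[OF pX[OF p(1)] this] cS[OF p(1)] qc show ?thesis
      by (intro bexI[of _ "c p"]) auto
  qed
  define L where "L = x ` K"
  have "closedin X K" unfolding K_def
    by (intro closedin_diff closedin_topspace openin_Union) (use Dopen in auto)
  then have Kc: "compactin X K" using comp closedin_compact_space by blast
  have cL: "compact L"
  proof -
    have "continuous_map (subtopology X K) euclidean x"
      unfolding continuous_map_def
    proof (intro conjI allI impI)
      fix O' :: "complex set" assume "openin euclidean O'"
      then have O': "open O'" by simp
      show "openin (subtopology X K) {q \<in> topspace (subtopology X K). x q \<in> O'}"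
      proof (subst openin_subopen, intro ballI)
        fix q assume q: "q \<in> {q \<in> topspace (subtopology X K). x q \<in> O'}"
        then obtain d where d: "d \<in> At" "q \<in> fst d" "(\<lambda>w. x (chart_inv d w)) analytic_on {snd d q}"
          using Kreg[of q] by auto
        then have "isCont (\<lambda>w. x (chart_inv d w)) (snd d q)" using analytic_at_imp_isCont by blast
        from isCont_chart[OF d(1,2) this O'] q obtain W where W: "openin X W" "q \<in> W" "\<forall>s\<in>W. x s \<in> O'" by auto
        have "openin (subtopology X K) (W \<inter> K)" using W by (auto simp: openin_subtopology)
        moreover have "q \<in> W \<inter> K" using W q by auto
        moreover have "W \<inter> K \<subseteq> {q \<in> topspace (subtopology X K). x q \<in> O'}" using W(1,3) openin_subset by fastforce
        ultimately show "\<exists>T. openin (subtopology X K) T \<and> q \<in> T \<and> T \<subseteq> {q \<in> topspace (subtopology X K). x q \<in> O'}"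
          by blast
      qed
    qed auto
    moreover have "compactin (subtopology X K) K" using Kc by (simp add: compactin_subtopology)
    ultimately have "compactin euclidean (x ` K)" using image_compactin by blast
    then show ?thesis by (simp add: L_def)
  qed
  have LN: "L \<inter> N = {}" using Kreg by (auto simp: L_def)
  \<comment> \<open>The circle around \<open>p\<close> is outside the open disc \<open>D p\<close>,
    and inside \<open>T p\<close>, hence outside all the others. So it lies in \<open>K\<close>,
    where \<open>x\<close> takes values in \<open>L\<close>.\<close>
  have sph: "w \<in> snd (c p) ` fst (c p)" "chart_inv (c p) w \<in> K" "(\<lambda>w. x (chart_inv (c p) w)) analytic_on {w}"
      "\<omega> (c p) analytic_on {w}"
    if p: "p \<in> S" and w: "w \<in> sphere (snd (c p) p) (\<epsilon> p)" for p w
  proof -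
    have w1: "w \<in> cball (snd (c p) p) (\<epsilon> p)" using w by auto
    with \<epsilon>[OF p] obtain q where q: "q \<in> fst (c p)" "q \<in> T p" "w = snd (c p) q" by blast
    show "w \<in> snd (c p) ` fst (c p)" using q by blast
    have iq: "chart_inv (c p) w = q" using q cS[OF p] by simp
    have "q \<notin> D p" using w q by (auto simp: D_def)
    moreover have "q \<notin> D p'" if "p' \<in> S" "p' \<noteq> p" for p'
      using DT[OF that(1)] T(3)[OF that(1) p that(2)] q by blast
    ultimately have "q \<notin> (\<Union>p\<in>S. D p)" by blast
    then show "chart_inv (c p) w \<in> K"
      using q cS[OF p] chart_subset[of "c p"] by (auto simp: K_def iq)
    have "w \<in> cball (snd (c p) p) (\<delta> p) - {snd (c p) p}" using w \<epsilon>[OF p] by auto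
    from reg[OF pX[OF p] this] show "(\<lambda>w. x (chart_inv (c p) w)) analytic_on {w}" "\<omega> (c p) analytic_on {w}" by auto
  qed
  define H where "H y = (\<Sum>p\<in>S. contour_integral (circlepath (snd (c p) p) (\<epsilon> p))
      (\<lambda>w. \<omega> (c p) w / (x (chart_inv (c p) w) - y)) / (2 * pi * \<i>))" for y
  have an_sph: "(\<lambda>w. x (chart_inv (c p) w)) analytic_on sphere (snd (c p) p) (\<epsilon> p)"
    "\<omega> (c p) analytic_on sphere (snd (c p) p) (\<epsilon> p)" if "p \<in> S" for p
    using sph[OF that] by (simp_all add: analytic_on_analytic_at[of _ "sphere (snd (c p) p) (\<epsilon> p)"])
  have xL: "(\<lambda>w. x (chart_inv (c p) w)) ` sphere (snd (c p) p) (\<epsilon> p) \<subseteq> L" if "p \<in> S" for p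
    using sph(2)[OF that] by (auto simp: L_def)
  note quot = an_sph[THEN analytic_imp_holomorphic, THEN holomorphic_on_imp_continuous_on]
  have Hh: "H holomorphic_on - L" unfolding H_def
    by (intro holomorphic_intros circle_integral_quotient_holomorphic quot xL compact_imp_closed[OF cL]) (use \<epsilon> in auto)
  have Hlim: "(H \<longlongrightarrow> 0) at_infinity" 
  proof -
    have "((\<lambda>y. contour_integral (circlepath (snd (c p) p) (\<epsilon> p)) (\<lambda>w. \<omega> (c p) w / (x (chart_inv (c p) w) - y))) \<longlongrightarrow> 0) at_infinity"
      if p: "p \<in> S" for p
      by (rule circle_integral_quotient_tendsto[OF _ quot(2)[OF p] quot(1)[OF p] compact_imp_closed[OF cL] xL[OF p]])
         (use \<epsilon>[OF p] in auto)
    then have "(H \<longlongrightarrow> (\<Sum>p\<in>S. 0 / (2 * pi * \<i>))) at_infinity"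
      unfolding H_def by (intro tendsto_sum tendsto_divide tendsto_const) auto
    then show ?thesis by simp
  qed
  have "total_residue (fmult (\<lambda>q. 1 / (x q - y)) \<omega>) = H y" if y: "y \<notin> L" for y
  proof -
    define \<eta> where "\<eta> = fmult (\<lambda>q. 1 / (x q - y)) \<omega>"
    have \<eta>: "meromorphic_form At \<eta>" unfolding \<eta>_def
      by (intro fmult_form \<omega> meromorphic_fun_divide meromorphic_fun_diff meromorphic_fun_const x)
    have \<eta>an: "\<eta> d analytic_on {w}"
      if "(\<lambda>w. x (chart_inv d w)) analytic_on {w}" "\<omega> d analytic_on {w}" "x (chart_inv d w) \<noteq> y" for d w
      unfolding \<eta>_def fmult_def[abs_def] using that by (intro analytic_intros) auto
    have zero: "form_residue At \<eta> q = 0" if q: "q \<in> K" for q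
    proof -
      obtain d where d: "d \<in> At" "q \<in> fst d" "(\<lambda>w. x (chart_inv d w)) analytic_on {snd d q}" "\<omega> d analytic_on {snd d q}"
        using Kreg[OF q] by blast
      have "x q \<noteq> y" using q y by (auto simp: L_def)
      then have "\<eta> d analytic_on {snd d q}" using d by (intro \<eta>an) auto
      then have "residue (\<eta> d) (snd d q) = 0" unfolding analytic_at using residue_holo by blast
      then show ?thesis using form_residue_chart[OF \<eta> d(1,2)] by simp
    qed
    let ?R = "{q \<in> topspace X. form_residue At \<eta> q \<noteq> 0}"
    have disc: "finite {q \<in> D p. form_residue At \<eta> q \<noteq> 0}" 
       "(\<Sum>q | q \<in> D p \<and> form_residue At \<eta> q \<noteq> 0. form_residue At \<eta> q) =
         contour_integral (circlepath (snd (c p) p) (\<epsilon> p)) (\<lambda>w. \<omega> (c p) w / (x (chart_inv (c p) w) - y)) / (2 * pi * \<i>)"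
      if p: "p \<in> S" for p
    proof -
      let ?z = "snd (c p) p"
      have cp: "c p \<in> At" and in_im: "cball ?z (\<epsilon> p) \<subseteq> snd (c p) ` fst (c p)" and e: "\<epsilon> p > 0"
        using cS[OF p] \<epsilon>[OF p] by auto
      have m: "\<eta> (c p) meromorphic_on cball ?z (\<epsilon> p)"
        using \<eta> cp in_im by (auto simp: meromorphic_form_def intro: meromorphic_on_subset)
      have a: "\<eta> (c p) analytic_on sphere ?z (\<epsilon> p)"
      proof (subst analytic_on_analytic_at, intro ballI)
        fix w assume w: "w \<in> sphere ?z (\<epsilon> p)"
        have "x (chart_inv (c p) w) \<in> L" using xL[OF p] w by blast
        then show "\<eta> (c p) analytic_on {w}" using sph[OF p w] y by (intro \<eta>an) auto
      qed
      note circ = residue_circle[OF m e a]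
      have bij: "bij_betw (snd (c p)) {q \<in> D p. form_residue At \<eta> q \<noteq> 0} {w \<in> ball ?z (\<epsilon> p). residue (\<eta> (c p)) w \<noteq> 0}"
        unfolding bij_betw_def
      proof
        show "inj_on (snd (c p)) {q \<in> D p. form_residue At \<eta> q \<noteq> 0}"
          by (rule inj_on_subset[OF chart_inj[OF cp]]) (auto simp: D_def)
        show "snd (c p) ` {q \<in> D p. form_residue At \<eta> q \<noteq> 0} = {w \<in> ball ?z (\<epsilon> p). residue (\<eta> (c p)) w \<noteq> 0}"
        proof (intro equalityI subsetI)
          fix w assume w: "w \<in> {w \<in> ball ?z (\<epsilon> p). residue (\<eta> (c p)) w \<noteq> 0}"
          then have "w \<in> cball ?z (\<epsilon> p)" by simp
          then obtain q where q: "q \<in> fst (c p)" "w = snd (c p) q" using in_im by blast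
          then show "w \<in> snd (c p) ` {q \<in> D p. form_residue At \<eta> q \<noteq> 0}"
            using w form_residue_chart[OF \<eta> cp q(1)] by (auto simp: D_def)
        qed (auto simp: D_def form_residue_chart[OF \<eta> cp])
      qed
      show "finite {q \<in> D p. form_residue At \<eta> q \<noteq> 0}"
        using bij_betw_finite[OF bij] circ(1) by simp
      have "(\<Sum>q | q \<in> D p \<and> form_residue At \<eta> q \<noteq> 0. form_residue At \<eta> q) =
            (\<Sum>w | w \<in> ball ?z (\<epsilon> p) \<and> residue (\<eta> (c p)) w \<noteq> 0. residue (\<eta> (c p)) w)"
        by (subst sum.reindex_bij_betw[OF bij, symmetric], rule sum.cong)
           (auto simp: D_def form_residue_chart[OF \<eta> cp])
      also have "\<dots> = contour_integral (circlepath ?z (\<epsilon> p)) (\<eta> (c p)) / (2 * pi * \<i>)"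
        unfolding circ(2) by simp
      finally show "(\<Sum>q | q \<in> D p \<and> form_residue At \<eta> q \<noteq> 0. form_residue At \<eta> q) =
         contour_integral (circlepath (snd (c p) p) (\<epsilon> p)) (\<lambda>w. \<omega> (c p) w / (x (chart_inv (c p) w) - y)) / (2 * pi * \<i>)"
        by (simp add: \<eta>_def fmult_def[abs_def])
    qed
    have RU: "?R = (\<Union>p\<in>S. {q \<in> D p. form_residue At \<eta> q \<noteq> 0})"
    proof -
      have "D p \<subseteq> topspace X" if "p \<in> S" for p using Dopen[OF that] openin_subset by blast
      then show ?thesis using zero unfolding K_def by blast
    qed
    have "total_residue \<eta> = (\<Sum>p\<in>S. \<Sum>q | q \<in> D p \<and> form_residue At \<eta> q \<noteq> 0. form_residue At \<eta> q)"
      unfolding total_residue_def RU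
    proof (rule sum.UNION_disjoint[OF S(1)])
      show "\<forall>i\<in>S. \<forall>j\<in>S. i \<noteq> j \<longrightarrow> {q \<in> D i. form_residue At \<eta> q \<noteq> 0} \<inter> {q \<in> D j. form_residue At \<eta> q \<noteq> 0} = {}"
        using DT T(3) by blast
    qed (use disc in blast)
    also have "\<dots> = H y" unfolding H_def by (rule sum.cong) (use disc in auto)
    finally show ?thesis unfolding \<eta>_def .
  qed
  with cL LN Hh Hlim show ?thesis by blast
qed

theorem residue_theorem:
  assumes comp: "compact_space X"
    and x: "meromorphic_fun x" and \<omega>: "meromorphic_form At \<omega>"
    and nonconst: "\<And>y p. p \<in> topspace X \<Longrightarrow> eventually (\<lambda>q. x q \<noteq> y) (atin X p)"
  shows "total_residue \<omega> = 0"
proof -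
  define \<omega>' where "\<omega>' = fmult x \<omega>"
  have \<omega>': "meromorphic_form At \<omega>'" unfolding \<omega>'_def by (rule fmult_form[OF x \<omega>])
  define F where "F y = total_residue (fmult (\<lambda>q. 1 / (x q - y)) \<omega>')" for y
  have "\<exists>f'. (F has_field_derivative f') (at y0)" for y0
  proof -
    \<comment> \<open>Taking \<open>N = {y0}\<close> gives an exceptional set that avoids
      \<open>y0\<close>. Both \<open>L\<close> and \<open>H\<close> depend on \<open>y0\<close>, but
      \<open>F\<close> does not, so holomorphy of \<open>F\<close> at every point follows.\<close>
    obtain L H where LH: "compact L" "L \<inter> {y0} = {}" "H holomorphic_on - L" "\<And>y. y \<notin> L \<Longrightarrow> F y = H y"
      using total_residue_representation[OF comp x \<omega>', of "{y0}"] nonconst unfolding F_def by auto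
    have "F holomorphic_on - L" using LH(3) by (rule holomorphic_transform) (use LH(4) in auto)
    moreover have "open (- L)" using LH(1) compact_imp_closed by auto
    ultimately show ?thesis using holomorphic_on_open[of "- L" F] LH(2) by auto
  qed
  then have "F holomorphic_on UNIV" by (simp add: holomorphic_on_open)
  moreover have "(F \<longlongrightarrow> 0) at_infinity"
  proof -
    \<comment> \<open>For the behaviour at infinity no value has to be avoided: \<open>L\<close> is
      bounded, so large \<open>y\<close> are outside it.\<close>
    obtain L H where LH: "compact L" "(H \<longlongrightarrow> 0) at_infinity" "\<And>y. y \<notin> L \<Longrightarrow> F y = H y"
      using total_residue_representation[OF comp x \<omega>', of "{}"] unfolding F_def by auto
    obtain b where "\<And>y. y \<in> L \<Longrightarrow> norm y \<le> b" using compact_imp_bounded[OF LH(1)] unfolding bounded_iff by blast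
    then have "eventually (\<lambda>y. y \<notin> L) at_infinity"
      unfolding eventually_at_infinity by (intro exI[of _ "b + 1"]) force
    then have "eventually (\<lambda>y. H y = F y) at_infinity" by eventually_elim (use LH(3) in simp)
    with LH(2) show ?thesis by (rule Lim_transform_eventually)
  qed
  ultimately have F0: "F 0 = 0" by (rule Liouville_weak_0)
  \<comment> \<open>Division by \<open>x\<close> undoes multiplication by \<open>x\<close> wherever
    \<open>x\<close> is nonzero, that is, on a punctured neighbourhood of each point; the residue
    sees no more than that.\<close>
  have "form_residue At (fmult (\<lambda>q. 1 / (x q - 0)) \<omega>') p = form_residue At \<omega> p" if p: "p \<in> topspace X" for p
  proof -
    obtain c where c: "c \<in> At" "p \<in> fst c" using chart_exists[OF p] by blast
    have f: "meromorphic_form At (fmult (\<lambda>q. 1 / (x q - 0)) \<omega>')"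
      by (intro fmult_form \<omega>' meromorphic_fun_divide meromorphic_fun_diff meromorphic_fun_const x)
    have "eventually (\<lambda>w. x (chart_inv c w) \<noteq> 0) (at (snd c p))"
      using nonconst[OF p, of 0] eventually_atin_chart[OF c] by simp
    then have "eventually (\<lambda>w. fmult (\<lambda>q. 1 / (x q - 0)) \<omega>' c w = \<omega> c w) (at (snd c p))"
      by eventually_elim (simp add: fmult_def \<omega>'_def)
    then show ?thesis
      unfolding form_residue_chart[OF f c] form_residue_chart[OF \<omega> c] by (rule residue_cong) simp
  qed
  then have "F 0 = total_residue \<omega>"
    unfolding F_def total_residue_def by (intro sum.cong) auto
  with F0 show ?thesis by simp
qed

end

section \<open>Order estimates and the bilinear residue identity\<close>

text \<open>A lower bound on the order, witnessed by an analytic cofactor. It ignores the value at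
  \<open>z\<close>, admits functions vanishing near \<open>z\<close>, and adds up under products,
  which is all that cancelling divisors takes.\<close>

definition order_ge :: "(complex \<Rightarrow> complex) \<Rightarrow> complex \<Rightarrow> int \<Rightarrow> bool" where
  "order_ge f z m \<longleftrightarrow> (\<exists>G. G analytic_on {z} \<and> (\<forall>\<^sub>F w in at z. f w = (w - z) powi m * G w))"

lemma order_ge_cong:
  assumes "\<forall>\<^sub>F w in at z. f w = g w"
  shows "order_ge f z m \<longleftrightarrow> order_ge g z m"
proof -
  have "(\<forall>\<^sub>F w in at z. f w = (w - z) powi m * G w) \<longleftrightarrow> (\<forall>\<^sub>F w in at z. g w = (w - z) powi m * G w)" for G
    by (rule eventually_subst, use assms in eventually_elim) simp
  then show ?thesis by (simp add: order_ge_def)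
qed

lemma order_ge_mult:
  assumes "order_ge f z m" "order_ge g z n"
  shows "order_ge (\<lambda>w. f w * g w) z (m + n)"
proof -
  obtain F G where F: "F analytic_on {z}" "\<forall>\<^sub>F w in at z. f w = (w - z) powi m * F w"
    and G: "G analytic_on {z}" "\<forall>\<^sub>F w in at z. g w = (w - z) powi n * G w"
    using assms unfolding order_ge_def by blast
  have "\<forall>\<^sub>F w in at z. w \<noteq> z" by (simp add: eventually_at_filter)
  with F(2) G(2) have "\<forall>\<^sub>F w in at z. f w * g w = (w - z) powi (m + n) * (F w * G w)"
    by eventually_elim (simp add: power_int_add)
  moreover have "(\<lambda>w. F w * G w) analytic_on {z}" using F(1) G(1) by (intro analytic_intros)
  ultimately show ?thesis unfolding order_ge_def by (intro exI[of _ "\<lambda>w. F w * G w"]) simp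
qed

lemma order_ge_analytic: "f analytic_on {z} \<Longrightarrow> order_ge f z 0"
  unfolding order_ge_def by (intro exI[of _ f]) simp

lemma order_ge_laurent:
  assumes F: "(\<lambda>w. f (z + w)) has_laurent_expansion F" "F = 0 \<or> m \<le> fls_subdegree F"
  shows "order_ge f z m"
proof -
  define g where "g w = f w * (w - z) powi (- m)" for w
  have g: "(\<lambda>w. g (z + w)) has_laurent_expansion fls_shift m F"
    unfolding g_def using has_laurent_expansion_shift'[OF F(1), of m] by simp
  have "fls_subdegree (fls_shift m F) \<ge> 0" using F(2) by (cases "F = 0") (auto simp: fls_shift_subdegree)
  from has_laurent_expansion_imp_tendsto[OF g this] has_laurent_expansion_isolated[OF g]
  have G: "(\<lambda>y. if y = z then fls_nth (fls_shift m F) 0 else g y) analytic_on {z}"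
    by (intro removable_singularity')
  have "\<forall>\<^sub>F w in at z. w \<noteq> z" by (simp add: eventually_at_filter)
  then have "\<forall>\<^sub>F w in at z. f w = (w - z) powi m * (if w = z then fls_nth (fls_shift m F) 0 else g w)"
    by eventually_elim (simp add: g_def power_int_minus field_simps)
  with G show ?thesis unfolding order_ge_def by blast
qed

lemma order_ge_meromorphic:
  assumes "order_ge f z m" shows "f meromorphic_on {z}"
proof -
  obtain G where G: "G analytic_on {z}" "\<forall>\<^sub>F w in at z. f w = (w - z) powi m * G w"
    using assms unfolding order_ge_def by blast
  have "(\<lambda>w. (w - z) powi m * G w) meromorphic_on {z}"
    by (intro meromorphic_intros analytic_on_imp_meromorphic_on G(1))
  then show ?thesis using G(2) by (subst meromorphic_on_cong[OF _ refl]) auto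
qed

lemma residue_order_ge_0:
  assumes "order_ge f z m" "m \<ge> 0" shows "residue f z = 0"
proof -
  obtain G where G: "G analytic_on {z}" "\<forall>\<^sub>F w in at z. f w = (w - z) powi m * G w"
    using assms unfolding order_ge_def by blast
  have "(\<lambda>w. (w - z) ^ nat m * G w) analytic_on {z}" by (intro analytic_intros G(1))
  then have "residue (\<lambda>w. (w - z) ^ nat m * G w) z = 0" unfolding analytic_at using residue_holo by blast
  moreover have "residue f z = residue (\<lambda>w. (w - z) ^ nat m * G w) z"
    by (rule residue_cong) (use G(2) assms(2) in \<open>simp_all add: power_int_def\<close>)
  ultimately show ?thesis by simp
qed

lemma residue_order_minus_1:
  assumes G: "G analytic_on {z}" "\<forall>\<^sub>F w in at z. f w = (w - z) powi - 1 * G w"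
  shows "residue f z = G z"
proof -
  obtain S where S: "open S" "z \<in> S" "G holomorphic_on S" using G(1) unfolding analytic_at by blast
  have "residue f z = residue (\<lambda>w. G w / (w - z)) z"
    by (rule residue_cong) (use G(2) in \<open>auto simp: power_int_minus field_simps\<close>)
  also have "\<dots> = G z" by (rule residue_simple[OF S])
  finally show ?thesis .
qed

lemma residue_simple_mult:
  assumes f: "f analytic_on {z}" and g: "order_ge g z (- 1)"
  shows "residue (\<lambda>w. f w * g w) z = f z * residue g z"
proof -
  obtain G where G: "G analytic_on {z}" "\<forall>\<^sub>F w in at z. g w = (w - z) powi - 1 * G w"
    using g unfolding order_ge_def by blast
  have "\<forall>\<^sub>F w in at z. f w * g w = (w - z) powi - 1 * (f w * G w)"
    using G(2) by eventually_elim simp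
  then have "residue (\<lambda>w. f w * g w) z = f z * G z"
    by (intro residue_order_minus_1 analytic_intros f G(1))
  with residue_order_minus_1[OF G] show ?thesis by simp
qed

lemma laurent_expansion_linear_coeff:
  assumes G: "G analytic_on {0}" "\<forall>\<^sub>F w in at 0. f w = w * G w"
  shows "fls_nth (laurent_expansion f 0) 1 = G 0"
proof -
  obtain F where F: "G has_fps_expansion F" using analytic_at_imp_has_fps_expansion_0[OF G(1)] by blast
  have "(\<lambda>w. w * G w) has_laurent_expansion fls_X * fps_to_fls F"
    by (intro laurent_expansion_intros has_laurent_expansion_fps F)
  then have "f has_laurent_expansion fls_X * fps_to_fls F"
    using G(2) by (subst has_laurent_expansion_cong[OF _ refl]) auto
  then have "laurent_expansion f 0 = fls_X * fps_to_fls F" by (intro laurent_expansion_eqI) simp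
  then show ?thesis using has_fps_expansion_imp_0_eq_fps_nth_0[OF F]
    by (simp add: fls_X_times_conv_shift)
qed

context riemann begin

text \<open>\<open>zorder\<close> is meaningful only for a function that does not vanish near the
  point; the frequency clause in \<open>form_divisor\<close> guarantees this.\<close>

lemma form_order:
  assumes \<omega>: "meromorphic_form At \<omega>" and E: "form_divisor At \<omega> E" and c: "c \<in> At" "p \<in> fst c"
  shows "order_ge (\<omega> c) (snd c p) (Poly_Mapping.lookup E p)"
proof -
  have m: "\<omega> c meromorphic_on {snd c p}" by (rule form_meromorphic[OF \<omega> c])
  have nz: "\<exists>\<^sub>F w in at (snd c p). \<omega> c w \<noteq> 0" and ord: "zorder (\<omega> c) (snd c p) = Poly_Mapping.lookup E p"
    using E c unfolding form_divisor_def by auto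
  define G where "G = zor_poly (\<omega> c) (snd c p)"
  obtain r where r: "r > 0" "G holomorphic_on cball (snd c p) r"
     "\<forall>w\<in>cball (snd c p) r - {snd c p}. \<omega> c w = G w * (w - snd c p) powi Poly_Mapping.lookup E p"
    using zorder_exist[OF meromorphic_on_isolated_singularity[OF m] meromorphic_on_not_essential[OF m] nz]
    unfolding ord G_def by blast
  have "G analytic_on {snd c p}"
    unfolding analytic_at by (intro exI[of _ "ball (snd c p) r"]) (use r in \<open>auto intro: holomorphic_on_subset\<close>)
  moreover have "\<forall>\<^sub>F w in at (snd c p). \<omega> c w = (w - snd c p) powi Poly_Mapping.lookup E p * G w"
    unfolding eventually_at using r by (intro exI[of _ r]) (auto simp: dist_commute)
  ultimately show ?thesis unfolding order_ge_def by blast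
qed

end

section \<open>The involution, transported charts and the bilinear identity\<close>

locale riemann_involution = riemann +
  fixes \<sigma> :: "'a \<Rightarrow> 'a"
  assumes inv: "holomorphic_involution X At \<sigma>"
begin

lemma \<sigma>_\<sigma> [simp]: "p \<in> topspace X \<Longrightarrow> \<sigma> (\<sigma> p) = p"
  using inv by (auto simp: holomorphic_involution_def)

lemma \<sigma>_continuous: "continuous_map X X \<sigma>"
  using inv by (auto simp: holomorphic_involution_def holomorphic_self_map_def)

lemma \<sigma>_in [simp]: "p \<in> topspace X \<Longrightarrow> \<sigma> p \<in> topspace X"
  using \<sigma>_continuous by (auto simp: continuous_map_def)

text \<open>The atlas is maximal, so it contains the charts transported by \<open>\<sigma>\<close>; expressing \<open>b\<close> at \<open>\<sigma> p\<close>
  in the transported chart is the same as expressing \<open>b \<circ> \<sigma>\<close> at \<open>p\<close> in the original one.\<close>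

definition \<sigma>_chart :: "'a chart \<Rightarrow> 'a chart" where
  "\<sigma>_chart c = (\<sigma> ` fst c, snd c \<circ> \<sigma>)"

lemma \<sigma>_image: "c \<in> At \<Longrightarrow> \<sigma> ` fst c = {q \<in> topspace X. \<sigma> q \<in> fst c}"
  using chart_subset[of c] by (auto intro!: image_eqI[of _ \<sigma> "\<sigma> _"])

lemma \<sigma>_chart_image: "c \<in> At \<Longrightarrow> snd (\<sigma>_chart c) ` fst (\<sigma>_chart c) = snd c ` fst c"
  using chart_subset[of c] by (force simp: \<sigma>_chart_def image_comp)

lemma chart_inv_\<sigma>_chart:
  assumes c: "c \<in> At" and w: "w \<in> snd c ` fst c"
  shows "chart_inv (\<sigma>_chart c) w = \<sigma> (chart_inv c w)"
proof (rule inv_into_f_eq)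
  have p: "p \<in> topspace X" if "p \<in> fst c" for p using that chart_subset[OF c] by blast
  show "inj_on (snd (\<sigma>_chart c)) (fst (\<sigma>_chart c))"
    unfolding \<sigma>_chart_def using chart_inj[OF c] p by (auto simp: inj_on_def)
  show "\<sigma> (chart_inv c w) \<in> fst (\<sigma>_chart c)" using chart_inv_in[OF w] by (simp add: \<sigma>_chart_def)
  show "snd (\<sigma>_chart c) (\<sigma> (chart_inv c w)) = w"
    using chart_chart_inv[OF w] p[OF chart_inv_in[OF w]] by (simp add: \<sigma>_chart_def)
qed

lemma \<sigma>_chart_in: 
  assumes c: "c \<in> At"
  shows "\<sigma>_chart c \<in> At"
proof -
  have sub: "fst c \<subseteq> topspace X" by (rule chart_subset[OF c])
  have "openin X (\<sigma> ` fst c)"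
    unfolding \<sigma>_image[OF c] using openin_continuous_map_preimage[OF \<sigma>_continuous chart_openin[OF c]] by simp
  moreover have "homeomorphic_map (subtopology X (\<sigma> ` fst c)) (top_of_set (snd c ` fst c)) (snd c \<circ> \<sigma>)"
  proof (rule homeomorphic_map_compose[OF _ chart_homeo[OF c]])
    have "homeomorphic_maps X X \<sigma> \<sigma>" by (simp add: homeomorphic_maps_def \<sigma>_continuous)
    then have h: "homeomorphic_map X X \<sigma>" using homeomorphic_maps_map by blast
    have "\<sigma> ` \<sigma> ` fst c = (\<lambda>p. p) ` fst c"
      unfolding image_image by (rule image_cong) (use sub in auto)
    moreover have "topspace X \<inter> \<sigma> ` fst c = \<sigma> ` fst c" using sub by auto
    ultimately have "\<sigma> ` (topspace X \<inter> \<sigma> ` fst c) = topspace X \<inter> fst c" using sub by auto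
    then show "homeomorphic_map (subtopology X (\<sigma> ` fst c)) (subtopology X (fst c)) \<sigma>"
      by (rule homeomorphic_map_subtopologies[OF h])
  qed
  ultimately have "complex_chart X (\<sigma>_chart c)"
    unfolding complex_chart_def \<sigma>_chart_image[OF c] using chart_open_image[OF c] by (simp add: \<sigma>_chart_def)
  \<comment> \<open>Since \<sigma> is its own inverse, both transition maps are coordinate
    expressions of \<sigma> itself, one from \<open>c\<close> to \<open>d\<close> and one from
    \<open>d\<close> to \<open>c\<close>; these are holomorphic by the definition of a holomorphic
    self-map.\<close>
  moreover have "holomorphic_transition (\<sigma>_chart c) d \<and> holomorphic_transition d (\<sigma>_chart c)" if d: "d \<in> At" for d
  proof
    have im: "snd (\<sigma>_chart c) ` (fst (\<sigma>_chart c) \<inter> fst d) = snd c ` {p \<in> fst c. \<sigma> p \<in> fst d}"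
      using sub by (force simp: \<sigma>_chart_def)
    have "(snd d \<circ> \<sigma> \<circ> chart_inv c) holomorphic_on snd c ` {p \<in> fst c. \<sigma> p \<in> fst d}"
      using inv c d unfolding holomorphic_involution_def holomorphic_self_map_def by blast
    then have "(snd d \<circ> chart_inv (\<sigma>_chart c)) holomorphic_on snd c ` {p \<in> fst c. \<sigma> p \<in> fst d}"
      by (rule holomorphic_transform) (use c in \<open>auto simp: chart_inv_\<sigma>_chart\<close>)
    then show "holomorphic_transition (\<sigma>_chart c) d" unfolding holomorphic_transition_def im .
  next
    have "(snd c \<circ> \<sigma> \<circ> chart_inv d) holomorphic_on snd d ` {p \<in> fst d. \<sigma> p \<in> fst c}"
      using inv c d unfolding holomorphic_involution_def holomorphic_self_map_def by blast
    moreover have "{p \<in> fst d. \<sigma> p \<in> fst c} = fst d \<inter> fst (\<sigma>_chart c)"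
      using chart_subset[OF d] by (auto simp: \<sigma>_chart_def \<sigma>_image[OF c])
    ultimately show "holomorphic_transition d (\<sigma>_chart c)"
      unfolding holomorphic_transition_def by (simp add: \<sigma>_chart_def o_assoc)
  qed
  ultimately show ?thesis using rs unfolding riemann_surface_def by blast
qed

lemma \<sigma>_chart_at:
  assumes c: "c \<in> At" "p \<in> fst c"
  shows "\<sigma> p \<in> fst (\<sigma>_chart c)" "snd (\<sigma>_chart c) (\<sigma> p) = snd c p"
    "\<forall>\<^sub>F w in nhds (snd c p). b (chart_inv (\<sigma>_chart c) w) = b (\<sigma> (chart_inv c w))"
proof -
  show "\<sigma> p \<in> fst (\<sigma>_chart c)" "snd (\<sigma>_chart c) (\<sigma> p) = snd c p"
    using c chart_subset[of c] by (auto simp: \<sigma>_chart_def)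
  have "\<forall>\<^sub>F w in nhds (snd c p). w \<in> snd c ` fst c"
    using chart_open_image[OF c(1)] c(2) by (intro eventually_nhds_in_open) auto
  then show "\<forall>\<^sub>F w in nhds (snd c p). b (chart_inv (\<sigma>_chart c) w) = b (\<sigma> (chart_inv c w))"
    by eventually_elim (simp add: chart_inv_\<sigma>_chart[OF c(1)])
qed

text \<open>The form \<open>a (S) b (\<sigma> S) \<Omega>\<close> has its only poles at \<open>T\<close> and \<open>range P\<close>: at the latter the exponential
  factors cancel because \<open>\<sigma>\<close> is odd there.  The factor \<open>1 / w\<close> in the expansions of \<open>a\<close> and \<open>b\<close>
  is needed for derivatives of \<open>\<psi>\<close>, whose leading term is \<open>k f exp (k u)\<close> with \<open>k = 1 / w\<close>.\<close>

lemma residue_identity: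
  fixes P :: "'k::finite \<Rightarrow> 'a" and \<kappa> :: "'k \<Rightarrow> 'a chart" and d z :: "'a \<Rightarrow> int" and v :: "'k \<Rightarrow> complex"
  assumes comp: "compact_space X"
    and x: "meromorphic_fun x" "\<And>y p. p \<in> topspace X \<Longrightarrow> eventually (\<lambda>q. x q \<noteq> y) (atin X p)"
    and \<Omega>: "meromorphic_form At \<Omega>"
    and P: "inj P" "\<And>k. \<sigma> (P k) = P k"
    and \<kappa>: "\<And>k. local_parameter At (P k) (\<kappa> k)"
    and odd: "\<And>k. eventually (\<lambda>S. \<sigma> S \<in> fst (\<kappa> k) \<and> snd (\<kappa> k) (\<sigma> S) = - snd (\<kappa> k) S) (atin X (P k))"
    and T: "finite T" "T \<subseteq> topspace X" "T \<inter> range P = {}"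
       "\<And>p. p \<in> T \<Longrightarrow> \<sigma> p = p \<and> d p = 0 \<and> z p = 0"
    and ord\<Omega>: "\<And>p c. c \<in> At \<Longrightarrow> p \<in> fst c \<Longrightarrow>
       order_ge (\<Omega> c) (snd c p) (d p + d (\<sigma> p) - z p - z (\<sigma> p) + of_bool (p \<in> range P) - of_bool (p \<in> T))"
    and dP: "\<And>k. d (P k) \<ge> 0 \<and> z (P k) = 0"
    and a: "\<And>p c. p \<notin> range P \<Longrightarrow> c \<in> At \<Longrightarrow> p \<in> fst c \<Longrightarrow> order_ge (\<lambda>w. a (chart_inv c w)) (snd c p) (z p - d p)"
       "\<And>p c. p \<in> T \<Longrightarrow> c \<in> At \<Longrightarrow> p \<in> fst c \<Longrightarrow> (\<lambda>w. a (chart_inv c w)) analytic_on {snd c p}"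
       "\<And>k. \<exists>\<alpha>. \<alpha> analytic_on {0} \<and> \<alpha> 0 = \<mu> k \<and> (\<forall>\<^sub>F w in at 0. a (chart_inv (\<kappa> k) w) = exp (v k / w) * \<alpha> w / w)"
    and b: "\<And>p c. p \<notin> range P \<Longrightarrow> c \<in> At \<Longrightarrow> p \<in> fst c \<Longrightarrow> order_ge (\<lambda>w. b (chart_inv c w)) (snd c p) (z p - d p)"
       "\<And>p c. p \<in> T \<Longrightarrow> c \<in> At \<Longrightarrow> p \<in> fst c \<Longrightarrow> (\<lambda>w. b (chart_inv c w)) analytic_on {snd c p}"
       "\<And>k. \<exists>\<beta>. \<beta> analytic_on {0} \<and> \<beta> 0 = \<nu> k \<and> (\<forall>\<^sub>F w in at 0. b (chart_inv (\<kappa> k) w) = exp (v k / w) * \<beta> w / w)"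
  shows "(\<Sum>p\<in>T. a p * b p * form_residue At \<Omega> p) = (\<Sum>k\<in>UNIV. \<mu> k * \<nu> k * form_linear_coeff \<Omega> (\<kappa> k))"
proof -
  define g where "g p = a p * b (\<sigma> p)" for p
  have \<kappa>': "\<kappa> k \<in> At" "P k \<in> fst (\<kappa> k)" "snd (\<kappa> k) (P k) = 0" "P k \<in> topspace X" for k
    using \<kappa>[of k] chart_subset[of "\<kappa> k"] by (auto simp: local_parameter_def)
  have \<sigma>P: "\<sigma> p \<notin> range P" if "p \<notin> range P" "p \<in> topspace X" for p
  proof
    assume "\<sigma> p \<in> range P"
    then have "\<sigma> (\<sigma> p) \<in> range P" using P(2) by auto
    with that show False by simp
  qed
  have g_order: "order_ge (\<lambda>w. g (chart_inv c w)) (snd c p) (z p - d p + (z (\<sigma> p) - d (\<sigma> p)))"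
    if p: "p \<notin> range P" and c: "c \<in> At" "p \<in> fst c" for p c
  proof -
    have pX: "p \<in> topspace X" using chart_subset c by blast
    have "order_ge (\<lambda>w. b (chart_inv (\<sigma>_chart c) w)) (snd (\<sigma>_chart c) (\<sigma> p)) (z (\<sigma> p) - d (\<sigma> p))"
      by (rule b(1)[OF \<sigma>P[OF p pX] \<sigma>_chart_in[OF c(1)] \<sigma>_chart_at(1)[OF c]])
    then have "order_ge (\<lambda>w. b (chart_inv (\<sigma>_chart c) w)) (snd c p) (z (\<sigma> p) - d (\<sigma> p))"
      using \<sigma>_chart_at(2)[OF c] by simp
    moreover have "\<forall>\<^sub>F w in at (snd c p). b (chart_inv (\<sigma>_chart c) w) = b (\<sigma> (chart_inv c w))"
      using \<sigma>_chart_at(3)[OF c] eventually_nhds_conv_at by blast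
    ultimately have "order_ge (\<lambda>w. b (\<sigma> (chart_inv c w))) (snd c p) (z (\<sigma> p) - d (\<sigma> p))"
      using order_ge_cong[of "\<lambda>w. b (chart_inv (\<sigma>_chart c) w)" "\<lambda>w. b (\<sigma> (chart_inv c w))" "snd c p"]
      by blast
    from order_ge_mult[OF a(1)[OF p c] this] show ?thesis by (simp add: g_def)
  qed
  \<comment> \<open>Since \<open>\<sigma>\<close> is \<open>w \<mapsto> - w\<close> here,
    \<open>exp (v k / w)\<close> meets \<open>exp (v k / - w)\<close> and the product is 1. The
    remaining factor \<open>(1 / w) * (1 / (- w))\<close> is the origin of the minus sign.\<close>
  have at_P: "\<exists>\<gamma>. \<gamma> analytic_on {0} \<and> \<gamma> 0 = - \<mu> k * \<nu> k \<and>
      (\<forall>\<^sub>F w in at 0. g (chart_inv (\<kappa> k) w) = \<gamma> w / w^2)" for k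
  proof -
    obtain \<alpha> \<beta> where \<alpha>: "\<alpha> analytic_on {0}" "\<alpha> 0 = \<mu> k" "\<forall>\<^sub>F w in at 0. a (chart_inv (\<kappa> k) w) = exp (v k / w) * \<alpha> w / w"
      and \<beta>: "\<beta> analytic_on {0}" "\<beta> 0 = \<nu> k" "\<forall>\<^sub>F w in at 0. b (chart_inv (\<kappa> k) w) = exp (v k / w) * \<beta> w / w"
      using a(3)[of k] b(3)[of k] by blast
    have "\<forall>\<^sub>F w in at 0. b (chart_inv (\<kappa> k) (- w)) = exp (v k / - w) * \<beta> (- w) / (- w)"
    proof -
      have "\<forall>\<^sub>F w in filtermap (\<lambda>w. - w) (at 0). b (chart_inv (\<kappa> k) w) = exp (v k / w) * \<beta> w / w"
        using \<beta>(3) by (simp only: filtermap_at_minus minus_zero)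
      then show ?thesis by (simp only: eventually_filtermap)
    qed
    moreover have "\<forall>\<^sub>F w in at 0. \<sigma> (chart_inv (\<kappa> k) w) = chart_inv (\<kappa> k) (- w)"
    proof -
      have "\<forall>\<^sub>F S in atin X (P k). \<sigma> S = chart_inv (\<kappa> k) (- snd (\<kappa> k) S)"
        using odd[of k] by eventually_elim (metis \<kappa>'(1) chart_inv_chart)
      then have "\<forall>\<^sub>F w in at 0. \<sigma> (chart_inv (\<kappa> k) w) = chart_inv (\<kappa> k) (- snd (\<kappa> k) (chart_inv (\<kappa> k) w))"
        using eventually_atin_chart[OF \<kappa>'(1,2)] \<kappa>'(3) by simp
      moreover have "\<forall>\<^sub>F w in at 0. w \<in> snd (\<kappa> k) ` fst (\<kappa> k)"
        using chart_open_image[OF \<kappa>'(1), of k] \<kappa>'(2,3)[of k] by (intro eventually_at_in_open') (auto intro!: image_eqI)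
      ultimately show ?thesis by eventually_elim (simp add: chart_chart_inv)
    qed
    moreover have "\<forall>\<^sub>F w in at (0::complex). w \<noteq> 0" by (simp add: eventually_at_filter)
    ultimately have "\<forall>\<^sub>F w in at 0. g (chart_inv (\<kappa> k) w) = (- \<alpha> w * \<beta> (- w)) / w^2"
      using \<alpha>(3)
    proof eventually_elim
      case (elim w)
      have "exp (v k / w) * exp (v k / - w) = 1" by (simp flip: exp_add)
      then have "exp (v k / w) * \<alpha> w / w * (exp (v k / - w) * \<beta> (- w) / (- w)) = \<alpha> w / w * (\<beta> (- w) / (- w))"
        by (metis (no_types, lifting) mult.assoc mult.left_commute mult_1 times_divide_eq_right)
      then show ?case using elim by (simp add: g_def power2_eq_square)
    qed
    moreover have "(\<lambda>w. - \<alpha> w * \<beta> (- w)) analytic_on {0}"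
    proof -
      have "(\<beta> \<circ> uminus) analytic_on {0}"
        by (rule analytic_on_compose) (use \<beta>(1) in \<open>auto intro!: analytic_intros\<close>)
      then show ?thesis using \<alpha>(1) by (intro analytic_intros) (auto simp: o_def)
    qed
    ultimately show ?thesis using \<alpha>(2) \<beta>(2) by (intro exI[of _ "\<lambda>w. - \<alpha> w * \<beta> (- w)"]) auto
  qed
  have g: "meromorphic_fun g" unfolding meromorphic_fun_def
  proof
    fix p assume pX: "p \<in> topspace X"
    show "meromorphic_fun_at g p"
    proof (cases "p \<in> range P")
      case True
      then obtain k where k: "p = P k" by blast
      obtain \<gamma> where \<gamma>: "\<gamma> analytic_on {0}" "\<forall>\<^sub>F w in at 0. g (chart_inv (\<kappa> k) w) = \<gamma> w / w^2"
        using at_P by blast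
      have "(\<lambda>w. \<gamma> w / w^2) meromorphic_on {0}"
        by (intro meromorphic_intros analytic_on_imp_meromorphic_on \<gamma>(1))
      then have "(\<lambda>w. g (chart_inv (\<kappa> k) w)) meromorphic_on {0}"
        using \<gamma>(2) by (subst meromorphic_on_cong[OF _ refl]) auto
      then show ?thesis using meromorphic_fun_atI[OF \<kappa>'(1,2)] \<kappa>'(3) k by simp
    next
      case False
      obtain c where c: "c \<in> At" "p \<in> fst c" using chart_exists[OF pX] by blast
      show ?thesis by (rule meromorphic_fun_atI[OF c order_ge_meromorphic[OF g_order[OF False c]]])
    qed
  qed
  define \<eta> where "\<eta> = fmult g \<Omega>"
  have \<eta>: "meromorphic_form At \<eta>" unfolding \<eta>_def by (rule fmult_form[OF g \<Omega>])
  have res_T: "form_residue At \<eta> p = a p * b p * form_residue At \<Omega> p" if p: "p \<in> T" for p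
  proof -
    obtain c where c: "c \<in> At" "p \<in> fst c" using chart_exists p T by blast
    have "(\<lambda>w. b (chart_inv (\<sigma>_chart c) w)) analytic_on {snd c p}"
      using b(2)[OF p \<sigma>_chart_in[OF c(1)]] \<sigma>_chart_at(1,2)[OF c] T(4)[OF p] by simp
    then have "(\<lambda>w. b (\<sigma> (chart_inv c w))) analytic_on {snd c p}"
      using analytic_at_cong[OF \<sigma>_chart_at(3)[OF c]] by simp
    then have g_an: "(\<lambda>w. g (chart_inv c w)) analytic_on {snd c p}"
      unfolding g_def using a(2)[OF p c] by (intro analytic_intros)
    have "p \<notin> range P" using p T by blast
    then have "order_ge (\<Omega> c) (snd c p) (- 1)"
      using ord\<Omega>[OF c] T(4)[OF p] p by simp
    from residue_simple_mult[OF g_an this] show ?thesis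
      unfolding form_residue_chart[OF \<eta> c] form_residue_chart[OF \<Omega> c]
      using c T(4)[OF p] by (simp add: \<eta>_def fmult_def[abs_def] g_def)
  qed
  have res_P: "form_residue At \<eta> (P k) = - (\<mu> k * \<nu> k * form_linear_coeff \<Omega> (\<kappa> k))" for k
  proof -
    obtain \<gamma> where \<gamma>: "\<gamma> analytic_on {0}" "\<gamma> 0 = - \<mu> k * \<nu> k" "\<forall>\<^sub>F w in at 0. g (chart_inv (\<kappa> k) w) = \<gamma> w / w^2"
      using at_P by blast
    have "P k \<notin> T" using T(3) by blast
    \<comment> \<open>As \<sigma> fixes \<open>P k\<close>, both \<open>D\<close> and its image
      contribute \<open>d (P k)\<close>, and \<open>P\<close> contributes 1. The even surplus power
      goes into \<open>G1\<close>, so \<open>G1 0\<close> is the linear coefficient in every case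
      (it is 0 if \<open>D\<close> contains \<open>P k\<close>).\<close>
    then have "order_ge (\<Omega> (\<kappa> k)) 0 (2 * d (P k) + 1)"
      using ord\<Omega>[OF \<kappa>'(1,2), of k] \<kappa>'(3) dP[of k] P(2)[of k] by simp
    then obtain G where G: "G analytic_on {0}" "\<forall>\<^sub>F w in at 0. \<Omega> (\<kappa> k) w = w powi (2 * d (P k) + 1) * G w"
      unfolding order_ge_def by auto
    define G1 where "G1 w = w ^ nat (2 * d (P k)) * G w" for w
    have G1: "G1 analytic_on {0}" unfolding G1_def[abs_def] by (intro analytic_intros G(1))
    have \<Omega>1: "\<forall>\<^sub>F w in at 0. \<Omega> (\<kappa> k) w = w * G1 w"
      using G(2)
    proof eventually_elim
      case (elim w)
      have "nat (2 * d (P k) + 1) = Suc (nat (2 * d (P k)))" using dP[of k] by arith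
      then have "w powi (2 * d (P k) + 1) = w * w ^ nat (2 * d (P k))" using dP[of k] by (simp add: power_int_def)
      with elim show ?case by (simp add: G1_def)
    qed
    have "\<forall>\<^sub>F w in at (0::complex). w \<noteq> 0" by (simp add: eventually_at_filter)
    with \<gamma>(3) \<Omega>1 have "\<forall>\<^sub>F w in at 0. \<eta> (\<kappa> k) w = (w - 0) powi - 1 * (\<gamma> w * G1 w)"
      by eventually_elim (simp add: \<eta>_def fmult_def power2_eq_square power_int_minus field_simps)
    then have "residue (\<eta> (\<kappa> k)) 0 = \<gamma> 0 * G1 0"
      by (intro residue_order_minus_1 analytic_intros \<gamma>(1) G1)
    then show ?thesis
      using form_residue_chart[OF \<eta> \<kappa>'(1,2)] \<kappa>'(3) laurent_expansion_linear_coeff[OF G1 \<Omega>1] \<gamma>(2)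
      by (simp add: form_linear_coeff_def)
  qed
  \<comment> \<open>The lower bounds for the orders of \<open>g\<close> and \<Omega> are exactly
    opposite here, so the product form is regular, also at points where \<open>D\<close>,
    \<open>Z\<close> and their images overlap.\<close>
  have res_0: "form_residue At \<eta> p = 0" if pX: "p \<in> topspace X" and p: "p \<notin> T" "p \<notin> range P" for p
  proof -
    obtain c where c: "c \<in> At" "p \<in> fst c" using chart_exists[OF pX] by blast
    have "order_ge (\<eta> c) (snd c p) (z p - d p + (z (\<sigma> p) - d (\<sigma> p)) + (d p + d (\<sigma> p) - z p - z (\<sigma> p)))"
      using order_ge_mult[OF g_order[OF p(2) c] ord\<Omega>[OF c]] p by (simp add: \<eta>_def fmult_def[abs_def])
    then show ?thesis unfolding form_residue_chart[OF \<eta> c] by (rule residue_order_ge_0) simp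
  qed
  have "0 = total_residue \<eta>" using residue_theorem[OF comp x(1) \<eta> x(2)] by simp
  also have "\<dots> = (\<Sum>p\<in>T \<union> range P. form_residue At \<eta> p)"
    unfolding total_residue_def
    by (rule sum.mono_neutral_left) (use T(1,2) \<kappa>'(4) res_0 in auto)
  also have "\<dots> = (\<Sum>p\<in>T. form_residue At \<eta> p) + (\<Sum>p\<in>range P. form_residue At \<eta> p)"
    by (rule sum.union_disjoint) (use T in auto)
  also have "(\<Sum>p\<in>range P. form_residue At \<eta> p) = (\<Sum>k\<in>UNIV. form_residue At \<eta> (P k))"
    by (subst sum.reindex[OF P(1)]) simp
  finally show ?thesis by (simp add: res_T res_P sum_negf)
qed

end

section \<open>Baker--Akhiezer functions\<close>

lemma laurent_expansion_const_coeff: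
  assumes G: "G analytic_on {0}" "\<forall>\<^sub>F w in at 0. f w = G w"
  shows "fls_nth (laurent_expansion f 0) 0 = G 0"
proof -
  obtain F where F: "G has_fps_expansion F" using analytic_at_imp_has_fps_expansion_0[OF G(1)] by blast
  have "f has_laurent_expansion fps_to_fls F"
    using G(2) has_laurent_expansion_fps[OF F] by (subst has_laurent_expansion_cong[OF _ refl]) auto
  then have "laurent_expansion f 0 = fps_to_fls F" by (intro laurent_expansion_eqI) simp
  then show ?thesis using has_fps_expansion_imp_0_eq_fps_nth_0[OF F] by simp
qed

lemma order_ge_0_extend:
  assumes f: "order_ge f z 0" "f holomorphic_on ball z \<rho> - {z}"
  shows "\<exists>G. G holomorphic_on ball z \<rho> \<and> (\<forall>w\<in>ball z \<rho> - {z}. f w = G w)"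
proof -
  obtain G where G: "G analytic_on {z}" "\<forall>\<^sub>F w in at z. f w = G w"
    using f(1) unfolding order_ge_def by auto
  have "(G \<longlongrightarrow> G z) (at z)" using analytic_at_imp_isCont[OF G(1)] by (simp add: isCont_def)
  moreover have "\<forall>\<^sub>F w in at z. G w = f w" using G(2) by eventually_elim simp
  ultimately have "(f \<longlongrightarrow> G z) (at z)" by (rule Lim_transform_eventually)
  from removable_singularity[OF f(2) open_ball this]
  show ?thesis by (intro exI[of _ "\<lambda>y. if y = z then G z else f y"]) auto
qed

text \<open>If \<open>F\<close> had no zeros near 0, \<open>exp (\<delta> / w) = G w / F w\<close>
  would be meromorphic, hence have a limit or a pole at 0. But its modulus tends to infinity along
  the positive reals and to 0 along the negative ones.\<close>

lemma exp_inverse_essential: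
  assumes F: "F meromorphic_on {0}" and G: "G meromorphic_on {0}" and \<delta>: "\<delta> > 0"
    and eq: "\<forall>\<^sub>F w in at 0. exp (of_real \<delta> / w) * F w = G w"
  shows "\<not> (\<forall>\<^sub>F w in at 0. F w \<noteq> 0)"
proof
  assume nz: "\<forall>\<^sub>F w in at 0. F w \<noteq> 0"
  define e where "e w = exp (of_real \<delta> / w)" for w :: complex
  have eq': "\<forall>\<^sub>F w in at 0. e w = G w / F w" using nz eq by eventually_elim (auto simp: e_def field_simps)
  have "(\<lambda>w. G w / F w) meromorphic_on {0}" by (intro meromorphic_intros F G)
  then have "e meromorphic_on {0}"
    using eq' by (subst meromorphic_on_cong[OF _ refl]) auto
  then have "not_essential e 0" by (rule meromorphic_on_not_essential)
  have r: "filterlim complex_of_real (at 0) (at_right 0)" and l: "filterlim complex_of_real (at 0) (at_left 0)"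
    unfolding filterlim_at by (auto simp: eventually_at_filter intro!: tendsto_eq_intros)
  have nr: "norm (e (of_real t)) = exp (\<delta> / t)" for t by (simp add: e_def flip: of_real_divide)
  have right: "filterlim (\<lambda>t. norm (e (of_real t))) at_top (at_right 0)"
    unfolding nr using \<delta> by real_asymp
  have left: "((\<lambda>t. norm (e (of_real t))) \<longlongrightarrow> 0) (at_left 0)"
    unfolding nr using \<delta> by real_asymp
  from \<open>not_essential e 0\<close> consider c where "e \<midarrow>0\<rightarrow> c" | "is_pole e 0" unfolding not_essential_def by blast
  then show False
  proof cases
    case 1
    have "((\<lambda>t. norm (e (of_real t))) \<longlongrightarrow> norm c) (at_right 0)"
      by (rule tendsto_norm[OF filterlim_compose[OF 1 r]])
    from not_tendsto_and_filterlim_at_infinity[OF _ this filterlim_at_top_imp_at_infinity[OF right]]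
    show False by simp
  next
    case 2
    then have "filterlim (\<lambda>t. e (of_real t)) at_infinity (at_left 0)"
      unfolding is_pole_def by (rule filterlim_compose[OF _ l])
    from not_tendsto_and_filterlim_at_infinity[OF _ tendsto_norm_zero_cancel[OF left] this]
    show False by simp
  qed
qed

section \<open>Local behaviour of \<psi> and of its derivatives in the parameters\<close>

locale baker_akhiezer_data = riemann X At
  for X :: "'a topology" and At :: "'a chart set" +
  fixes P :: "'n::finite \<Rightarrow> 'a" and \<kappa> :: "'n \<Rightarrow> 'a chart" and D Z :: "'a \<Rightarrow>\<^sub>0 int" and r :: 'a
    and h :: complex and U :: "(real^'n) set" and \<psi> :: "real^'n \<Rightarrow> 'a \<Rightarrow> complex"
  assumes par: "\<And>k. local_parameter At (P k) (\<kappa> k)"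
    and BA: "baker_akhiezer X At P \<kappa> D r Z h U \<psi>"
begin

definition W where "W = topspace X - (range P \<union> Poly_Mapping.keys D)"

lemmas BA' = BA[unfolded baker_akhiezer_def Let_def, folded W_def]

lemma \<kappa>: "\<kappa> k \<in> At" "P k \<in> fst (\<kappa> k)" "snd (\<kappa> k) (P k) = 0"
  using par[of k] by (auto simp: local_parameter_def)

lemma P_in: "P k \<in> topspace X" using \<kappa> chart_subset by blast

lemma U_open: "open U" and r_W: "r \<in> W" and Z_W: "Poly_Mapping.keys Z \<subseteq> W" and h_nz: "h \<noteq> 0"
  using BA' by auto

lemma regular: "u \<in> U \<Longrightarrow> \<exists>F. regular_part \<psi> (\<kappa> j) j u has_laurent_expansion fps_to_fls F"
  and holo: "u \<in> U \<Longrightarrow> holomorphic_fun_on At W (\<psi> u)"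
  and D_ord: "u \<in> U \<Longrightarrow> p \<in> Poly_Mapping.keys D - range P \<Longrightarrow> fun_order_ge At (\<psi> u) p (- Poly_Mapping.lookup D p)"
  and norm_r: "u \<in> U \<Longrightarrow> \<psi> u r = h"
  and Z_ord: "u \<in> U \<Longrightarrow> p \<in> Poly_Mapping.keys Z \<Longrightarrow> \<psi> u p = 0 \<and> fun_order_ge At (\<psi> u) p (Poly_Mapping.lookup Z p)"
  and diff: "u \<in> U \<Longrightarrow> S \<in> W \<Longrightarrow> (\<lambda>t. \<psi> (u + t *\<^sub>R axis i 1) S) differentiable (at 0)"
  and cont0: "continuous_map (prod_topology (top_of_set U) (subtopology X W)) euclidean (\<lambda>(u, S). \<psi> u S)"
  and cont1: "continuous_map (prod_topology (top_of_set U) (subtopology X W)) euclidean (\<lambda>(u, S). partial_u i \<psi> u S)"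
  using BA' by auto

lemma W_sub: "W \<subseteq> topspace X" by (auto simp: W_def)

lemma open_minus_finite:
  assumes "finite A" shows "openin X (topspace X - A)"
proof -
  have "Hausdorff_space X" using rs by (auto simp: riemann_surface_def)
  then have "closedin X (A \<inter> topspace X)" using assms by (intro closedin_Hausdorff_finite) auto
  then have "openin X (topspace X - A \<inter> topspace X)" by blast
  moreover have "topspace X - A \<inter> topspace X = topspace X - A" by blast
  ultimately show ?thesis by simp
qed

lemma W_open: "openin X W" unfolding W_def by (rule open_minus_finite) simp

lemma punctured_in_W:
  assumes c: "c \<in> At" "p \<in> fst c"
  shows "\<exists>\<rho>>0. ball (snd c p) \<rho> \<subseteq> snd c ` fst c \<and> (\<forall>w\<in>ball (snd c p) \<rho> - {snd c p}. chart_inv c w \<in> W)"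
proof -
  let ?O = "topspace X - ((range P \<union> Poly_Mapping.keys D) - {p})"
  have pO: "p \<in> fst c \<inter> ?O" using c chart_subset by blast
  have "openin X ?O" by (rule open_minus_finite) simp
  then have "open (snd c ` (fst c \<inter> ?O))" using chart_open_map c by blast
  moreover have "snd c p \<in> snd c ` (fst c \<inter> ?O)" using pO by blast
  ultimately obtain \<rho> where \<rho>: "\<rho> > 0" "ball (snd c p) \<rho> \<subseteq> snd c ` (fst c \<inter> ?O)" by (meson open_contains_ball)
  have "chart_inv c w \<in> W" if w: "w \<in> ball (snd c p) \<rho> - {snd c p}" for w
  proof -
    obtain q where q: "q \<in> fst c \<inter> ?O" "w = snd c q" using w \<rho> by blast
    then have "q \<noteq> p" using w by auto
    then have "q \<in> W" using q by (auto simp: W_def)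
    then show ?thesis using q c by simp
  qed
  then show ?thesis using \<rho> by blast
qed

lemma chart_inv_continuous:
  assumes c: "c \<in> At" and B: "B \<subseteq> snd c ` fst c" "chart_inv c ` B \<subseteq> W"
  shows "continuous_map (top_of_set B) (subtopology X W) (chart_inv c)"
  unfolding continuous_map_in_subtopology
proof
  show "continuous_map (top_of_set B) X (chart_inv c)"
    unfolding continuous_map_def
  proof (intro conjI allI impI)
    show "chart_inv c \<in> topspace (top_of_set B) \<rightarrow> topspace X" using B W_sub by auto
    fix V assume V: "openin X V"
    have "{w \<in> B. chart_inv c w \<in> V} = B \<inter> snd c ` (fst c \<inter> V)"
      using B(1) c chart_inv_in[of _ c] chart_chart_inv[of _ c] by (auto 4 4 intro!: image_eqI)
    then show "openin (top_of_set B) {w \<in> topspace (top_of_set B). chart_inv c w \<in> V}"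
      using chart_open_map[OF c V] by auto
  qed
qed (use B in auto)

text \<open>Turns joint continuity on parameters times surface into joint continuity in a real time
  and a coordinate. The path \<open>v\<close> is a shift in one variable, or constant.\<close>

lemma continuous_on_local:
  assumes c: "c \<in> At" and B: "B \<subseteq> snd c ` fst c" "chart_inv c ` B \<subseteq> W"
    and v: "continuous_on I v" "v ` I \<subseteq> U"
    and f: "continuous_map (prod_topology (top_of_set U) (subtopology X W)) euclidean (\<lambda>(u, S). f u S)"
  shows "continuous_on (I \<times> B) (\<lambda>(t, w). f (v t) (chart_inv c w))"
proof -
  have 1: "continuous_map (prod_topology (top_of_set I) (top_of_set B)) (prod_topology (top_of_set U) (subtopology X W))
      (\<lambda>p. (v (fst p), chart_inv c (snd p)))"
  proof (rule continuous_map_pairedI)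
    have "continuous_map (top_of_set I) (top_of_set U) v" using v by (auto simp: continuous_map_in_subtopology)
    from continuous_map_compose[OF continuous_map_fst this]
    show "continuous_map (prod_topology (top_of_set I) (top_of_set B)) (top_of_set U) (\<lambda>p. v (fst p))"
      unfolding o_def .
    from continuous_map_compose[OF continuous_map_snd chart_inv_continuous[OF c B]]
    show "continuous_map (prod_topology (top_of_set I) (top_of_set B)) (subtopology X W) (\<lambda>p. chart_inv c (snd p))"
      unfolding o_def .
  qed
  have "continuous_map (prod_topology (top_of_set I) (top_of_set B)) euclidean (\<lambda>(t, w). f (v t) (chart_inv c w))"
    using continuous_map_compose[OF 1 f] by (simp add: o_def case_prod_unfold)
  then show ?thesis by (simp add: prod_topology_subtopology_eu)
qed

lemma \<psi>_analytic:
  assumes u: "u \<in> U" and c: "c \<in> At" "p \<in> fst c" and p: "p \<in> W"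
  shows "(\<lambda>w. \<psi> u (chart_inv c w)) analytic_on {snd c p}"
proof -
  have "(\<lambda>w. \<psi> u (chart_inv c w)) holomorphic_on snd c ` (fst c \<inter> W)"
    using holo[OF u] c unfolding holomorphic_fun_on_def by (auto simp: o_def)
  moreover have "open (snd c ` (fst c \<inter> W))" using chart_open_map W_open c by blast
  moreover have "snd c p \<in> snd c ` (fst c \<inter> W)" using c p by blast
  ultimately show ?thesis unfolding analytic_at by blast
qed

text \<open>The prescribed zeros lie in \<open>W\<close>, away from the poles, so at most one of the
  two multiplicities is nonzero at any point.\<close>

lemma \<psi>_order:
  assumes u: "u \<in> U" and c: "c \<in> At" "p \<in> fst c" and p: "p \<notin> range P"
  shows "order_ge (\<lambda>w. \<psi> u (chart_inv c w)) (snd c p) (Poly_Mapping.lookup Z p - Poly_Mapping.lookup D p)"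
proof -
  have pX: "p \<in> topspace X" using c chart_subset by blast
  have L: "order_ge (\<lambda>w. \<psi> u (chart_inv c w)) (snd c p) m" if f: "fun_order_ge At (\<psi> u) p m" for m
  proof -
    obtain F where "(\<lambda>w. \<psi> u (chart_inv c (snd c p + w))) has_laurent_expansion F" "F = 0 \<or> m \<le> fls_subdegree F"
      using f c unfolding fun_order_ge_def by blast
    then show ?thesis by (rule order_ge_laurent)
  qed
  consider "p \<in> Poly_Mapping.keys D" | "p \<in> Poly_Mapping.keys Z" "p \<notin> Poly_Mapping.keys D"
    | "p \<in> W" "p \<notin> Poly_Mapping.keys D" "p \<notin> Poly_Mapping.keys Z"
    using p pX by (auto simp: W_def)
  then show ?thesis
  proof cases
    case 1
    then have "p \<notin> Poly_Mapping.keys Z" using Z_W by (auto simp: W_def)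
    then show ?thesis using L[OF D_ord[OF u]] 1 p by (auto simp: in_keys_iff)
  next
    case 2
    then show ?thesis using L[OF conjunct2[OF Z_ord[OF u]]] by (auto simp: in_keys_iff)
  next
    case 3
    then show ?thesis using order_ge_analytic[OF \<psi>_analytic[OF u c]] by (auto simp: in_keys_iff)
  qed
qed

lemma \<psi>_at_P:
  assumes u: "u \<in> U"
  obtains F where "F analytic_on {0}" "F 0 = BA_leading_coeff \<psi> (\<kappa> k) k u"
    "\<forall>\<^sub>F w in at 0. regular_part \<psi> (\<kappa> k) k u w = F w"
    "\<forall>\<^sub>F w in at 0. \<psi> u (chart_inv (\<kappa> k) w) = exp (of_real (u $ k) / w) * F w"
proof -
  obtain F where F: "regular_part \<psi> (\<kappa> k) k u has_laurent_expansion fps_to_fls F" using regular[OF u] by blast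
  have "order_ge (regular_part \<psi> (\<kappa> k) k u) 0 0"
    by (rule order_ge_laurent[of _ _ "fps_to_fls F"]) (use F in \<open>simp_all add: fls_subdegree_fls_to_fps_gt0\<close>)
  then obtain G where G: "G analytic_on {0}" "\<forall>\<^sub>F w in at 0. regular_part \<psi> (\<kappa> k) k u w = G w"
    unfolding order_ge_def by auto
  have "\<forall>\<^sub>F w in at 0. \<psi> u (chart_inv (\<kappa> k) w) = exp (of_real (u $ k) / w) * G w"
    using G(2) by eventually_elim (auto simp: regular_part_def exp_minus field_simps)
  with G laurent_expansion_const_coeff[OF G] that show ?thesis by (simp add: BA_leading_coeff_def)
qed

abbreviation shift_u :: "real^'n \<Rightarrow> 'n \<Rightarrow> real \<Rightarrow> real^'n" where
  "shift_u u i t \<equiv> u + t *\<^sub>R axis i 1"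

lemma shift_in_U:
  assumes "u \<in> U" obtains \<delta> where "\<delta> > 0" "\<And>t. t \<in> {-\<delta>..\<delta>} \<Longrightarrow> shift_u u i t \<in> U"
proof -
  obtain e where e: "e > 0" "ball u e \<subseteq> U" using U_open assms open_contains_ball by blast
  have "shift_u u i t \<in> U" if "t \<in> {-(e/2)..e/2}" for t
  proof -
    have "dist u (shift_u u i t) = \<bar>t\<bar>" by (simp add: dist_norm norm_axis_1)
    also have "\<dots> < e" using that e by auto
    finally show ?thesis using e by auto
  qed
  then show ?thesis using that[of "e/2"] e by auto
qed

text \<open>Differentiability is given only at \<open>t = 0\<close>, but at every base point of
  \<open>U\<close>; translating the base point yields it at every \<open>t\<close>.\<close>

lemma \<psi>_deriv:
  assumes "shift_u u i t \<in> U" "S \<in> W"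
  shows "((\<lambda>t. \<psi> (shift_u u i t) S) has_vector_derivative partial_u i \<psi> (shift_u u i t) S) (at t)"
proof -
  have "((\<lambda>s. \<psi> (shift_u (shift_u u i t) i s) S) has_vector_derivative partial_u i \<psi> (shift_u u i t) S) (at 0)"
    unfolding partial_u_def using diff[OF assms] vector_derivative_works by blast
  then have "((\<lambda>s. \<psi> (shift_u (shift_u u i t) i s) S) has_vector_derivative partial_u i \<psi> (shift_u u i t) S) (at (t - t))"
    by simp
  moreover have "((\<lambda>s. s - t) has_vector_derivative 1) (at t)" by (auto intro!: derivative_eq_intros)
  ultimately have "((\<lambda>s. \<psi> (shift_u (shift_u u i t) i s) S) \<circ> (\<lambda>s. s - t) has_vector_derivative 1 *\<^sub>R partial_u i \<psi> (shift_u u i t) S) (at t)"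
    by (intro vector_diff_chain_at)
  moreover have "(\<lambda>s. \<psi> (shift_u (shift_u u i t) i s) S) \<circ> (\<lambda>s. s - t) = (\<lambda>s. \<psi> (shift_u u i s) S)"
    by (auto simp: fun_eq_iff algebra_simps)
  ultimately show ?thesis by simp
qed

text \<open>The multiplier \<open>m\<close> cancels the singularity of \<psi> at \<open>z\<close>
  for every time, so \<open>deriv_extends\<close> applies to the product, and the product rule
  produces the term with \<open>m'\<close>. Two multipliers are used: a power of the coordinate for
  zeros and poles, an exponential at the points of \<open>P\<close>.\<close>

lemma partial_extends:
  assumes u: "u \<in> U" and c: "c \<in> At" "p \<in> fst c" and z: "z = snd c p"
    and m: "\<And>t. m t holomorphic_on - {z}"
      "\<And>t w. w \<noteq> z \<Longrightarrow> ((\<lambda>t. m t w) has_vector_derivative m' t w) (at t)"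
      "continuous_on (UNIV \<times> - {z}) (\<lambda>(t, w). m t w)" "continuous_on (UNIV \<times> - {z}) (\<lambda>(t, w). m' t w)"
    and ord: "\<And>t. shift_u u i t \<in> U \<Longrightarrow> order_ge (\<lambda>w. m t w * \<psi> (shift_u u i t) (chart_inv c w)) z 0"
  shows "\<exists>G. G analytic_on {z} \<and>
     (\<forall>\<^sub>F w in at z. m 0 w * partial_u i \<psi> u (chart_inv c w) + m' 0 w * \<psi> u (chart_inv c w) = G w)"
proof -
  obtain \<delta> where \<delta>: "\<delta> > 0" "\<And>t. t \<in> {-\<delta>..\<delta>} \<Longrightarrow> shift_u u i t \<in> U" using shift_in_U[OF u] by metis
  obtain \<rho> where \<rho>: "\<rho> > 0" "ball z \<rho> \<subseteq> snd c ` fst c" "\<And>w. w \<in> ball z \<rho> - {z} \<Longrightarrow> chart_inv c w \<in> W"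
    using punctured_in_W[OF c] z by blast
  define B where "B = ball z \<rho> - {z}"
  have B: "B \<subseteq> snd c ` fst c" "chart_inv c ` B \<subseteq> W" using \<rho>(2,3) unfolding B_def by blast+
  have sc: "continuous_on {-\<delta>..\<delta>} (shift_u u i)" by (intro continuous_intros)
  have si: "shift_u u i ` {-\<delta>..\<delta>} \<subseteq> U" using \<delta> by blast
  have c0: "continuous_on ({-\<delta>..\<delta>} \<times> B) (\<lambda>(t, w). \<psi> (shift_u u i t) (chart_inv c w))"
    and c1: "continuous_on ({-\<delta>..\<delta>} \<times> B) (\<lambda>(t, w). partial_u i \<psi> (shift_u u i t) (chart_inv c w))"
    by (rule continuous_on_local[OF c(1) B sc si cont0], rule continuous_on_local[OF c(1) B sc si cont1])
  have "\<exists>G. G holomorphic_on ball z (\<rho>/2) \<and> (\<forall>w\<in>ball z (\<rho>/2) - {z}.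
     m 0 w * partial_u i \<psi> (shift_u u i 0) (chart_inv c w) + m' 0 w * \<psi> (shift_u u i 0) (chart_inv c w) = G w)"
  proof (rule deriv_extends[where \<phi> = "\<lambda>t w. m t w * \<psi> (shift_u u i t) (chart_inv c w)"
        and \<phi>' = "\<lambda>t w. m t w * partial_u i \<psi> (shift_u u i t) (chart_inv c w) + m' t w * \<psi> (shift_u u i t) (chart_inv c w)"])
    fix t assume t: "t \<in> {-\<delta>..\<delta>}"
    have "(\<lambda>w. \<psi> (shift_u u i t) (chart_inv c w)) holomorphic_on ball z \<rho> - {z}"
    proof (rule analytic_imp_holomorphic, subst analytic_on_analytic_at, intro ballI)
      fix w assume w: "w \<in> ball z \<rho> - {z}"
      then have wim: "w \<in> snd c ` fst c" using \<rho> by blast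
      have "(\<lambda>w. \<psi> (shift_u u i t) (chart_inv c w)) analytic_on {snd c (chart_inv c w)}"
        by (rule \<psi>_analytic[OF \<delta>(2)[OF t] c(1) chart_inv_in[OF wim] \<rho>(3)[OF w]])
      then show "(\<lambda>w. \<psi> (shift_u u i t) (chart_inv c w)) analytic_on {w}" using chart_chart_inv[OF wim] by simp
    qed
    then have "(\<lambda>w. m t w * \<psi> (shift_u u i t) (chart_inv c w)) holomorphic_on ball z \<rho> - {z}"
      by (intro holomorphic_intros holomorphic_on_subset[OF m(1)]) auto
    with ord[OF \<delta>(2)[OF t]]
    show "\<exists>G. G holomorphic_on ball z \<rho> \<and> (\<forall>w\<in>ball z \<rho> - {z}. m t w * \<psi> (shift_u u i t) (chart_inv c w) = G w)"
      by (rule order_ge_0_extend)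
  next
    fix t w assume t: "t \<in> {-\<delta>..\<delta>}" and w: "w \<in> ball z \<rho> - {z}"
    have "((\<lambda>t. m t w * \<psi> (shift_u u i t) (chart_inv c w)) has_vector_derivative
       (m t w * partial_u i \<psi> (shift_u u i t) (chart_inv c w) + m' t w * \<psi> (shift_u u i t) (chart_inv c w))) (at t)"
      by (intro has_vector_derivative_mult m(2) \<psi>_deriv[OF \<delta>(2)[OF t] \<rho>(3)[OF w]]) (use w in auto)
    then show "((\<lambda>t. m t w * \<psi> (shift_u u i t) (chart_inv c w)) has_vector_derivative
       (m t w * partial_u i \<psi> (shift_u u i t) (chart_inv c w) + m' t w * \<psi> (shift_u u i t) (chart_inv c w))) (at t within {-\<delta>..\<delta>})"
      by (rule has_vector_derivative_at_within)
  next
    have "continuous_on ({-\<delta>..\<delta>} \<times> B) (\<lambda>(t, w). m t w)" "continuous_on ({-\<delta>..\<delta>} \<times> B) (\<lambda>(t, w). m' t w)"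
      by (rule continuous_on_subset[OF m(3)], force simp: B_def, rule continuous_on_subset[OF m(4)], force simp: B_def)
    with c0 c1 have "continuous_on ({-\<delta>..\<delta>} \<times> B) (\<lambda>(t, w).
       m t w * partial_u i \<psi> (shift_u u i t) (chart_inv c w) + m' t w * \<psi> (shift_u u i t) (chart_inv c w))"
      unfolding case_prod_unfold by (intro continuous_intros)
    then show "continuous_on ({-\<delta>..\<delta>} \<times> (ball z \<rho> - {z})) (\<lambda>(t, w).
       m t w * partial_u i \<psi> (shift_u u i t) (chart_inv c w) + m' t w * \<psi> (shift_u u i t) (chart_inv c w))"
      unfolding B_def .
  qed (use \<delta> \<rho> in auto)
  then obtain G where G: "G holomorphic_on ball z (\<rho>/2)" "\<And>w. w \<in> ball z (\<rho>/2) - {z} \<Longrightarrow>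
     m 0 w * partial_u i \<psi> u (chart_inv c w) + m' 0 w * \<psi> u (chart_inv c w) = G w" by auto
  have "G analytic_on {z}" unfolding analytic_at using G(1) \<rho>(1) by (intro exI[of _ "ball z (\<rho>/2)"]) auto
  moreover have "\<forall>\<^sub>F w in at z. m 0 w * partial_u i \<psi> u (chart_inv c w) + m' 0 w * \<psi> u (chart_inv c w) = G w"
    unfolding eventually_at using G(2) \<rho>(1) by (intro exI[of _ "\<rho>/2"]) (auto simp: dist_commute)
  ultimately show ?thesis by blast
qed

lemma partial_order_ge:
  assumes u: "u \<in> U" and c: "c \<in> At" "p \<in> fst c"
    and ord: "\<And>u. u \<in> U \<Longrightarrow> order_ge (\<lambda>w. \<psi> u (chart_inv c w)) (snd c p) M"
  shows "order_ge (\<lambda>w. partial_u i \<psi> u (chart_inv c w)) (snd c p) M"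
proof -
  let ?z = "snd c p"
  \<comment> \<open>The power that makes \<psi> regular does not depend on time, whence the zero in
    place of \<open>m'\<close>.\<close>
  have "\<exists>G. G analytic_on {?z} \<and> (\<forall>\<^sub>F w in at ?z.
      (\<lambda>t w. (w - ?z) powi (- M)) 0 w * partial_u i \<psi> u (chart_inv c w) + (\<lambda>t w. 0) 0 w * \<psi> u (chart_inv c w) = G w)"
  proof (rule partial_extends[OF u c refl])
    fix t assume t: "shift_u u i t \<in> U"
    have "order_ge (\<lambda>w. (w - ?z) powi (- M)) ?z (- M)"
      unfolding order_ge_def by (intro exI[of _ "\<lambda>_. 1"]) auto
    from order_ge_mult[OF this ord[OF t]]
    show "order_ge (\<lambda>w. (w - ?z) powi (- M) * \<psi> (shift_u u i t) (chart_inv c w)) ?z 0" by simp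
  qed (auto intro!: holomorphic_intros continuous_intros simp: case_prod_unfold)
  then obtain G where G: "G analytic_on {?z}" "\<forall>\<^sub>F w in at ?z. (w - ?z) powi (- M) * partial_u i \<psi> u (chart_inv c w) = G w"
    by auto
  have "\<forall>\<^sub>F w in at ?z. w \<noteq> ?z" by (simp add: eventually_at_filter)
  with G(2) have "\<forall>\<^sub>F w in at ?z. partial_u i \<psi> u (chart_inv c w) = (w - ?z) powi M * G w"
  proof eventually_elim
    case (elim w)
    have "(w - ?z) powi M * (w - ?z) powi (- M) = 1" using elim by (simp flip: power_int_add)
    then show ?case using elim(1) by (metis mult.assoc mult_1)
  qed
  with G(1) show ?thesis unfolding order_ge_def by blast
qed

lemma partial_order:
  assumes u: "u \<in> U" and c: "c \<in> At" "p \<in> fst c" and p: "p \<notin> range P"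
  shows "order_ge (\<lambda>w. partial_u i \<psi> u (chart_inv c w)) (snd c p) (Poly_Mapping.lookup Z p - Poly_Mapping.lookup D p)"
  by (rule partial_order_ge[OF u c \<psi>_order[OF _ c p]])

text \<open>A nonnegative order leaves open a removable singularity, where the value at
  \<open>p\<close> could be wrong. The assumed continuity of the derivative in \<open>S\<close>,
  extracted by a constant path, excludes this.\<close>

lemma partial_analytic:
  assumes u: "u \<in> U" and c: "c \<in> At" "p \<in> fst c" and p: "p \<in> W"
  shows "(\<lambda>w. partial_u i \<psi> u (chart_inv c w)) analytic_on {snd c p}"
proof (rule meromorphic_at_isCont_imp_analytic)
  show "(\<lambda>w. partial_u i \<psi> u (chart_inv c w)) meromorphic_on {snd c p}"
    by (rule order_ge_meromorphic[OF partial_order_ge[OF u c order_ge_analytic[OF \<psi>_analytic[OF _ c p]]]])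
  let ?B = "snd c ` (fst c \<inter> W)"
  have B: "?B \<subseteq> snd c ` fst c" "chart_inv c ` ?B \<subseteq> W" using c by auto
  have "continuous_on ({0::real} \<times> ?B) (\<lambda>(t, w). partial_u i \<psi> u (chart_inv c w))"
    by (rule continuous_on_local[OF c(1) B _ _ cont1, where v="\<lambda>_. u"]) (use u in auto)
  then have "continuous_on ?B (\<lambda>w. (\<lambda>(t, w). partial_u i \<psi> u (chart_inv c w)) (0::real, w))"
    by (rule continuous_on_compose2) (auto intro!: continuous_intros)
  then have "continuous_on ?B (\<lambda>w. partial_u i \<psi> u (chart_inv c w))" by simp
  moreover have "open ?B" using chart_open_map W_open c by blast
  ultimately show "isCont (\<lambda>w. partial_u i \<psi> u (chart_inv c w)) (snd c p)"
    using c p continuous_on_eq_continuous_at by blast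
qed

lemma partial_at_P:
  assumes u: "u \<in> U"
  shows "\<exists>\<alpha>. \<alpha> analytic_on {0} \<and> \<alpha> 0 = of_bool (i = k) * BA_leading_coeff \<psi> (\<kappa> k) k u \<and>
    (\<forall>\<^sub>F w in at 0. partial_u i \<psi> u (chart_inv (\<kappa> k) w) = exp (of_real (u $ k) / w) * \<alpha> w / w)"
proof -
  \<comment> \<open>The rate at which \<open>u $ k\<close> changes when \<open>u\<close> moves in
    direction \<open>i\<close>. The exponential multiplier has to follow this motion, and its time
    derivative brings in \<open>e / w\<close>.\<close>
  define e :: real where "e = of_bool (i = k)"
  have ek: "shift_u u i t $ k = u $ k + t * e" for u t by (simp add: e_def axis_def)
  let ?m = "\<lambda>(t::real) w. exp (- ((of_real (u $ k) + of_real t * of_real e) / w))"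
  let ?m' = "\<lambda>(t::real) w. - (of_real e / w) * ?m t w"
  have "\<exists>G. G analytic_on {0} \<and> (\<forall>\<^sub>F w in at 0.
      ?m 0 w * partial_u i \<psi> u (chart_inv (\<kappa> k) w) + ?m' 0 w * \<psi> u (chart_inv (\<kappa> k) w) = G w)"
  proof (rule partial_extends[OF u \<kappa>(1,2)])
    fix t assume t: "shift_u u i t \<in> U"
    obtain F where F: "F analytic_on {0}" "\<forall>\<^sub>F w in at 0. regular_part \<psi> (\<kappa> k) k (shift_u u i t) w = F w"
      using \<psi>_at_P[OF t] by blast
    then have "order_ge (regular_part \<psi> (\<kappa> k) k (shift_u u i t)) 0 0"
      unfolding order_ge_def by (intro exI[of _ F]) auto
    then show "order_ge (\<lambda>w. ?m t w * \<psi> (shift_u u i t) (chart_inv (\<kappa> k) w)) 0 0"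
      unfolding regular_part_def ek by simp
  next
    fix t :: real and w :: complex assume "w \<noteq> 0"
    have "((\<lambda>x. exp (- ((of_real (u $ k) + x * of_real e) / w))) has_field_derivative ?m' t w) (at (of_real t))"
      using \<open>w \<noteq> 0\<close> by (auto intro!: derivative_eq_intros simp: field_simps)
    from has_vector_derivative_real_field[OF this]
    show "((\<lambda>t. ?m t w) has_vector_derivative ?m' t w) (at t)" by (simp add: o_def)
  qed (use \<kappa>(3) in \<open>auto intro!: holomorphic_intros continuous_intros simp: case_prod_unfold\<close>)
  then obtain G where G: "G analytic_on {0}" "\<forall>\<^sub>F w in at 0.
      ?m 0 w * partial_u i \<psi> u (chart_inv (\<kappa> k) w) + ?m' 0 w * \<psi> u (chart_inv (\<kappa> k) w) = G w" by blast
  obtain F where F: "F analytic_on {0}" "F 0 = BA_leading_coeff \<psi> (\<kappa> k) k u"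
      "\<forall>\<^sub>F w in at 0. \<psi> u (chart_inv (\<kappa> k) w) = exp (of_real (u $ k) / w) * F w"
    using \<psi>_at_P[OF u] by blast
  have "\<forall>\<^sub>F w in at (0::complex). w \<noteq> 0" by (simp add: eventually_at_filter)
  \<comment> \<open>Solving \<open>G = \<psi>\<^sub>i / E - (e / w) * F\<close>, with
    \<open>E\<close> the exponential, for the derivative \<open>\<psi>\<^sub>i\<close> gives
    \<open>E * (w * G + e * F) / w\<close>. The numerator at \<open>w = 0\<close> is
    \<open>e * F 0\<close>: the leading coefficient of \<psi> if \<open>i = k\<close>, and 0
    otherwise.\<close>
  with G(2) F(3) have "\<forall>\<^sub>F w in at 0. partial_u i \<psi> u (chart_inv (\<kappa> k) w) =
      exp (of_real (u $ k) / w) * (w * G w + of_real e * F w) / w"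
  proof eventually_elim
    case (elim w)
    define E where "E = exp (of_real (u $ k) / w)"
    have "E \<noteq> 0" by (simp add: E_def)
    have "exp (- (of_real (u $ k) / w)) = 1 / E" by (simp add: E_def exp_minus divide_inverse)
    then have "partial_u i \<psi> u (chart_inv (\<kappa> k) w) / E - of_real e / w * F w = G w"
      using elim(1,2) \<open>E \<noteq> 0\<close> unfolding E_def[symmetric] by simp
    then have "partial_u i \<psi> u (chart_inv (\<kappa> k) w) = E * (G w + of_real e / w * F w)"
      using \<open>E \<noteq> 0\<close> by (simp add: field_simps)
    then show ?case using elim(3) unfolding E_def[symmetric] by (simp add: field_simps)
  qed
  moreover have "(\<lambda>w. w * G w + of_real e * F w) analytic_on {0}" by (intro analytic_intros G F)
  moreover have "of_real e = (of_bool (i = k) :: complex)" by (simp add: e_def)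
  ultimately show ?thesis using F(2) by (intro exI[of _ "\<lambda>w. w * G w + of_real e * F w"]) auto
qed

end

section \<open>Nonvanishing of \<psi> and nonconstancy of its logarithmic derivative\<close>

lemma meromorphic_dichotomy:
  assumes "f meromorphic_on {z}"
  shows "(\<forall>\<^sub>F w in at z. f w = 0) \<or> (\<forall>\<^sub>F w in at z. f w \<noteq> 0)"
  using assms not_essential_frequently_0_imp_eventually_0[of f z]
  unfolding meromorphic_at_iff frequently_def by blast

lemma analytic_eq_at:
  assumes "f analytic_on {z}" "\<forall>\<^sub>F w in at z. f w = y"
  shows "f z = (y :: complex)"
proof -
  have "(f \<longlongrightarrow> f z) (at z)" using analytic_at_imp_isCont[OF assms(1)] by (simp add: isCont_def)
  moreover have "(f \<longlongrightarrow> y) (at z)" using assms(2) by (rule tendsto_eventually)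
  ultimately show ?thesis using tendsto_unique[OF at_neq_bot] by blast
qed

context baker_akhiezer_data begin

text \<open>The normalization fixes the value at \<open>r\<close> for all parameters. This is why no
  residue at \<open>r\<close> enters the identities for derivatives, although \<Omega> has a pole
  there.\<close>

lemma partial_r:
  assumes u: "u \<in> U" shows "partial_u i \<psi> u r = 0"
proof -
  obtain \<delta> where \<delta>: "\<delta> > 0" "\<And>t. t \<in> {-\<delta>..\<delta>} \<Longrightarrow> shift_u u i t \<in> U" using shift_in_U[OF u] by metis
  have "((\<lambda>t. \<psi> (shift_u u i t) r) has_vector_derivative 0) (at 0)"
    by (rule has_vector_derivative_transform_within_open[of "\<lambda>_. h" _ _ "{-\<delta><..<\<delta>}"])
       (use \<delta> norm_r in \<open>auto intro!: derivative_eq_intros\<close>)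
  then show ?thesis unfolding partial_u_def by (rule vector_derivative_at)
qed

text \<open>At a point of \<open>P\<close> the exponential has no zeros, so the dichotomy passes to
  \<psi> from its regular factor. By the identity theorem, vanishing near one point would spread to
  \<open>r\<close>, where the value is \<open>h\<close>.\<close>

lemma \<psi>_nonzero:
  assumes u: "u \<in> U" and p: "p \<in> topspace X"
  shows "\<forall>\<^sub>F q in atin X p. \<psi> u q \<noteq> 0"
proof -
  have dich: "(\<forall>\<^sub>F q in atin X p. \<psi> u q = 0) \<or> (\<forall>\<^sub>F q in atin X p. \<psi> u q \<noteq> 0)"
    if p: "p \<in> topspace X" for p
  proof (cases "p \<in> range P")
    case True
    then obtain k where k: "p = P k" by blast
    obtain F where F: "F analytic_on {0}"
      "\<forall>\<^sub>F w in at 0. \<psi> u (chart_inv (\<kappa> k) w) = exp (of_real (u $ k) / w) * F w"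
      using \<psi>_at_P[OF u] by blast
    have "(\<forall>\<^sub>F w in at 0. F w = 0) \<or> (\<forall>\<^sub>F w in at 0. F w \<noteq> 0)"
      using meromorphic_dichotomy analytic_on_imp_meromorphic_on[OF F(1)] by blast
    then have "(\<forall>\<^sub>F w in at 0. \<psi> u (chart_inv (\<kappa> k) w) = 0) \<or> (\<forall>\<^sub>F w in at 0. \<psi> u (chart_inv (\<kappa> k) w) \<noteq> 0)"
    proof (elim disjE)
      assume "\<forall>\<^sub>F w in at 0. F w = 0"
      with F(2) have "\<forall>\<^sub>F w in at 0. \<psi> u (chart_inv (\<kappa> k) w) = 0" by eventually_elim simp
      then show ?thesis ..
    next
      assume "\<forall>\<^sub>F w in at 0. F w \<noteq> 0"
      with F(2) have "\<forall>\<^sub>F w in at 0. \<psi> u (chart_inv (\<kappa> k) w) \<noteq> 0" by eventually_elim simp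
      then show ?thesis ..
    qed
    then show ?thesis
      unfolding k eventually_atin_chart[OF \<kappa>(1,2)] \<kappa>(3) .
  next
    case False
    obtain c where c: "c \<in> At" "p \<in> fst c" using chart_exists[OF p] by blast
    show ?thesis
      by (rule meromorphic_fun_at_dichotomy[OF p meromorphic_fun_atI[OF c order_ge_meromorphic[OF \<psi>_order[OF u c False]]]])
  qed
  have "\<not> (\<forall>\<^sub>F q in atin X p. \<psi> u q = 0)"
  proof
    assume 0: "\<forall>\<^sub>F q in atin X p. \<psi> u q = 0"
    have rX: "r \<in> topspace X" using r_W W_sub by blast
    then obtain c where c: "c \<in> At" "r \<in> fst c" using chart_exists by blast
    have "\<forall>\<^sub>F q in atin X r. \<psi> u q = 0" by (rule identity_theorem[OF dich p 0 rX])
    then have "\<forall>\<^sub>F w in at (snd c r). \<psi> u (chart_inv c w) = 0" using eventually_atin_chart[OF c] by simp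
    from analytic_eq_at[OF \<psi>_analytic[OF u c r_W] this] c norm_r[OF u] h_nz show False by simp
  qed
  with dich[OF p] show ?thesis by blast
qed

text \<open>At the points of \<open>P\<close> the function and its derivative carry the same
  exponential factor, and it cancels in the quotient.\<close>

lemma logderiv_meromorphic:
  assumes u: "u \<in> U" shows "meromorphic_fun (\<lambda>S. partial_u i \<psi> u S / \<psi> u S)"
  unfolding meromorphic_fun_def
proof
  fix p assume p: "p \<in> topspace X"
  show "meromorphic_fun_at (\<lambda>S. partial_u i \<psi> u S / \<psi> u S) p"
  proof (cases "p \<in> range P")
    case True
    then obtain k where k: "p = P k" by blast
    obtain F where F: "F analytic_on {0}"
      "\<forall>\<^sub>F w in at 0. \<psi> u (chart_inv (\<kappa> k) w) = exp (of_real (u $ k) / w) * F w"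
      using \<psi>_at_P[OF u] by blast
    obtain \<alpha> where \<alpha>: "\<alpha> analytic_on {0}"
      "\<forall>\<^sub>F w in at 0. partial_u i \<psi> u (chart_inv (\<kappa> k) w) = exp (of_real (u $ k) / w) * \<alpha> w / w"
      using partial_at_P[OF u] by blast
    have "\<forall>\<^sub>F w in at 0. \<alpha> w / w / F w = partial_u i \<psi> u (chart_inv (\<kappa> k) w) / \<psi> u (chart_inv (\<kappa> k) w)"
      using F(2) \<alpha>(2) by eventually_elim simp
    moreover have "(\<lambda>w. \<alpha> w / w / F w) meromorphic_on {0}"
      by (intro meromorphic_intros analytic_on_imp_meromorphic_on F(1) \<alpha>(1))
    ultimately have "(\<lambda>w. partial_u i \<psi> u (chart_inv (\<kappa> k) w) / \<psi> u (chart_inv (\<kappa> k) w)) meromorphic_on {0}"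
      by (subst (asm) meromorphic_on_cong[OF _ refl]) auto
    then show ?thesis unfolding k using meromorphic_fun_atI[OF \<kappa>(1,2)] \<kappa>(3) by simp
  next
    case False
    obtain c where c: "c \<in> At" "p \<in> fst c" using chart_exists[OF p] by blast
    show ?thesis
      by (rule meromorphic_fun_atI[OF c], intro meromorphic_intros order_ge_meromorphic[OF \<psi>_order[OF u c False]]
          order_ge_meromorphic[OF partial_order[OF u c False]])
  qed
qed

text \<open>If \<open>\<psi>\<^sub>u / \<psi>\<close> were constant for all \<open>u\<close>, the constant would be its value \<open>0\<close> at \<open>r\<close>, and
  \<open>\<psi>\<close> would not depend on the variable; the exponential factor at \<open>P\<close> excludes this.\<close>

lemma logderiv_nonconstant:
  assumes u0: "u0 \<in> U"
  shows "\<exists>u\<in>U. \<forall>y. \<forall>p\<in>topspace X. \<forall>\<^sub>F q in atin X p. partial_u i \<psi> u q / \<psi> u q \<noteq> y"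
proof (rule ccontr)
  assume contr: "\<not> ?thesis"
  have zero: "partial_u i \<psi> u S = 0" if u: "u \<in> U" and S: "S \<in> W" for u S
  proof -
    define x where "x q = partial_u i \<psi> u q / \<psi> u q" for q
    \<comment> \<open>The negated claim only says that the value \<open>y\<close> recurs arbitrarily
      close to \<open>p\<close>; the dichotomy upgrades this to equality near \<open>p\<close>, and
      the identity theorem to equality near every point.\<close>
    obtain y p where p: "p \<in> topspace X" "\<not> (\<forall>\<^sub>F q in atin X p. x q \<noteq> y)"
      using contr u unfolding x_def by blast
    have dich: "(\<forall>\<^sub>F q in atin X p. x q = y) \<or> (\<forall>\<^sub>F q in atin X p. x q \<noteq> y)" if "p \<in> topspace X" for p
      using meromorphic_fun_at_dichotomy[OF that] logderiv_meromorphic[OF u, of i] that unfolding meromorphic_fun_def x_def by blast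
    with p have y: "\<forall>\<^sub>F q in atin X p. x q = y" by blast
    have const: "\<forall>\<^sub>F q in atin X s. x q = y" if "s \<in> topspace X" for s
      by (rule identity_theorem[OF dich p(1) y that])
    have rX: "r \<in> topspace X" and SX: "S \<in> topspace X" using r_W S W_sub by auto
    obtain c where c: "c \<in> At" "r \<in> fst c" using chart_exists[OF rX] by blast
    have "(\<lambda>w. x (chart_inv c w)) analytic_on {snd c r}"
      unfolding x_def using c norm_r[OF u] h_nz
      by (intro analytic_intros partial_analytic[OF u c r_W] \<psi>_analytic[OF u c r_W]) auto
    moreover have "\<forall>\<^sub>F w in at (snd c r). x (chart_inv c w) = y"
      using const[OF rX] eventually_atin_chart[OF c] by simp
    ultimately have "x r = y" using analytic_eq_at c by fastforce
    then have "y = 0" using partial_r[OF u] by (simp add: x_def)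
    with const[OF SX] \<psi>_nonzero[OF u SX] have ev: "\<forall>\<^sub>F q in atin X S. partial_u i \<psi> u q = 0"
      by (auto elim: eventually_elim2 simp: x_def)
    obtain d where d: "d \<in> At" "S \<in> fst d" using chart_exists[OF SX] by blast
    have "\<forall>\<^sub>F w in at (snd d S). partial_u i \<psi> u (chart_inv d w) = 0"
      using ev eventually_atin_chart[OF d] by simp
    from analytic_eq_at[OF partial_analytic[OF u d S] this] d show ?thesis by simp
  qed
  obtain \<delta> where \<delta>: "\<delta> > 0" "\<And>t. t \<in> {-\<delta>..\<delta>} \<Longrightarrow> shift_u u0 i t \<in> U" using shift_in_U[OF u0] by metis
  define u1 where "u1 = shift_u u0 i \<delta>"
  have u1: "u1 \<in> U" using \<delta> by (simp add: u1_def)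
  have const: "\<psi> u1 S = \<psi> u0 S" if S: "S \<in> W" for S
  proof -
    obtain c where c: "\<And>t. t \<in> {0..\<delta>} \<Longrightarrow> \<psi> (shift_u u0 i t) S = c"
    proof (rule has_vector_derivative_zero_constant[of "{0..\<delta>}" "\<lambda>t. \<psi> (shift_u u0 i t) S"])
      fix t assume "t \<in> {0..\<delta>}"
      then have t: "shift_u u0 i t \<in> U" using \<delta> by auto
      show "((\<lambda>t. \<psi> (shift_u u0 i t) S) has_vector_derivative 0) (at t within {0..\<delta>})"
        using has_vector_derivative_at_within[OF \<psi>_deriv[OF t S]] zero[OF t S] by simp
    qed auto
    from c[of 0] c[of \<delta>] \<delta>(1) show ?thesis by (simp add: u1_def)
  qed
  \<comment> \<open>The contradiction is sought at \<open>P i\<close>, the point attached to the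
    variable that was moved: there the two exponents differ by \<open>\<delta> / w\<close> although
    the functions agree.\<close>
  obtain F0 where F0: "F0 analytic_on {0}"
    "\<forall>\<^sub>F w in at 0. \<psi> u0 (chart_inv (\<kappa> i) w) = exp (of_real (u0 $ i) / w) * F0 w"
    using \<psi>_at_P[OF u0] by blast
  obtain F1 where F1: "F1 analytic_on {0}"
    "\<forall>\<^sub>F w in at 0. \<psi> u1 (chart_inv (\<kappa> i) w) = exp (of_real (u1 $ i) / w) * F1 w"
    using \<psi>_at_P[OF u1] by blast
  have "\<forall>\<^sub>F w in at 0. chart_inv (\<kappa> i) w \<in> W"
  proof -
    obtain \<rho> where "\<rho> > 0" "\<And>w. w \<in> ball 0 \<rho> - {0} \<Longrightarrow> chart_inv (\<kappa> i) w \<in> W"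
      using punctured_in_W[OF \<kappa>(1,2)] \<kappa>(3) by metis
    then show ?thesis unfolding eventually_at by (intro exI[of _ \<rho>]) auto
  qed
  with F0(2) F1(2) have "\<forall>\<^sub>F w in at 0. exp (of_real \<delta> / w) * F1 w = F0 w"
  proof eventually_elim
    case (elim w)
    have "u1 $ i = u0 $ i + \<delta>" by (simp add: u1_def axis_def)
    then have "exp (of_real (u1 $ i) / w) = exp (of_real (u0 $ i) / w) * exp (of_real \<delta> / w)"
      by (simp add: add_divide_distrib flip: exp_add)
    then show ?case using elim const by simp
  qed
  then have "\<not> (\<forall>\<^sub>F w in at 0. F1 w \<noteq> 0)"
    by (intro exp_inverse_essential[of F1 F0 \<delta>] analytic_on_imp_meromorphic_on F0(1) F1(1) \<delta>(1))
  moreover have "\<forall>\<^sub>F w in at 0. \<psi> u1 (chart_inv (\<kappa> i) w) \<noteq> 0"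
    using \<psi>_nonzero[OF u1 P_in, of i] eventually_atin_chart[OF \<kappa>(1,2), of _ i] \<kappa>(3)[of i] by simp
  with F1(2) have "\<forall>\<^sub>F w in at 0. F1 w \<noteq> 0" by eventually_elim auto
  ultimately show False ..
qed

end

section \<open>The three identities\<close>

lemma lookup_sum_frag_of:
  "Poly_Mapping.lookup (\<Sum>i\<in>I. frag_of (f i)) p = (\<Sum>i\<in>I. of_bool (f i = p))"
  by (simp add: lookup_sum lookup_frag_of of_bool_def eq_commute)

lemma sum_of_bool_inj:
  assumes "finite I" "inj_on f I"
  shows "(\<Sum>i\<in>I. of_bool (f i = p)) = (of_bool (p \<in> f ` I) :: int)"
proof -
  have "(\<Sum>i\<in>I. of_bool (f i = p)) = (\<Sum>q\<in>f ` I. of_bool (q = p) :: int)"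
    by (subst sum.reindex[OF assms(2)]) simp
  also have "\<dots> = of_bool (p \<in> f ` I)" using assms(1) by (simp add: of_bool_def sum.delta)
  finally show ?thesis .
qed

theorem theorem1:
  fixes X :: "'a topology" and At :: "'a chart set" and g l :: nat
    and P :: "'n::finite \<Rightarrow> 'a" and \<kappa> :: "'n \<Rightarrow> 'a chart"
    and \<gamma> rr Q :: "nat \<Rightarrow> 'a" and r :: 'a
    and D Z \<sigma>D \<sigma>Z :: "'a \<Rightarrow>\<^sub>0 int"
    and \<psi> :: "real^'n \<Rightarrow> 'a \<Rightarrow> complex" and U :: "(real^'n) set" and h :: complex
    and \<sigma> :: "'a \<Rightarrow> 'a" and \<Omega> :: "'a chart \<Rightarrow> complex \<Rightarrow> complex"
    and A :: "nat \<Rightarrow> complex" and B :: complex and C :: "'n \<Rightarrow> complex"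
    and f :: "'n \<Rightarrow> real^'n \<Rightarrow> complex"
  assumes surface: "riemann_surface X At" "compact_space X" "has_genus X g"
    and points: "range P \<subseteq> topspace X" "\<gamma> ` {1..g + l} \<subseteq> topspace X"
      "rr ` {1..l} \<subseteq> topspace X" "r \<in> topspace X" "Q ` {1..CARD('n) + 1} \<subseteq> topspace X"
    and parameters: "\<And>i. local_parameter At (P i) (\<kappa> i)"
    and D: "D = (\<Sum>i=1..g + l. frag_of (\<gamma> i))"
    and Z: "Z = (\<Sum>i=1..l. frag_of (rr i))"
    and distinct: "inj P" "inj_on Q {1..CARD('n) + 1}" "range P \<inter> Q ` {1..CARD('n) + 1} = {}"
      "r \<notin> range P \<union> Q ` {1..CARD('n) + 1}"
    and general: "Q ` {1..CARD('n) + 1} \<inter> (\<gamma> ` {1..g + l} \<union> rr ` {1..l}) = {}"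
    and BA: "baker_akhiezer X At P \<kappa> D r Z h U \<psi>"
    and involution: "holomorphic_involution X At \<sigma>"
    and stationary: "\<And>k. k \<in> {1..CARD('n) + 1} \<Longrightarrow> \<sigma> (Q k) = Q k" "\<And>i. \<sigma> (P i) = P i" "\<sigma> r = r"
    and odd: "\<And>i. \<exists>N. openin X N \<and> P i \<in> N \<and> N \<subseteq> fst (\<kappa> i) \<and> \<sigma> ` N \<subseteq> fst (\<kappa> i) \<and>
                 (\<forall>S\<in>N. snd (\<kappa> i) (\<sigma> S) = - snd (\<kappa> i) S)"
    and \<sigma>D: "\<sigma>D = (\<Sum>i=1..g + l. frag_of (\<sigma> (\<gamma> i)))"
    and \<sigma>Z: "\<sigma>Z = (\<Sum>i=1..l. frag_of (\<sigma> (rr i)))"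
    and form: "meromorphic_form At \<Omega>"
      "form_divisor At \<Omega>
         (D + \<sigma>D + (\<Sum>i\<in>UNIV. frag_of (P i)) - (\<Sum>k=1..CARD('n) + 1. frag_of (Q k))
            - (frag_of r + Z) - \<sigma>Z)"
    and A: "\<And>k. k \<in> {1..CARD('n) + 1} \<Longrightarrow> A k = form_residue At \<Omega> (Q k)"
    and B: "B = form_residue At \<Omega> r"
    and C: "\<And>i. C i = form_linear_coeff \<Omega> (\<kappa> i)"
    and f: "\<And>j u. u \<in> U \<Longrightarrow> f j u = BA_leading_coeff \<psi> (\<kappa> j) j u"
  shows "\<forall>u\<in>U.
      (\<Sum>k=1..CARD('n) + 1. (\<psi> u (Q k))\<^sup>2 * A k) + h\<^sup>2 * B = 0 \<and>
      (\<forall>i j. i \<noteq> j \<longrightarrow>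
         (\<Sum>k=1..CARD('n) + 1. partial_u i \<psi> u (Q k) * partial_u j \<psi> u (Q k) * A k) = 0) \<and>
      (\<forall>i. (\<Sum>k=1..CARD('n) + 1. (partial_u i \<psi> u (Q k))\<^sup>2 * A k) = C i * (f i u)\<^sup>2)"
proof
  fix u assume u: "u \<in> U"
  interpret riemann_involution X At \<sigma> by standard (use surface(1) involution in auto)
  interpret baker_akhiezer_data X At P \<kappa> D Z r h U \<psi> by standard (use parameters BA in auto)
  let ?I = "{1..CARD('n) + 1}"
  define T where "T = insert r (Q ` ?I)"
  let ?d = "Poly_Mapping.lookup D" and ?z = "Poly_Mapping.lookup Z"
  have lookup_D: "?d p = (\<Sum>i=1..g+l. of_bool (\<gamma> i = p))" for p unfolding D by (rule lookup_sum_frag_of)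
  have lookup_Z: "?z p = (\<Sum>i=1..l. of_bool (rr i = p))" for p unfolding Z by (rule lookup_sum_frag_of)
  \<comment> \<open>By this equivalence the multiplicity of \<open>\<sigma>D\<close> at
    \<open>p\<close> is that of \<open>D\<close> at \<open>\<sigma> p\<close>, which brings the
    divisor of \<Omega> into the form \<open>residue_identity\<close> expects.\<close>
  have \<sigma>_eq: "\<sigma> q = p \<longleftrightarrow> q = \<sigma> p" if "q \<in> topspace X" "p \<in> topspace X" for p q
    using that by auto
  have lookup_\<sigma>D: "Poly_Mapping.lookup \<sigma>D p = ?d (\<sigma> p)" if "p \<in> topspace X" for p
    unfolding \<sigma>D lookup_sum_frag_of lookup_D
    by (rule sum.cong[OF refl], subst \<sigma>_eq) (use points that in auto)
  have lookup_\<sigma>Z: "Poly_Mapping.lookup \<sigma>Z p = ?z (\<sigma> p)" if "p \<in> topspace X" for p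
    unfolding \<sigma>Z lookup_sum_frag_of lookup_Z
    by (rule sum.cong[OF refl], subst \<sigma>_eq) (use points that in auto)
  have T_W: "T \<subseteq> W"
  proof -
    have "?d (Q k) = 0" if k: "k \<in> ?I" for k
    proof -
      have "\<gamma> i \<noteq> Q k" if "i \<in> {1..g+l}" for i using general k that by blast
      then show ?thesis unfolding lookup_D by (intro sum.neutral) auto
    qed
    then show ?thesis using r_W points distinct by (auto simp: T_def W_def in_keys_iff)
  qed
  have T_dz: "?d p = 0" "?z p = 0" if p: "p \<in> T" for p
  proof -
    show "?d p = 0" using T_W p by (auto simp: W_def in_keys_iff)
    \<comment> \<open>\<psi> vanishes on the support of \<open>Z\<close> but takes the value
      \<open>h\<close> at \<open>r\<close>, so \<open>r\<close> is none of the prescribed zeros and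
      the pole of \<Omega> at \<open>r\<close> stays simple.\<close>
    have "?z r = 0" using Z_ord[OF u, of r] norm_r[OF u] h_nz by (auto simp: in_keys_iff)
    moreover have "?z (Q k) = 0" if k: "k \<in> ?I" for k
    proof -
      have "rr i \<noteq> Q k" if "i \<in> {1..l}" for i using general k that by blast
      then show ?thesis unfolding lookup_Z by (intro sum.neutral) auto
    qed
    ultimately show "?z p = 0" using p by (auto simp: T_def)
  qed
  have T_\<sigma>: "\<sigma> p = p" if "p \<in> T" for p using that stationary by (auto simp: T_def)
  have ord: "order_ge (\<Omega> c) (snd c p) (?d p + ?d (\<sigma> p) - ?z p - ?z (\<sigma> p) + of_bool (p \<in> range P) - of_bool (p \<in> T))"
    if c: "c \<in> At" "p \<in> fst c" for p c
  proof -
    have pX: "p \<in> topspace X" using c chart_subset by blast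
    have "Poly_Mapping.lookup (\<Sum>i\<in>UNIV. frag_of (P i)) p = of_bool (p \<in> range P)"
      unfolding lookup_sum_frag_of using distinct(1) by (rule sum_of_bool_inj[OF finite])
    moreover have "Poly_Mapping.lookup (\<Sum>k\<in>?I. frag_of (Q k)) p = of_bool (p \<in> Q ` ?I)"
      unfolding lookup_sum_frag_of using distinct(2) by (rule sum_of_bool_inj[OF finite_atLeastAtMost])
    moreover have "Poly_Mapping.lookup (frag_of r) p + of_bool (p \<in> Q ` ?I) = of_bool (p \<in> T)"
      using distinct(4) by (auto simp: T_def lookup_frag_of)
    ultimately show ?thesis
      using form_order[OF form c] by (simp add: lookup_add lookup_minus lookup_\<sigma>D[OF pX] lookup_\<sigma>Z[OF pX] algebra_simps)
  qed
  have dP: "?d (P k) \<ge> 0 \<and> ?z (P k) = 0" for k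
  proof
    show "?d (P k) \<ge> 0" unfolding lookup_D by (intro sum_nonneg) auto
    show "?z (P k) = 0" using Z_W by (auto simp: W_def in_keys_iff)
  qed
  have odd': "\<forall>\<^sub>F S in atin X (P k). \<sigma> S \<in> fst (\<kappa> k) \<and> snd (\<kappa> k) (\<sigma> S) = - snd (\<kappa> k) S" for k
    using odd[of k] unfolding eventually_atin by blast
  \<comment> \<open>Any direction will do, and \<open>undefined\<close> names one, as the index type
    has an element. The auxiliary function is taken at \<open>u'\<close>, while the exponents in the
    identity below belong to \<open>u\<close>.\<close>
  obtain u' where u': "u' \<in> U" "\<And>y p. p \<in> topspace X \<Longrightarrow>
      \<forall>\<^sub>F q in atin X p. partial_u undefined \<psi> u' q / \<psi> u' q \<noteq> y"
    using logderiv_nonconstant[OF u] by blast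
  have T: "finite T" "T \<subseteq> topspace X" "T \<inter> range P = {}"
    using T_W by (auto simp: T_def W_def)
  note identity = residue_identity[OF surface(2) logderiv_meromorphic[OF u'(1)] u'(2) form(1) distinct(1) stationary(2)
      parameters odd' T _ ord dP, where v = "\<lambda>k. of_real (u $ k)"]
  \<comment> \<open>\<psi> itself has no factor \<open>1 / w\<close>; writing its regular part
    \<open>F\<close> as \<open>(w * F) / w\<close> fits it into the common scheme with leading
    coefficient 0, so the points of \<open>P\<close> contribute nothing to the first
    identity.\<close>
  have \<psi>P: "\<exists>\<alpha>. \<alpha> analytic_on {0} \<and> \<alpha> 0 = 0 \<and>
      (\<forall>\<^sub>F w in at 0. \<psi> u (chart_inv (\<kappa> k) w) = exp (of_real (u $ k) / w) * \<alpha> w / w)" for k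
  proof -
    obtain F where F: "F analytic_on {0}" "\<forall>\<^sub>F w in at 0. \<psi> u (chart_inv (\<kappa> k) w) = exp (of_real (u $ k) / w) * F w"
      using \<psi>_at_P[OF u] by blast
    have "\<forall>\<^sub>F w in at (0::complex). w \<noteq> 0" by (simp add: eventually_at_filter)
    with F(2) have "\<forall>\<^sub>F w in at 0. \<psi> u (chart_inv (\<kappa> k) w) = exp (of_real (u $ k) / w) * (w * F w) / w"
      by eventually_elim simp
    moreover have "(\<lambda>w. w * F w) analytic_on {0}" by (intro analytic_intros F(1))
    ultimately show ?thesis by (intro exI[of _ "\<lambda>w. w * F w"]) auto
  qed
  have sum_T: "(\<Sum>p\<in>T. a p * b p * form_residue At \<Omega> p) = a r * b r * B + (\<Sum>k\<in>?I. a (Q k) * b (Q k) * A k)" for a b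
  proof -
    have "(\<Sum>p\<in>T. a p * b p * form_residue At \<Omega> p) = a r * b r * B + (\<Sum>p\<in>Q ` ?I. a p * b p * form_residue At \<Omega> p)"
      unfolding T_def B using distinct(4) by (subst sum.insert) auto
    also have "(\<Sum>p\<in>Q ` ?I. a p * b p * form_residue At \<Omega> p) = (\<Sum>k\<in>?I. a (Q k) * b (Q k) * A k)"
      by (subst sum.reindex[OF distinct(2)], rule sum.cong) (use A in auto)
    finally show ?thesis .
  qed
  have T_fix: "\<sigma> p = p \<and> ?d p = 0 \<and> ?z p = 0" if "p \<in> T" for p using T_\<sigma> T_dz that by blast
  have TW: "p \<in> W" if "p \<in> T" for p using T_W that by blast
  have "(\<Sum>p\<in>T. \<psi> u p * \<psi> u p * form_residue At \<Omega> p) = (\<Sum>k\<in>UNIV. 0 * 0 * form_linear_coeff \<Omega> (\<kappa> k))"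
    by (rule identity[where a = "\<psi> u" and b = "\<psi> u" and \<mu> = "\<lambda>_. 0" and \<nu> = "\<lambda>_. 0"];
        (assumption | rule T_fix \<psi>P \<psi>_order[OF u] \<psi>_analytic[OF u _ _ TW]; assumption))
  then have 1: "(\<Sum>k\<in>?I. (\<psi> u (Q k))\<^sup>2 * A k) + h\<^sup>2 * B = 0"
    unfolding sum_T by (simp add: norm_r[OF u] power2_eq_square add.commute)
  \<comment> \<open>The second and third identities are the cases \<open>i \<noteq> j\<close> and
    \<open>i = j\<close> of one formula: \<open>P k\<close> contributes only if both derivatives
    produce the factor \<open>1 / w\<close> there, that is, if \<open>i = k\<close> and
    \<open>j = k\<close>.\<close>
  have 2: "(\<Sum>k\<in>?I. partial_u i \<psi> u (Q k) * partial_u j \<psi> u (Q k) * A k) = of_bool (i = j) * (C i * (f i u)\<^sup>2)" for i j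
  proof -
    have "(\<Sum>p\<in>T. partial_u i \<psi> u p * partial_u j \<psi> u p * form_residue At \<Omega> p) =
      (\<Sum>k\<in>UNIV. (of_bool (i = k) * BA_leading_coeff \<psi> (\<kappa> k) k u) * (of_bool (j = k) * BA_leading_coeff \<psi> (\<kappa> k) k u)
          * form_linear_coeff \<Omega> (\<kappa> k))"
      by (rule identity[where a = "partial_u i \<psi> u" and b = "partial_u j \<psi> u"
            and \<mu> = "\<lambda>k. of_bool (i = k) * BA_leading_coeff \<psi> (\<kappa> k) k u"
            and \<nu> = "\<lambda>k. of_bool (j = k) * BA_leading_coeff \<psi> (\<kappa> k) k u"];
          (assumption | rule T_fix partial_at_P[OF u] partial_order[OF u] partial_analytic[OF u _ _ TW]; assumption))
    also have "\<dots> = (\<Sum>k\<in>UNIV. if k = i then of_bool (i = j) * (C i * (f i u)\<^sup>2) else 0)"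
      by (rule sum.cong) (auto simp: f[OF u] C power2_eq_square)
    also have "\<dots> = of_bool (i = j) * (C i * (f i u)\<^sup>2)" by simp
    finally show ?thesis unfolding sum_T using partial_r[OF u] by simp
  qed
  show "(\<Sum>k\<in>?I. (\<psi> u (Q k))\<^sup>2 * A k) + h\<^sup>2 * B = 0 \<and>
      (\<forall>i j. i \<noteq> j \<longrightarrow> (\<Sum>k\<in>?I. partial_u i \<psi> u (Q k) * partial_u j \<psi> u (Q k) * A k) = 0) \<and>
      (\<forall>i. (\<Sum>k\<in>?I. (partial_u i \<psi> u (Q k))\<^sup>2 * A k) = C i * (f i u)\<^sup>2)"
    using 1 2 by (simp add: power2_eq_square)
qed

end
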